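(* Let $X$ be a locally compact $\sigma$-compact metric space with a positive Radon measure $\mu$ such that $\operatorname{supp}\mu=X$, let $\mathcal{E}$ be a local Dirichlet form on $L_2(X)$ such that $D(\mathcal{E})\cap C_c(X)$ is dense in $C_0(X)$ (supremum norm), and let $S$ be the submarkovian semigroup associated with $\mathcal{E}$. Let $\Omega$ be an open subset of $X$ and let $S^D$ be the semigroup on $L_2(\Omega)$ associated with the form $\mathcal{E}_D$ ($\mathcal{E}$ with Dirichlet boundary conditions on $\partial\Omega$). Consider the following conditions. I. $S^D$ is conservative, i.e. $S^D_t\mathbf{1}_\Omega=\mathbf{1}_\Omega$ for all $t>0$. II. $S_t\varphi=S^D_t\varphi$ for all $\varphi\in L_2(\Omega)$ and $t>0$. III. $\operatorname{cap}_\Omega(\partial\Omega)=0$. Then I $\Rightarrow$ II $\Rightarrow$ III. In particular, each of Conditions I and II implies that $L_2(\Omega)$ is $S$-invariant, i.e. $S_tL_2(\Omega)\subseteq L_2(\Omega)$ for all $t>0$. Moreover, if $S$ is conservative (i.e. $S_t\mathbf{1}=\mathbf{1}$ for all $t>0$), then II $\Rightarrow$ I. Finally, if $\mathcal{E}$ is regular, then III $\Rightarrow$ II.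
   Context: Functions are real-valued and $L_p(X)=L_p(X,\mu)$. $C_c(X)$ is the space of continuous functions with compact support and $C_0(X)$ the space of continuous functions vanishing at infinity. For measurable $\Omega\subseteq X$, $L_2(\Omega)$ is identified with $\{\mathbf{1}_\Omega\varphi:\varphi\in L_2(X)\}\subseteq L_2(X)$. The support of an $L_2$-function is its measure-theoretic (essential, closed) support. A Dirichlet form $\mathcal{E}$ on $L_2(X)$ is a densely defined, closed, positive symmetric form with domain $D(\mathcal{E})$ such that $0\vee\varphi\wedge\mathbf{1}\in D(\mathcal{E})$ and $\mathcal{E}(0\vee\varphi\wedge\mathbf{1})\le\mathcal{E}(\varphi)$ for all $\varphi\in D(\mathcal{E})$; here $\mathcal{E}(\varphi)=\mathcal{E}(\varphi,\varphi)$. The graph norm is $\|\varphi\|_{D(\mathcal{E})}=(\mathcal{E}(\varphi)+\|\varphi\|_2^2)^{1/2}$. The form is local if $\mathcal{E}(\psi,\varphi)=0$ for all $\varphi,\psi\in D(\mathcal{E})$ with $\varphi\psi=0$. It is regular if $D(\mathcal{E})\cap C_c(X)$ is dense both in $D(\mathcal{E})$ with the graph norm and in $C_0(X)$ with the supremum norm. The semigroup associated with $\mathcal{E}$ is $S_t=e^{-tH}$, where $H$ is the positive self-adjoint operator associated with $\mathcal{E}$. Submarkovian semigroups extend to all the $L_p$-spaces, including $L_\infty$ (on $L_\infty$ the extension of $S_t$ is the adjoint of its extension to $L_1$). For open $\Omega\subseteq X$ let $D_\Omega=\{\varphi\in D(\mathcal{E}):\operatorname{supp}\varphi\text{ is a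 compact subset of }\Omega\}$ and let $\overline{D_\Omega}$ be its closure in $D(\mathcal{E})$ with respect to the graph norm (then $\overline{D_\Omega}\subseteq L_2(\Omega)$). The form $\mathcal{E}_D$ on $L_2(\Omega)$ is the restriction $\mathcal{E}_D=\mathcal{E}|_{\overline{D_\Omega}}$ with domain $D(\mathcal{E}_D)=\overline{D_\Omega}$; it is a Dirichlet form on $L_2(\Omega)$, and $S^D$ is its associated semigroup on $L_2(\Omega)$. For $A\subseteq\overline\Omega$ the relative capacity $\operatorname{cap}_\Omega(A)\in[0,\infty]$ is the infimum of $\|\varphi\|_{D(\mathcal{E})}^2$ over all $\varphi\in D(\mathcal{E})$ for which there exists an open $V\subseteq X$ with $A\subseteq V$ and $\varphi\ge\mathbf{1}$ a.e. on $V\cap\Omega$. *)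

theory Defs
  imports "HOL-Analysis.Analysis"
begin

section \<open>Measures on topological spaces\<close>

definition radon_measure :: "'a::topological_space measure \<Rightarrow> bool" where
  "radon_measure M \<longleftrightarrow> sets M = sets borel \<and>
     (\<forall>K. compact K \<longrightarrow> emeasure M K < \<infinity>) \<and>
     (\<forall>B\<in>sets M. emeasure M B = (SUP K\<in>{K. compact K \<and> K \<subseteq> B}. emeasure M K))"

definition measure_support :: "'a::topological_space measure \<Rightarrow> 'a set" where
  "measure_support M = {x. \<forall>U. open U \<and> x \<in> U \<longrightarrow> emeasure M U > 0}"

definition ess_support :: "'a::topological_space measure \<Rightarrow> ('a \<Rightarrow> real) \<Rightarrow> 'a set" where
  "ess_support M f = {x. \<forall>U. open U \<and> x \<in> U \<longrightarrow> \<not> (AE y in M. y \<in> U \<longrightarrow> f y = 0)}"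

definition sigma_compact :: "'a::topological_space set \<Rightarrow> bool" where
  "sigma_compact A \<longleftrightarrow> (\<exists>K::nat \<Rightarrow> 'a set. (\<forall>n. compact (K n)) \<and> A = (\<Union>n. K n))"

section \<open>Function spaces\<close>

definition Cc_space :: "('a::topological_space \<Rightarrow> real) set" where
  "Cc_space = {f. continuous_on UNIV f \<and> compact (closure {x. f x \<noteq> 0})}"

definition C0_space :: "('a::topological_space \<Rightarrow> real) set" where
  "C0_space = {f. continuous_on UNIV f \<and>
     (\<forall>e>0. \<exists>K. compact K \<and> (\<forall>x. x \<notin> K \<longrightarrow> \<bar>f x\<bar> < e))}"

text \<open>An element of a Lebesgue space is represented by all measurable members of its
  almost-everywhere class. The spaces over \<open>\<Omega>\<close> are regarded as subspaces of those over
  the whole space: they consist of the functions vanishing almost everywhere off \<open>\<Omega>\<close>, i.e.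
  those a.e. equal to their product with the indicator function of \<open>\<Omega>\<close>.
  The spaces over all of \<open>X\<close> are obtained for \<open>\<Omega> = UNIV\<close>.\<close>

definition L1_space :: "'a measure \<Rightarrow> 'a set \<Rightarrow> ('a \<Rightarrow> real) set" where
  "L1_space M \<Omega> = {f. integrable M f \<and> (AE x in M. x \<notin> \<Omega> \<longrightarrow> f x = 0)}"

definition L2_space :: "'a measure \<Rightarrow> 'a set \<Rightarrow> ('a \<Rightarrow> real) set" where
  "L2_space M \<Omega> = {f \<in> borel_measurable M. integrable M (\<lambda>x. (f x)\<^sup>2) \<and>
     (AE x in M. x \<notin> \<Omega> \<longrightarrow> f x = 0)}"

definition Linf_space :: "'a measure \<Rightarrow> 'a set \<Rightarrow> ('a \<Rightarrow> real) set" where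
  "Linf_space M \<Omega> = {f \<in> borel_measurable M. (\<exists>C. AE x in M. \<bar>f x\<bar> \<le> C) \<and>
     (AE x in M. x \<notin> \<Omega> \<longrightarrow> f x = 0)}"

definition L1_norm :: "'a measure \<Rightarrow> ('a \<Rightarrow> real) \<Rightarrow> real" where
  "L1_norm M f = (\<integral>x. \<bar>f x\<bar> \<partial>M)"

definition L2_norm :: "'a measure \<Rightarrow> ('a \<Rightarrow> real) \<Rightarrow> real" where
  "L2_norm M f = sqrt (\<integral>x. (f x)\<^sup>2 \<partial>M)"

section \<open>Dirichlet forms\<close>

text \<open>A form is given by its domain \<open>D\<close> and a function \<open>E\<close>, whose values outside \<open>D\<close>
  are irrelevant.\<close>

definition graph_norm ::
  "'a measure \<Rightarrow> (('a \<Rightarrow> real) \<Rightarrow> ('a \<Rightarrow> real) \<Rightarrow> real) \<Rightarrow> ('a \<Rightarrow> real) \<Rightarrow> real" where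
  "graph_norm M E u = sqrt (E u u + (L2_norm M u)\<^sup>2)"

text \<open>The second and third conjuncts say that the form lives on almost-everywhere classes.\<close>

definition positive_symmetric_form ::
  "'a measure \<Rightarrow> ('a \<Rightarrow> real) set \<Rightarrow> (('a \<Rightarrow> real) \<Rightarrow> ('a \<Rightarrow> real) \<Rightarrow> real) \<Rightarrow> bool" where
  "positive_symmetric_form M D E \<longleftrightarrow>
     D \<subseteq> L2_space M UNIV \<and>
     (\<forall>u\<in>D. \<forall>v\<in>borel_measurable M. (AE x in M. u x = v x) \<longrightarrow> v \<in> D) \<and>
     (\<forall>u\<in>D. \<forall>v\<in>D. \<forall>w\<in>D. (AE x in M. u x = v x) \<longrightarrow> E u w = E v w) \<and>
     (\<lambda>x. 0) \<in> D \<and>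
     (\<forall>u\<in>D. \<forall>v\<in>D. (\<lambda>x. u x + v x) \<in> D) \<and>
     (\<forall>c. \<forall>u\<in>D. (\<lambda>x. c * u x) \<in> D) \<and>
     (\<forall>u\<in>D. \<forall>v\<in>D. \<forall>w\<in>D. E (\<lambda>x. u x + v x) w = E u w + E v w) \<and>
     (\<forall>c. \<forall>u\<in>D. \<forall>w\<in>D. E (\<lambda>x. c * u x) w = c * E u w) \<and>
     (\<forall>u\<in>D. \<forall>v\<in>D. E u v = E v u) \<and>
     (\<forall>u\<in>D. E u u \<ge> 0)"

definition densely_defined :: "'a measure \<Rightarrow> ('a \<Rightarrow> real) set \<Rightarrow> bool" where
  "densely_defined M D \<longleftrightarrow>
     (\<forall>f\<in>L2_space M UNIV. \<forall>e>0. \<exists>u\<in>D. L2_norm M (\<lambda>x. f x - u x) < e)"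

definition closed_form ::
  "'a measure \<Rightarrow> ('a \<Rightarrow> real) set \<Rightarrow> (('a \<Rightarrow> real) \<Rightarrow> ('a \<Rightarrow> real) \<Rightarrow> real) \<Rightarrow> bool" where
  "closed_form M D E \<longleftrightarrow>
     (\<forall>u. (\<forall>n::nat. u n \<in> D) \<and>
          (\<forall>e>0. \<exists>N. \<forall>m\<ge>N. \<forall>n\<ge>N. graph_norm M E (\<lambda>x. u m x - u n x) < e) \<longrightarrow>
          (\<exists>v\<in>D. (\<lambda>n. graph_norm M E (\<lambda>x. u n x - v x)) \<longlonglongrightarrow> 0))"

definition dirichlet_form ::
  "'a measure \<Rightarrow> ('a \<Rightarrow> real) set \<Rightarrow> (('a \<Rightarrow> real) \<Rightarrow> ('a \<Rightarrow> real) \<Rightarrow> real) \<Rightarrow> bool" where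
  "dirichlet_form M D E \<longleftrightarrow>
     positive_symmetric_form M D E \<and> densely_defined M D \<and> closed_form M D E \<and>
     (\<forall>u\<in>D. (\<lambda>x. min (max 0 (u x)) 1) \<in> D \<and>
        E (\<lambda>x. min (max 0 (u x)) 1) (\<lambda>x. min (max 0 (u x)) 1) \<le> E u u)"

definition local_form ::
  "'a measure \<Rightarrow> ('a \<Rightarrow> real) set \<Rightarrow> (('a \<Rightarrow> real) \<Rightarrow> ('a \<Rightarrow> real) \<Rightarrow> real) \<Rightarrow> bool" where
  "local_form M D E \<longleftrightarrow>
     (\<forall>u\<in>D. \<forall>v\<in>D. (AE x in M. u x * v x = 0) \<longrightarrow> E v u = 0)"

definition dense_in_C0 :: "('a::topological_space \<Rightarrow> real) set \<Rightarrow> bool" where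
  "dense_in_C0 A \<longleftrightarrow> (\<forall>f\<in>C0_space. \<forall>e>0. \<exists>g\<in>A. \<forall>x. \<bar>f x - g x\<bar> \<le> e)"

definition regular_form ::
  "'a::topological_space measure \<Rightarrow> ('a \<Rightarrow> real) set \<Rightarrow>
     (('a \<Rightarrow> real) \<Rightarrow> ('a \<Rightarrow> real) \<Rightarrow> real) \<Rightarrow> bool" where
  "regular_form M D E \<longleftrightarrow>
     (\<forall>u\<in>D. \<forall>e>0. \<exists>v\<in>D \<inter> Cc_space. graph_norm M E (\<lambda>x. u x - v x) < e) \<and>
     dense_in_C0 (D \<inter> Cc_space)"

definition compact_support_domain ::
  "'a::topological_space measure \<Rightarrow> ('a \<Rightarrow> real) set \<Rightarrow> 'a set \<Rightarrow> ('a \<Rightarrow> real) set" where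
  "compact_support_domain M D \<Omega> =
     {u\<in>D. compact (ess_support M u) \<and> ess_support M u \<subseteq> \<Omega>}"

text \<open>The domain of the form with Dirichlet boundary conditions; the form itself is the
  restriction of \<open>E\<close> to this domain.\<close>

definition dirichlet_domain ::
  "'a::topological_space measure \<Rightarrow> ('a \<Rightarrow> real) set \<Rightarrow>
     (('a \<Rightarrow> real) \<Rightarrow> ('a \<Rightarrow> real) \<Rightarrow> real) \<Rightarrow> 'a set \<Rightarrow> ('a \<Rightarrow> real) set" where
  "dirichlet_domain M D E \<Omega> =
     {u\<in>D. \<forall>e>0. \<exists>v\<in>compact_support_domain M D \<Omega>. graph_norm M E (\<lambda>x. u x - v x) < e}"

definition rel_cap ::
  "'a::topological_space measure \<Rightarrow> ('a \<Rightarrow> real) set \<Rightarrow>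
     (('a \<Rightarrow> real) \<Rightarrow> ('a \<Rightarrow> real) \<Rightarrow> real) \<Rightarrow> 'a set \<Rightarrow> 'a set \<Rightarrow> ennreal" where
  "rel_cap M D E \<Omega> A =
     (INF u\<in>{u\<in>D. \<exists>V. open V \<and> A \<subseteq> V \<and> (AE x in M. x \<in> V \<inter> \<Omega> \<longrightarrow> u x \<ge> 1)}.
        ennreal ((graph_norm M E u)\<^sup>2))"

section \<open>Semigroups\<close>

text \<open>Operators act on representatives; linearity is meant up to null sets.
  A bounded operator automatically respects almost-everywhere classes.\<close>

definition bounded_operator ::
  "'a measure \<Rightarrow> ('a \<Rightarrow> real) set \<Rightarrow> (('a \<Rightarrow> real) \<Rightarrow> real) \<Rightarrow>
     (('a \<Rightarrow> real) \<Rightarrow> ('a \<Rightarrow> real)) \<Rightarrow> bool" where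
  "bounded_operator M V N T \<longleftrightarrow>
     (\<forall>u\<in>V. T u \<in> V) \<and>
     (\<forall>u\<in>V. \<forall>v\<in>V. AE x in M. T (\<lambda>y. u y + v y) x = T u x + T v x) \<and>
     (\<forall>c. \<forall>u\<in>V. AE x in M. T (\<lambda>y. c * u y) x = c * T u x) \<and>
     (\<exists>C. \<forall>u\<in>V. N (T u) \<le> C * N u)"

definition C0_semigroup ::
  "'a measure \<Rightarrow> 'a set \<Rightarrow> (real \<Rightarrow> ('a \<Rightarrow> real) \<Rightarrow> ('a \<Rightarrow> real)) \<Rightarrow> bool" where
  "C0_semigroup M \<Omega> S \<longleftrightarrow>
     (\<forall>t\<ge>0. bounded_operator M (L2_space M \<Omega>) (L2_norm M) (S t)) \<and>
     (\<forall>u\<in>L2_space M \<Omega>. AE x in M. S 0 u x = u x) \<and>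
     (\<forall>s\<ge>0. \<forall>t\<ge>0. \<forall>u\<in>L2_space M \<Omega>. AE x in M. S (s + t) u x = S s (S t u) x) \<and>
     (\<forall>u\<in>L2_space M \<Omega>. ((\<lambda>t. L2_norm M (\<lambda>x. S t u x - u x)) \<longlongrightarrow> 0) (at_right 0))"

text \<open>The (graph of the) generator of a semigroup on \<open>L2_space M \<Omega>\<close>.\<close>

definition generator ::
  "'a measure \<Rightarrow> 'a set \<Rightarrow> (real \<Rightarrow> ('a \<Rightarrow> real) \<Rightarrow> ('a \<Rightarrow> real)) \<Rightarrow>
     ('a \<Rightarrow> real) \<Rightarrow> ('a \<Rightarrow> real) \<Rightarrow> bool" where
  "generator M \<Omega> S u f \<longleftrightarrow> u \<in> L2_space M \<Omega> \<and> f \<in> L2_space M \<Omega> \<and>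
     ((\<lambda>t. L2_norm M (\<lambda>x. (S t u x - u x) / t - f x)) \<longlongrightarrow> 0) (at_right 0)"

text \<open>The (graph of the) operator \<open>H\<close> on \<open>L2_space M \<Omega>\<close> associated with a form:
  \<open>H u = f\<close> iff \<open>E u v\<close> equals the inner product of \<open>f\<close> and \<open>v\<close> for all \<open>v\<close> in the
  form domain.\<close>

definition form_operator ::
  "'a measure \<Rightarrow> 'a set \<Rightarrow> ('a \<Rightarrow> real) set \<Rightarrow>
     (('a \<Rightarrow> real) \<Rightarrow> ('a \<Rightarrow> real) \<Rightarrow> real) \<Rightarrow> ('a \<Rightarrow> real) \<Rightarrow> ('a \<Rightarrow> real) \<Rightarrow> bool" where
  "form_operator M \<Omega> D E u f \<longleftrightarrow> u \<in> D \<and> f \<in> L2_space M \<Omega> \<and>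
     (\<forall>v\<in>D. E u v = (\<integral>x. f x * v x \<partial>M))"

text \<open>\<open>S t = exp (- t H)\<close>, understood as the strongly continuous semigroup generated
  by \<open>- H\<close> (which is unique up to null sets).\<close>

definition associated_semigroup ::
  "'a measure \<Rightarrow> 'a set \<Rightarrow> ('a \<Rightarrow> real) set \<Rightarrow>
     (('a \<Rightarrow> real) \<Rightarrow> ('a \<Rightarrow> real) \<Rightarrow> real) \<Rightarrow>
     (real \<Rightarrow> ('a \<Rightarrow> real) \<Rightarrow> ('a \<Rightarrow> real)) \<Rightarrow> bool" where
  "associated_semigroup M \<Omega> D E S \<longleftrightarrow>
     C0_semigroup M \<Omega> S \<and>
     (\<forall>u f. form_operator M \<Omega> D E u f \<longleftrightarrow> generator M \<Omega> S u (\<lambda>x. - f x))"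

definition L1_extension ::
  "'a measure \<Rightarrow> 'a set \<Rightarrow> (('a \<Rightarrow> real) \<Rightarrow> ('a \<Rightarrow> real)) \<Rightarrow>
     (('a \<Rightarrow> real) \<Rightarrow> ('a \<Rightarrow> real)) \<Rightarrow> bool" where
  "L1_extension M \<Omega> T T1 \<longleftrightarrow>
     bounded_operator M (L1_space M \<Omega>) (L1_norm M) T1 \<and>
     (\<forall>f\<in>L1_space M \<Omega> \<inter> L2_space M \<Omega>. AE x in M. T1 f x = T f x)"

definition Linf_extension ::
  "'a measure \<Rightarrow> 'a set \<Rightarrow> (('a \<Rightarrow> real) \<Rightarrow> ('a \<Rightarrow> real)) \<Rightarrow>
     (('a \<Rightarrow> real) \<Rightarrow> ('a \<Rightarrow> real)) \<Rightarrow> bool" where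
  "Linf_extension M \<Omega> T Tinf \<longleftrightarrow>
     (\<exists>T1. L1_extension M \<Omega> T T1 \<and>
       (\<forall>g\<in>Linf_space M \<Omega>. Tinf g \<in> Linf_space M \<Omega> \<and>
         (\<forall>f\<in>L1_space M \<Omega>. (\<integral>x. Tinf g x * f x \<partial>M) = (\<integral>x. g x * T1 f x \<partial>M))))"

text \<open>The extensions to \<open>L1_space\<close> and \<open>Linf_space\<close> are unique up to null sets, so the
  existential quantifier just refers to the extension.\<close>

definition conservative ::
  "'a measure \<Rightarrow> 'a set \<Rightarrow> (real \<Rightarrow> ('a \<Rightarrow> real) \<Rightarrow> ('a \<Rightarrow> real)) \<Rightarrow> bool" where
  "conservative M \<Omega> S \<longleftrightarrow>
     (\<forall>t>0. \<exists>T. Linf_extension M \<Omega> (S t) T \<and>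
        (AE x in M. T (indicat_real \<Omega>) x = indicat_real \<Omega> x))"

end

theory Submission
  imports Defs
begin

text \<open>
  Both II and III are linked to the statement that \<open>1\<^sub>\<Omega> \<phi>\<close> belongs to the domain of the form with
  Dirichlet boundary conditions for every \<open>\<phi>\<close> in \<open>D\<close>. If this holds, locality shows that the operator
  of the Dirichlet form is a restriction of \<open>H\<close>, and the energy identity for \<open>u' = - H u\<close> gives II.
  Conversely, II makes the operator of the Dirichlet form a restriction of \<open>H\<close>, and the functions
  \<open>\<lambda> (\<lambda> + H\<^sub>D)\<^sup>-\<^sup>1 (1\<^sub>\<Omega> \<phi>)\<close> have energy at most that of \<open>\<phi>\<close> and converge to \<open>1\<^sub>\<Omega> \<phi>\<close>. Energy-bounded
  \<open>L\<^sub>2\<close>-limits stay in a closed convex subset of the form domain, by a minimisation argument.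

  For II \<open>\<Longrightarrow>\<close> III one subtracts from \<open>1\<^sub>\<Omega> \<phi>\<close>, with \<open>\<phi> \<ge> 1\<close> near a compact part of the boundary, an
  approximating function with compact support in \<open>\<Omega>\<close>; for III \<open>\<Longrightarrow>\<close> II one truncates functions by small
  functions that are at least 1 near the boundary. For I \<open>\<Longrightarrow>\<close> II, differentiating
  \<open>\<integral> \<Phi> (u t)\<close> along orbits for suitable convex \<open>\<Phi>\<close> yields that \<open>S\<close> is positive, contracts \<open>L\<^sub>1\<close>
  and dominates \<open>S\<^sup>D\<close>; conservation of mass then forces equality.
\<close>

section \<open>Positive symmetric forms\<close>

text \<open>Functions stand for their classes, so \<open>E\<close>, the inner product of
  \<open>L\<^sub>2\<close> and \<open>E\<close> plus a multiple of it are treated as semidefinite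
  forms of one kind. No spectral calculus enters: \<open>S\<close> is only a strongly continuous
  semigroup with generator \<open>- H\<close>, so even its contractivity has to be derived, from a
  local bound and the sign of the derivative of the squared norm. Such derivatives exist only along
  orbits starting in the generator domain; resolvents show that this domain is dense.

  A recurring obstacle is that truncations would have to be continuous in the graph norm. This is
  avoided by asking only for convergence in \<open>L\<^sub>2\<close> together with an energy bound.
  Locality supplies many of these bounds: cutting \<open>v\<close> down to a set, if the result
  stays in \<open>D\<close>, splits off an orthogonal summand.

  Conservation concerns the constant function, so squared norms do not suffice for I
  \<Longrightarrow> II. The functions \<open>huber c\<close> serve as \<open>\<Phi>\<close> because
  their derivative \<open>clip c\<close> is exactly the contraction under which Dirichlet forms
  decrease, and because \<open>huber c / c\<close> tends to the positive part as \<open>c\<close>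
  tends to 0, which recovers the mass.\<close>

lemma nonneg_perturbation:
  fixes a b :: real
  assumes "\<And>s. s > 0 \<Longrightarrow> 0 \<le> 2 * s * b + s\<^sup>2 * a"
  shows "0 \<le> b"
proof (rule ccontr)
  assume b: "\<not> 0 \<le> b"
  \<comment> \<open>At \<open>s = - b / A\<close> the quadratic expression is at most
    \<open>- (b\<^sup>2 / A)\<close>. Replacing \<open>a\<close> by the larger \<open>A\<close>
    guards against \<open>a \<le> 0\<close>.\<close>
  define A where "A = \<bar>a\<bar> + 1"
  have A: "A > 0" "a < A" by (auto simp: A_def)
  have "0 \<le> 2 * (- b / A) * b + (- b / A)\<^sup>2 * a" using A b by (intro assms) (simp add: divide_less_0_iff)
  also have "\<dots> \<le> 2 * (- b / A) * b + (- b / A)\<^sup>2 * A"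
    using A by (intro add_left_mono mult_left_mono) auto
  also have "\<dots> = - (b\<^sup>2 / A)" using A by (simp add: power2_eq_square field_simps)
  finally show False using A b by (simp add: divide_le_0_iff zero_le_divide_iff)
qed

lemma nonneg_perturbation_zero:
  fixes a b :: real
  assumes "\<And>s. 0 \<le> 2 * s * b + s\<^sup>2 * a"
  shows "b = 0"
proof (rule antisym)
  show "0 \<le> b" using assms by (rule nonneg_perturbation)
  have "0 \<le> 2 * s * (- b) + s\<^sup>2 * a" for s using assms[of "- s"] by simp
  then have "0 \<le> - b" by (rule nonneg_perturbation)
  then show "b \<le> 0" by simp
qed

text \<open>The inner product on \<open>L2_space\<close> and the sums of \<open>E\<close> and a
  nonnegative multiple of it are instances as well, so Cauchy-Schwarz, the triangle inequality and
  the parallelogram law are proved only once.\<close>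

locale psform =
  fixes M :: "'a measure" and D :: "('a \<Rightarrow> real) set"
    and E :: "('a \<Rightarrow> real) \<Rightarrow> ('a \<Rightarrow> real) \<Rightarrow> real"
  assumes psform: "positive_symmetric_form M D E"
begin

lemma
  shows D_L2: "u \<in> D \<Longrightarrow> u \<in> L2_space M UNIV"
    and D_cong: "u \<in> D \<Longrightarrow> v \<in> borel_measurable M \<Longrightarrow> AE x in M. u x = v x \<Longrightarrow> v \<in> D"
    and E_cong_left: "u \<in> D \<Longrightarrow> v \<in> D \<Longrightarrow> w \<in> D \<Longrightarrow> AE x in M. u x = v x \<Longrightarrow> E u w = E v w"
    and zero_mem: "(\<lambda>x. 0) \<in> D"
    and add_mem: "u \<in> D \<Longrightarrow> v \<in> D \<Longrightarrow> (\<lambda>x. u x + v x) \<in> D"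
    and scale_mem: "u \<in> D \<Longrightarrow> (\<lambda>x. c * u x) \<in> D"
    and E_add_left: "u \<in> D \<Longrightarrow> v \<in> D \<Longrightarrow> w \<in> D \<Longrightarrow> E (\<lambda>x. u x + v x) w = E u w + E v w"
    and E_scale_left: "u \<in> D \<Longrightarrow> w \<in> D \<Longrightarrow> E (\<lambda>x. c * u x) w = c * E u w"
    and E_sym: "u \<in> D \<Longrightarrow> v \<in> D \<Longrightarrow> E u v = E v u"
    and E_nonneg: "u \<in> D \<Longrightarrow> E u u \<ge> 0"
  using psform unfolding positive_symmetric_form_def by blast+

lemma E_add_right: "u \<in> D \<Longrightarrow> v \<in> D \<Longrightarrow> w \<in> D \<Longrightarrow> E w (\<lambda>x. u x + v x) = E w u + E w v"
  using E_add_left[of u v w] E_sym add_mem by metis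

lemma E_scale_right: "u \<in> D \<Longrightarrow> w \<in> D \<Longrightarrow> E w (\<lambda>x. c * u x) = c * E w u"
  using E_scale_left[of u w] E_sym scale_mem by metis

lemma E_cong: "u \<in> D \<Longrightarrow> v \<in> D \<Longrightarrow> AE x in M. u x = v x \<Longrightarrow> E u u = E v v"
  using E_cong_left[of u v u] E_cong_left[of u v v] E_sym[of u v] by simp

lemma uminus_mem: "u \<in> D \<Longrightarrow> (\<lambda>x. - u x) \<in> D"
  using scale_mem[of u "-1"] by simp

lemma diff_mem: "u \<in> D \<Longrightarrow> v \<in> D \<Longrightarrow> (\<lambda>x. u x - v x) \<in> D"
  using add_mem[OF _ uminus_mem, of u v] by simp

lemma E_uminus_left: "u \<in> D \<Longrightarrow> w \<in> D \<Longrightarrow> E (\<lambda>x. - u x) w = - E u w"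
  using E_scale_left[of u w "-1"] by simp

lemma E_uminus_right: "u \<in> D \<Longrightarrow> w \<in> D \<Longrightarrow> E w (\<lambda>x. - u x) = - E w u"
  using E_scale_right[of u w "-1"] by simp

lemma E_diff_left: "u \<in> D \<Longrightarrow> v \<in> D \<Longrightarrow> w \<in> D \<Longrightarrow> E (\<lambda>x. u x - v x) w = E u w - E v w"
  using E_add_left[OF _ uminus_mem, of u v w] by (simp add: E_uminus_left)

lemma E_diff_right: "u \<in> D \<Longrightarrow> v \<in> D \<Longrightarrow> w \<in> D \<Longrightarrow> E w (\<lambda>x. u x - v x) = E w u - E w v"
  using E_add_right[OF _ uminus_mem, of u v w] by (simp add: E_uminus_right)

lemma E_add_scale:
  assumes "u \<in> D" "v \<in> D"
  shows "E (\<lambda>x. u x + s * v x) (\<lambda>x. u x + s * v x) = E u u + 2 * s * E u v + s\<^sup>2 * E v v"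
proof -
  have sv: "(\<lambda>x. s * v x) \<in> D" using assms scale_mem by blast
  show ?thesis
    using assms sv E_sym[OF assms]
    by (simp add: E_add_left E_add_right add_mem E_scale_left E_scale_right power2_eq_square algebra_simps)
qed

lemma E_add_self: "u \<in> D \<Longrightarrow> v \<in> D \<Longrightarrow> E (\<lambda>x. u x + v x) (\<lambda>x. u x + v x) = E u u + 2 * E u v + E v v"
  using E_add_scale[of u v 1] by simp

lemma E_diff_self: "u \<in> D \<Longrightarrow> v \<in> D \<Longrightarrow> E (\<lambda>x. u x - v x) (\<lambda>x. u x - v x) = E u u - 2 * E u v + E v v"
  using E_add_scale[of u v "-1"] by simp

lemma E_diff_le: "u \<in> D \<Longrightarrow> v \<in> D \<Longrightarrow> E (\<lambda>x. u x - v x) (\<lambda>x. u x - v x) \<le> 2 * E u u + 2 * E v v"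
  using E_nonneg[OF add_mem, of u v] by (simp add: E_diff_self E_add_self)

lemma E_midpoint:
  assumes "u \<in> D" "v \<in> D"
  shows "(\<lambda>x. (u x + v x) / 2) \<in> D"
    and "E (\<lambda>x. (u x + v x) / 2) (\<lambda>x. (u x + v x) / 2)
      = (E u u + E v v) / 2 - E (\<lambda>x. u x - v x) (\<lambda>x. u x - v x) / 4"
proof -
  have eq: "(\<lambda>x. (u x + v x) / 2) = (\<lambda>x. (1/2) * (u x + v x))" by auto
  show "(\<lambda>x. (u x + v x) / 2) \<in> D" unfolding eq using assms by (intro scale_mem add_mem)
  show "E (\<lambda>x. (u x + v x) / 2) (\<lambda>x. (u x + v x) / 2)
      = (E u u + E v v) / 2 - E (\<lambda>x. u x - v x) (\<lambda>x. u x - v x) / 4"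
    unfolding eq E_scale_left[OF add_mem[OF assms] scale_mem[OF add_mem[OF assms]]]
      E_scale_right[OF add_mem[OF assms] add_mem[OF assms]] E_add_self[OF assms] E_diff_self[OF assms]
    by (simp add: algebra_simps add_divide_distrib diff_divide_distrib)
qed

lemma Cauchy_Schwarz:
  assumes "u \<in> D" "v \<in> D"
  shows "\<bar>E u v\<bar> \<le> sqrt (E u u) * sqrt (E v v)"
proof -
  have ineq: "0 \<le> E u u + 2 * s * E u v + s\<^sup>2 * E v v" for s
    using E_nonneg[OF add_mem[OF assms(1) scale_mem[OF assms(2)]], of s] E_add_scale[OF assms] by simp
  have "(E u v)\<^sup>2 \<le> E u u * E v v"
  proof (cases "E v v = 0")
    case True
    have "E u v = 0"
    proof (rule ccontr)
      assume n: "E u v \<noteq> 0"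
      \<comment> \<open>For \<open>E v v = 0\<close> the quadratic is affine in \<open>s\<close>,
        and this \<open>s\<close> gives it the value -1.\<close>
      have "0 \<le> E u u + 2 * (- (E u u + 1) / (2 * E u v)) * E u v"
        using ineq[of "- (E u u + 1) / (2 * E u v)"] True by simp
      then show False using n by (simp add: field_simps)
    qed
    then show ?thesis using True by simp
  next
    case False
    then have pos: "E v v > 0" using E_nonneg[OF assms(2)] by simp
    have "0 \<le> E u u + 2 * (- E u v / E v v) * E u v + (- E u v / E v v)\<^sup>2 * E v v" by (rule ineq)
    also have "\<dots> = E u u - (E u v)\<^sup>2 / E v v" using pos by (simp add: power2_eq_square field_simps)
    finally show ?thesis using pos by (simp add: field_simps)
  qed
  then have "sqrt ((E u v)\<^sup>2) \<le> sqrt (E u u * E v v)" by (rule real_sqrt_le_mono)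
  then show ?thesis by (simp add: real_sqrt_mult)
qed

lemma sqrt_triangle:
  assumes "u \<in> D" "v \<in> D"
  shows "sqrt (E (\<lambda>x. u x + v x) (\<lambda>x. u x + v x)) \<le> sqrt (E u u) + sqrt (E v v)"
proof (rule real_le_lsqrt[THEN order_trans])
  show "E (\<lambda>x. u x + v x) (\<lambda>x. u x + v x) \<le> (sqrt (E u u) + sqrt (E v v))\<^sup>2"
    using Cauchy_Schwarz[OF assms] E_nonneg[OF assms(1)] E_nonneg[OF assms(2)] assms
    by (simp add: E_add_self power2_sum)
qed (use E_nonneg assms in auto)

lemma sqrt_diff_commute:
  assumes "u \<in> D" "v \<in> D"
  shows "sqrt (E (\<lambda>x. u x - v x) (\<lambda>x. u x - v x)) = sqrt (E (\<lambda>x. v x - u x) (\<lambda>x. v x - u x))"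
  using assms E_sym[OF assms] by (simp add: E_diff_self)

lemma sqrt_scale: "u \<in> D \<Longrightarrow> sqrt (E (\<lambda>x. c * u x) (\<lambda>x. c * u x)) = \<bar>c\<bar> * sqrt (E u u)"
  by (simp add: E_scale_left E_scale_right scale_mem real_sqrt_mult flip: mult.assoc)

lemma subset_psform:
  assumes "D' \<subseteq> D" "(\<lambda>x. 0) \<in> D'"
    and "\<And>u v. u \<in> D' \<Longrightarrow> v \<in> borel_measurable M \<Longrightarrow> AE x in M. u x = v x \<Longrightarrow> v \<in> D'"
    and "\<And>u v. u \<in> D' \<Longrightarrow> v \<in> D' \<Longrightarrow> (\<lambda>x. u x + v x) \<in> D'"
    and "\<And>u c. u \<in> D' \<Longrightarrow> (\<lambda>x. c * u x) \<in> D'"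
  shows "positive_symmetric_form M D' E"
  unfolding positive_symmetric_form_def
  apply (intro conjI ballI allI impI)
  subgoal using assms(1) D_L2 by auto
  subgoal using assms(3) by blast
  subgoal using assms(1) E_cong_left by blast
  subgoal by (rule assms(2))
  subgoal by (rule assms(4))
  subgoal by (rule assms(5))
  subgoal using assms(1) E_add_left by blast
  subgoal using assms(1) E_scale_left by blast
  subgoal using assms(1) E_sym by blast
  subgoal using assms(1) E_nonneg by blast
  done

end

section \<open>The space of square-integrable functions\<close>

lemma L2_spaceD:
  assumes "f \<in> L2_space M \<Omega>"
  shows "f \<in> borel_measurable M" "integrable M (\<lambda>x. (f x)\<^sup>2)" "AE x in M. x \<notin> \<Omega> \<longrightarrow> f x = 0"
  using assms by (auto simp: L2_space_def)

lemma L2_space_mono: "f \<in> L2_space M A \<Longrightarrow> A \<subseteq> B \<Longrightarrow> f \<in> L2_space M B"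
  unfolding L2_space_def by auto

lemma L2_space_UNIV: "f \<in> L2_space M \<Omega> \<Longrightarrow> f \<in> L2_space M UNIV"
  by (rule L2_space_mono) auto

lemma L2_space_restrict: "f \<in> L2_space M UNIV \<Longrightarrow> AE x in M. x \<notin> \<Omega> \<longrightarrow> f x = 0 \<Longrightarrow> f \<in> L2_space M \<Omega>"
  unfolding L2_space_def by auto

lemma integrable_mult_L2:
  assumes "u \<in> L2_space M UNIV" "v \<in> L2_space M UNIV"
  shows "integrable M (\<lambda>x. u x * v x)"
proof (rule Bochner_Integration.integrable_bound[of M "\<lambda>x. (u x)\<^sup>2 + (v x)\<^sup>2"])
  show "integrable M (\<lambda>x. (u x)\<^sup>2 + (v x)\<^sup>2)" using assms by (auto dest: L2_spaceD)
  show "(\<lambda>x. u x * v x) \<in> borel_measurable M" using assms by (auto dest!: L2_spaceD(1))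
  show "AE x in M. norm (u x * v x) \<le> norm ((u x)\<^sup>2 + (v x)\<^sup>2)"
  proof (intro AE_I2)
    fix x
    have "0 \<le> (\<bar>u x\<bar> - \<bar>v x\<bar>)\<^sup>2" "0 \<le> \<bar>u x\<bar> * \<bar>v x\<bar>" by auto
    then have "\<bar>u x\<bar> * \<bar>v x\<bar> \<le> (u x)\<^sup>2 + (v x)\<^sup>2"
      unfolding power2_diff power2_abs by linarith
    then show "norm (u x * v x) \<le> norm ((u x)\<^sup>2 + (v x)\<^sup>2)" by (simp add: abs_mult)
  qed
qed

lemma L2_space_bound:
  assumes "f \<in> L2_space M UNIV" "g \<in> borel_measurable M" "AE x in M. \<bar>g x\<bar> \<le> \<bar>f x\<bar>"
  shows "g \<in> L2_space M UNIV"
proof -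
  have "integrable M (\<lambda>x. (g x)\<^sup>2)"
  proof (rule Bochner_Integration.integrable_bound[of M "\<lambda>x. (f x)\<^sup>2"])
    show "AE x in M. norm ((g x)\<^sup>2) \<le> norm ((f x)\<^sup>2)"
      using assms(3) by eventually_elim (simp add: abs_le_square_iff)
  qed (use assms in \<open>auto dest: L2_spaceD\<close>)
  then show ?thesis using assms by (simp add: L2_space_def)
qed

lemma L2_space_add:
  assumes "u \<in> L2_space M \<Omega>" "v \<in> L2_space M \<Omega>"
  shows "(\<lambda>x. u x + v x) \<in> L2_space M \<Omega>"
proof -
  have "integrable M (\<lambda>x. (u x)\<^sup>2 + (v x)\<^sup>2 + 2 * (u x * v x))"
    using integrable_mult_L2[of u M v] assms L2_space_UNIV
    by (intro Bochner_Integration.integrable_add integrable_mult_right) (auto dest: L2_spaceD)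
  then have "integrable M (\<lambda>x. (u x + v x)\<^sup>2)" by (simp add: power2_sum algebra_simps)
  moreover have "AE x in M. x \<notin> \<Omega> \<longrightarrow> u x + v x = 0"
    using L2_spaceD(3)[OF assms(1)] L2_spaceD(3)[OF assms(2)] by eventually_elim auto
  ultimately show ?thesis using assms by (auto simp: L2_space_def)
qed

lemma L2_space_scale: "u \<in> L2_space M \<Omega> \<Longrightarrow> (\<lambda>x. c * u x) \<in> L2_space M \<Omega>"
  unfolding L2_space_def by (auto simp: power_mult_distrib)

lemma L2_space_cong:
  assumes "u \<in> L2_space M \<Omega>" "v \<in> borel_measurable M" "AE x in M. u x = v x"
  shows "v \<in> L2_space M \<Omega>"
proof -
  have "AE x in M. x \<notin> \<Omega> \<longrightarrow> v x = 0"
    using L2_spaceD(3)[OF assms(1)] assms(3) by eventually_elim auto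
  moreover have "AE x in M. \<bar>v x\<bar> \<le> \<bar>u x\<bar>"
    using assms(3) by eventually_elim simp
  then have "v \<in> L2_space M UNIV" by (rule L2_space_bound[OF L2_space_UNIV[OF assms(1)] assms(2)])
  ultimately show ?thesis using L2_space_restrict by blast
qed

interpretation L2: psform M "L2_space M \<Omega>" "\<lambda>u v. \<integral>x. u x * v x \<partial>M"
proof
  have UN: "\<And>u. u \<in> L2_space M \<Omega> \<Longrightarrow> u \<in> L2_space M UNIV" by (rule L2_space_UNIV)
  show "positive_symmetric_form M (L2_space M \<Omega>) (\<lambda>u v. \<integral>x. u x * v x \<partial>M)"
    unfolding positive_symmetric_form_def
    apply (intro conjI ballI allI impI)
    subgoal using L2_space_UNIV by auto
    subgoal using L2_space_cong by blast
    subgoal by (rule integral_cong_AE) (auto dest!: L2_spaceD(1))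
    subgoal by (simp add: L2_space_def)
    subgoal by (rule L2_space_add)
    subgoal by (rule L2_space_scale)
    subgoal by (simp add: distrib_right integrable_mult_L2 UN)
    subgoal by (simp add: mult.assoc)
    subgoal by (simp add: mult.commute)
    subgoal by simp
    done
qed

lemma L2_norm_alt: "L2_norm M u = sqrt (\<integral>x. u x * u x \<partial>M)"
  by (simp add: L2_norm_def power2_eq_square)

lemma L2_norm_nonneg [simp]: "L2_norm M u \<ge> 0"
  by (simp add: L2_norm_def)

lemma L2_norm_sq: "(L2_norm M u)\<^sup>2 = (\<integral>x. (u x)\<^sup>2 \<partial>M)"
  by (simp add: L2_norm_def)

lemma L2_norm_sq': "(L2_norm M u)\<^sup>2 = (\<integral>x. u x * u x \<partial>M)"
  by (simp add: L2_norm_alt)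

lemma L2_norm_triangle:
  assumes "u \<in> L2_space M UNIV" "v \<in> L2_space M UNIV"
  shows "L2_norm M (\<lambda>x. u x + v x) \<le> L2_norm M u + L2_norm M v"
  unfolding L2_norm_alt by (rule L2.sqrt_triangle[OF assms])

lemma L2_norm_triangle_diff:
  assumes "u \<in> L2_space M UNIV" "v \<in> L2_space M UNIV" "w \<in> L2_space M UNIV"
  shows "L2_norm M (\<lambda>x. u x - w x) \<le> L2_norm M (\<lambda>x. u x - v x) + L2_norm M (\<lambda>x. v x - w x)"
  using L2_norm_triangle[OF L2.diff_mem[OF assms(1,2)] L2.diff_mem[OF assms(2,3)]] by simp

lemma L2_norm_commute: "L2_norm M (\<lambda>x. u x - v x) = L2_norm M (\<lambda>x. v x - u x)"
  by (simp add: L2_norm_def power2_commute)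

lemma L2_norm_triangle_diff':
  assumes "u \<in> L2_space M UNIV" "v \<in> L2_space M UNIV"
  shows "L2_norm M u \<le> L2_norm M v + L2_norm M (\<lambda>x. u x - v x)"
  using L2_norm_triangle[OF assms(2) L2.diff_mem[OF assms]] by simp

lemma L2_norm_scale: "L2_norm M (\<lambda>x. c * u x) = \<bar>c\<bar> * L2_norm M u"
  by (simp add: L2_norm_def power_mult_distrib real_sqrt_mult)

lemma L2_norm_mono:
  assumes "f \<in> L2_space M UNIV" "g \<in> borel_measurable M" "AE x in M. \<bar>g x\<bar> \<le> \<bar>f x\<bar>"
  shows "L2_norm M g \<le> L2_norm M f"
  unfolding L2_norm_def
proof (intro real_sqrt_le_mono integral_mono_AE)
  show "AE x in M. (g x)\<^sup>2 \<le> (f x)\<^sup>2"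
    using assms(3) by eventually_elim (simp add: abs_le_square_iff)
qed (use assms L2_space_bound[OF assms] in \<open>auto dest: L2_spaceD\<close>)

lemma L2_norm_cong: "u \<in> borel_measurable M \<Longrightarrow> v \<in> borel_measurable M \<Longrightarrow> AE x in M. u x = v x
    \<Longrightarrow> L2_norm M u = L2_norm M v"
  unfolding L2_norm_def by (intro arg_cong[where f=sqrt] integral_cong_AE) auto

lemma L2_norm_eq_0:
  assumes "u \<in> L2_space M UNIV" "L2_norm M u \<le> 0"
  shows "AE x in M. u x = 0"
proof -
  have "(\<integral>x. (u x)\<^sup>2 \<partial>M) = 0" using assms(2) unfolding L2_norm_def
    by (metis L2_norm_def L2_norm_nonneg antisym real_sqrt_eq_zero_cancel_iff)
  then have "AE x in M. (u x)\<^sup>2 = 0"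
    using integral_nonneg_eq_0_iff_AE[OF L2_spaceD(2)[OF assms(1)]] by simp
  then show ?thesis by simp
qed

lemma L2_eq_of_norm_le:
  assumes "u \<in> L2_space M UNIV" "v \<in> L2_space M UNIV" "\<And>e. e > 0 \<Longrightarrow> L2_norm M (\<lambda>x. u x - v x) \<le> e"
  shows "AE x in M. u x = v x"
proof -
  have "L2_norm M (\<lambda>x. u x - v x) \<le> 0" using assms(3) by (rule field_le_epsilon) simp
  from L2_norm_eq_0[OF L2.diff_mem[OF assms(1,2)] this] show ?thesis by simp
qed

lemma L2_inner_le:
  assumes "u \<in> L2_space M UNIV" "v \<in> L2_space M UNIV"
  shows "\<bar>\<integral>x. u x * v x \<partial>M\<bar> \<le> L2_norm M u * L2_norm M v"
  using L2.Cauchy_Schwarz[OF assms] by (simp add: L2_norm_alt)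

lemma L2_norm_dominated:
  fixes s :: "nat \<Rightarrow> 'a \<Rightarrow> real"
  assumes "w \<in> L2_space M UNIV" "f \<in> borel_measurable M" "\<And>n. s n \<in> borel_measurable M"
    and "AE x in M. (\<lambda>n. s n x) \<longlonglongrightarrow> f x" "\<And>n. AE x in M. \<bar>s n x - f x\<bar> \<le> \<bar>w x\<bar>"
  shows "(\<lambda>n. L2_norm M (\<lambda>x. s n x - f x)) \<longlonglongrightarrow> 0"
proof -
  have "(\<lambda>n. \<integral>x. (s n x - f x)\<^sup>2 \<partial>M) \<longlonglongrightarrow> (\<integral>x. 0 \<partial>M)"
  proof (rule integral_dominated_convergence[where w = "\<lambda>x. (w x)\<^sup>2"])
    show "AE x in M. (\<lambda>n. (s n x - f x)\<^sup>2) \<longlonglongrightarrow> 0"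
      using assms(4)
    proof eventually_elim
      case (elim x)
      then have "(\<lambda>n. (s n x - f x)\<^sup>2) \<longlonglongrightarrow> (f x - f x)\<^sup>2" by (intro tendsto_intros)
      then show ?case by simp
    qed
    show "AE x in M. norm ((s n x - f x)\<^sup>2) \<le> (w x)\<^sup>2" for n
      using assms(5)[of n] by eventually_elim (simp add: abs_le_square_iff)
  qed (use assms in \<open>auto dest: L2_spaceD\<close>)
  then have "(\<lambda>n. sqrt (\<integral>x. (s n x - f x)\<^sup>2 \<partial>M)) \<longlonglongrightarrow> sqrt 0"
    by (intro tendsto_real_sqrt) simp
  then show ?thesis by (simp add: L2_norm_def)
qed

text \<open>Lower semicontinuity of the norm under pointwise limits. Membership of \<open>g\<close>
  belongs to the conclusion because the limit is not yet known to be square integrable when this is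
  applied.\<close>

lemma L2_Fatou:
  fixes f :: "nat \<Rightarrow> 'a \<Rightarrow> real"
  assumes "\<And>k. f k \<in> L2_space M UNIV" "g \<in> borel_measurable M"
    and lim: "AE x in M. (\<lambda>k. f k x) \<longlonglongrightarrow> g x"
    and bound: "\<forall>\<^sub>F k in sequentially. L2_norm M (f k) \<le> C"
  shows "g \<in> L2_space M UNIV" "L2_norm M g \<le> C"
proof -
  have meas: "f k \<in> borel_measurable M" for k using assms(1) by (auto dest: L2_spaceD)
  obtain k0 where "L2_norm M (f k0) \<le> C" using eventually_happens[OF bound] by auto
  then have C: "C \<ge> 0" using L2_norm_nonneg order_trans by blast
  have nn: "(\<integral>\<^sup>+x. ennreal ((f k x)\<^sup>2) \<partial>M) = ennreal ((L2_norm M (f k))\<^sup>2)" for k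
    unfolding L2_norm_sq using L2_spaceD(2)[OF assms(1)[of k]] by (intro nn_integral_eq_integral) auto
  have "(\<integral>\<^sup>+x. ennreal ((g x)\<^sup>2) \<partial>M) = (\<integral>\<^sup>+x. liminf (\<lambda>k. ennreal ((f k x)\<^sup>2)) \<partial>M)"
  proof (rule nn_integral_cong_AE)
    show "AE x in M. ennreal ((g x)\<^sup>2) = liminf (\<lambda>k. ennreal ((f k x)\<^sup>2))"
      using lim
    proof eventually_elim
      case (elim x)
      then have "(\<lambda>k. ennreal ((f k x)\<^sup>2)) \<longlonglongrightarrow> ennreal ((g x)\<^sup>2)"
        by (intro tendsto_ennrealI tendsto_power)
      then show ?case by (rule lim_imp_Liminf[OF trivial_limit_sequentially, symmetric])
    qed
  qed
  also have "\<dots> \<le> liminf (\<lambda>k. \<integral>\<^sup>+x. ennreal ((f k x)\<^sup>2) \<partial>M)"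
    using meas by (intro nn_integral_liminf) auto
  also have "\<dots> \<le> liminf (\<lambda>k::nat. ennreal (C\<^sup>2))"
    unfolding nn
    by (rule Liminf_mono) (use bound in \<open>eventually_elim, auto intro!: ennreal_leI power_mono\<close>)
  also have "\<dots> = ennreal (C\<^sup>2)" by (simp add: Liminf_const)
  finally have le: "(\<integral>\<^sup>+x. ennreal ((g x)\<^sup>2) \<partial>M) \<le> ennreal (C\<^sup>2)" .
  then have int: "integrable M (\<lambda>x. (g x)\<^sup>2)"
    using assms(2) by (intro integrableI_nonneg) (auto simp: less_top[symmetric] top_unique intro: le_less_trans)
  then show "g \<in> L2_space M UNIV" using assms(2) by (simp add: L2_space_def)
  have "ennreal (\<integral>x. (g x)\<^sup>2 \<partial>M) \<le> ennreal (C\<^sup>2)"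
    using le nn_integral_eq_integral[OF int] by simp
  then have "(\<integral>x. (g x)\<^sup>2 \<partial>M) \<le> C\<^sup>2" by simp
  then have "sqrt (\<integral>x. (g x)\<^sup>2 \<partial>M) \<le> sqrt (C\<^sup>2)" by (rule real_sqrt_le_mono)
  then show "L2_norm M g \<le> C" using C by (simp add: L2_norm_def)
qed

text \<open>Riesz-Fischer: a rapidly converging subsequence converges almost everywhere, and Fatou's
  lemma identifies its limit as the limit of the whole sequence.\<close>

lemma L2_complete:
  fixes u :: "nat \<Rightarrow> 'a \<Rightarrow> real"
  assumes u: "\<And>n. u n \<in> L2_space M UNIV"
    and Cauchy: "\<And>e. e > 0 \<Longrightarrow> \<exists>N. \<forall>m\<ge>N. \<forall>n\<ge>N. L2_norm M (\<lambda>x. u m x - u n x) < e"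
  shows "\<exists>v\<in>L2_space M UNIV. (\<lambda>n. L2_norm M (\<lambda>x. u n x - v x)) \<longlonglongrightarrow> 0"
proof -
  have meas: "u k \<in> borel_measurable M" for k using u by (auto dest: L2_spaceD)
  have "\<forall>k. \<exists>N. \<forall>m\<ge>N. \<forall>n\<ge>N. L2_norm M (\<lambda>x. u m x - u n x) < (1/2)^k"
    by (intro allI Cauchy) simp
  then obtain N where N: "\<And>k m n. m \<ge> N k \<Longrightarrow> n \<ge> N k \<Longrightarrow> L2_norm M (\<lambda>x. u m x - u n x) < (1/2)^k"
    by metis
  \<comment> \<open>Summing the \<open>N i\<close> makes the indices monotone while keeping
    \<open>r k \<ge> N k\<close>.\<close>
  define r where "r k = (\<Sum>i\<le>k. N i) + k" for k
  have rN: "r k \<ge> N k" for k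
    unfolding r_def by (rule trans_le_add1) (simp add: member_le_sum)
  have rmono: "r k \<le> r l" if "k \<le> l" for k l
    unfolding r_def using that by (intro add_mono sum_mono2) auto
  have rC: "L2_norm M (\<lambda>x. u m x - u n x) < (1/2)^k" if "m \<ge> r k" "n \<ge> r k" for k m n
    using N rN that order_trans by metis
  \<comment> \<open>The norm of \<open>d k\<close> is at most \<open>(1/2)^k\<close>, so the
    weighted squares \<open>2^k * (d k x)\<^sup>2\<close> still have integrals at most
    \<open>(1/2)^k\<close>. Their sum is thus finite almost everywhere, and
    \<open>\<bar>d k x\<bar> \<le> 2^k * (d k x)\<^sup>2 + (1/2)^k\<close> turns this into absolute
    convergence of the telescoping series.\<close>
  define d where "d k x = u (r (Suc k)) x - u (r k) x" for k x
  have dL2: "d k \<in> L2_space M UNIV" for k unfolding d_def using u by (intro L2.diff_mem)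
  have dmeas [measurable]: "d k \<in> borel_measurable M" for k using dL2 by (auto dest: L2_spaceD)
  have "(\<integral>\<^sup>+x. (\<Sum>k. ennreal (2^k * (d k x)\<^sup>2)) \<partial>M) = (\<Sum>k. \<integral>\<^sup>+x. ennreal (2^k * (d k x)\<^sup>2) \<partial>M)"
    by (intro nn_integral_suminf) measurable
  also have "\<dots> \<le> (\<Sum>k. ennreal ((1/2)^k))"
  proof (intro suminf_le allI)
    fix k
    have "(\<integral>\<^sup>+x. ennreal (2^k * (d k x)\<^sup>2) \<partial>M) = ennreal (\<integral>x. 2^k * (d k x)\<^sup>2 \<partial>M)"
      using L2_spaceD(2)[OF dL2[of k]] by (intro nn_integral_eq_integral) auto
    also have "\<dots> = ennreal (2^k * (L2_norm M (d k))\<^sup>2)" by (simp add: L2_norm_sq)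
    also have "\<dots> \<le> ennreal ((1/2)^k)"
    proof (rule ennreal_leI)
      have "L2_norm M (d k) \<le> (1/2)^k"
        unfolding d_def using rC[of k "r (Suc k)" "r k"] rmono[of k "Suc k"] by simp
      then have "2^k * (L2_norm M (d k))\<^sup>2 \<le> 2^k * ((1/2)^k)\<^sup>2"
        by (intro mult_left_mono power_mono) auto
      also have "\<dots> = (1/2::real)^k" by (simp add: power2_eq_square power_divide)
      finally show "2^k * (L2_norm M (d k))\<^sup>2 \<le> (1/2)^k" .
    qed
    finally show "(\<integral>\<^sup>+x. ennreal (2^k * (d k x)\<^sup>2) \<partial>M) \<le> ennreal ((1/2)^k)" .
  qed (auto)
  also have "\<dots> = ennreal (\<Sum>k. (1/2)^k)" by (intro suminf_ennreal2) (auto intro: summable_geometric)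
  also have "\<dots> < \<infinity>" by simp
  finally have "(\<integral>\<^sup>+x. (\<Sum>k. ennreal (2^k * (d k x)\<^sup>2)) \<partial>M) \<noteq> \<infinity>" by simp
  then have "AE x in M. (\<Sum>k. ennreal (2^k * (d k x)\<^sup>2)) \<noteq> \<infinity>"
    by (intro nn_integral_PInf_AE) (auto intro!: borel_measurable_suminf_order)
  then have AEconv: "AE x in M. convergent (\<lambda>k. u (r k) x)"
  proof eventually_elim
    case (elim x)
    then have sm: "summable (\<lambda>k. 2^k * (d k x)\<^sup>2)"
      by (intro summable_suminf_not_top) auto
    have "summable (\<lambda>k. d k x)"
    proof (rule summable_comparison_test')
      show "summable (\<lambda>k. 2^k * (d k x)\<^sup>2 + (1/2)^k)"
        using sm by (intro summable_add summable_geometric) auto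
      fix k :: nat
      assume "k \<ge> 0"
      define a where "a = (2::real)^k"
      have a: "a > 0" "(1/2::real)^k = 1 / a" by (auto simp: a_def power_divide)
      have "0 \<le> (a * \<bar>d k x\<bar> - 1)\<^sup>2" by simp
      then have "2 * a * \<bar>d k x\<bar> \<le> a\<^sup>2 * (d k x)\<^sup>2 + 1" by (simp add: power2_diff power_mult_distrib)
      also have "\<dots> = a * (a * (d k x)\<^sup>2 + 1 / a)" using a by (simp add: power2_eq_square field_simps)
      finally have "a * (2 * \<bar>d k x\<bar>) \<le> a * (a * (d k x)\<^sup>2 + 1 / a)" by simp
      then have "2 * \<bar>d k x\<bar> \<le> a * (d k x)\<^sup>2 + 1 / a" using a by (simp only: mult_le_cancel_left_pos)
      moreover have "\<bar>d k x\<bar> \<ge> 0" by simp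
      ultimately have "\<bar>d k x\<bar> \<le> a * (d k x)\<^sup>2 + 1 / a" by linarith
      then show "norm (d k x) \<le> 2^k * (d k x)\<^sup>2 + (1/2)^k" unfolding a(2) a_def by simp
    qed
    then have "convergent (\<lambda>n. \<Sum>k<n. d k x)" by (simp add: summable_iff_convergent)
    moreover have "(\<Sum>k<n. d k x) = u (r n) x - u (r 0) x" for n
      unfolding d_def by (rule sum_lessThan_telescope)
    ultimately have "convergent (\<lambda>n. u (r n) x - u (r 0) x)" by simp
    from convergent_add[OF this convergent_const[of "u (r 0) x"]] show ?case by simp
  qed
  define v where "v x = lim (\<lambda>k. u (r k) x)" for x
  have vmeas: "v \<in> borel_measurable M" unfolding v_def using meas by (intro borel_measurable_lim_metric)
  have AElim: "AE x in M. (\<lambda>k. u (r k) x) \<longlonglongrightarrow> v x"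
    using AEconv by eventually_elim (simp add: v_def convergent_LIMSEQ_iff)
  \<comment> \<open>Fatou's lemma in the second index of the Cauchy estimate, with
    \<open>u n\<close> fixed and \<open>u (r k)\<close> tending to \<open>v\<close>. It covers every
    late \<open>n\<close>, not only the subsequence.\<close>
  have key: "(\<lambda>x. u n x - v x) \<in> L2_space M UNIV \<and> L2_norm M (\<lambda>x. u n x - v x) \<le> (1/2)^j"
    if n: "n \<ge> r j" for n j
  proof -
    have "\<forall>\<^sub>F k in sequentially. L2_norm M (\<lambda>x. u n x - u (r k) x) \<le> (1/2)^j"
      using eventually_ge_at_top[of j]
      by eventually_elim (use rC[OF n] rmono in \<open>auto intro: less_imp_le\<close>)
    moreover have "AE x in M. (\<lambda>k. u n x - u (r k) x) \<longlonglongrightarrow> u n x - v x"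
      using AElim by eventually_elim (intro tendsto_intros)
    ultimately show ?thesis
      using L2_Fatou[of "\<lambda>k x. u n x - u (r k) x" M "\<lambda>x. u n x - v x"] L2.diff_mem[OF u u] meas vmeas
      by (simp add: borel_measurable_diff)
  qed
  have "(\<lambda>x. u (r 0) x - (u (r 0) x - v x)) \<in> L2_space M UNIV"
    by (rule L2.diff_mem[OF u conjunct1[OF key[OF order_refl]]])
  then have v: "v \<in> L2_space M UNIV" by simp
  have "(\<lambda>n. L2_norm M (\<lambda>x. u n x - v x)) \<longlonglongrightarrow> 0"
  proof (rule LIMSEQ_I)
    fix e :: real assume "e > 0"
    then obtain j where j: "(1/2::real)^j < e" using real_arch_pow_inv[of e "1/2"] by auto
    have "norm (L2_norm M (\<lambda>x. u n x - v x) - 0) < e" if "n \<ge> r j" for n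
      using key[OF that] j by simp
    then show "\<exists>N. \<forall>n\<ge>N. norm (L2_norm M (\<lambda>x. u n x - v x) - 0) < e" by blast
  qed
  with v show ?thesis by blast
qed


lemma L2_space_closed:
  assumes Om: "\<Omega> \<in> sets M" and u: "u \<in> L2_space M UNIV"
    and approx: "\<And>e. e > 0 \<Longrightarrow> \<exists>v\<in>L2_space M \<Omega>. L2_norm M (\<lambda>x. u x - v x) < e"
  shows "u \<in> L2_space M \<Omega>"
proof -
  define h where "h x = u x - indicat_real \<Omega> x * u x" for x
  have hm: "h \<in> borel_measurable M" unfolding h_def using L2_spaceD(1)[OF u] Om by simp
  have h: "h \<in> L2_space M UNIV" using hm by (intro L2_space_bound[OF u]) (auto simp: h_def indicator_def)
  have "L2_norm M h \<le> 0"
  proof (rule field_le_epsilon)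
    fix e :: real assume "e > 0"
    then obtain v where v: "v \<in> L2_space M \<Omega>" "L2_norm M (\<lambda>x. u x - v x) < e" using approx by blast
    have "AE x in M. \<bar>h x\<bar> \<le> \<bar>u x - v x\<bar>"
      using L2_spaceD(3)[OF v(1)] by eventually_elim (auto simp: h_def indicator_def)
    then have "L2_norm M h \<le> L2_norm M (\<lambda>x. u x - v x)"
      using hm L2.diff_mem[OF u L2_space_UNIV[OF v(1)]] by (intro L2_norm_mono) auto
    then show "L2_norm M h \<le> 0 + e" using v by simp
  qed
  then have "AE x in M. h x = 0" using L2_norm_eq_0[OF h] by blast
  then have "AE x in M. x \<notin> \<Omega> \<longrightarrow> u x = 0" by eventually_elim (auto simp: h_def indicator_def)
  then show ?thesis using u L2_space_restrict by blast
qed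

lemma L2_space_complete:
  fixes u :: "nat \<Rightarrow> 'a \<Rightarrow> real"
  assumes Om: "\<Omega> \<in> sets M" and u: "\<And>n. u n \<in> L2_space M \<Omega>"
    and Cauchy: "\<And>e. e > 0 \<Longrightarrow> \<exists>N. \<forall>m\<ge>N. \<forall>n\<ge>N. L2_norm M (\<lambda>x. u m x - u n x) < e"
  shows "\<exists>v\<in>L2_space M \<Omega>. (\<lambda>n. L2_norm M (\<lambda>x. u n x - v x)) \<longlonglongrightarrow> 0"
proof -
  obtain v where v: "v \<in> L2_space M UNIV" "(\<lambda>n. L2_norm M (\<lambda>x. u n x - v x)) \<longlonglongrightarrow> 0"
    using L2_complete[of u M, OF L2_space_UNIV[OF u] Cauchy] by blast
  have "v \<in> L2_space M \<Omega>"
  proof (rule L2_space_closed[OF Om v(1)])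
    fix e :: real assume "e > 0"
    then obtain n where "L2_norm M (\<lambda>x. u n x - v x) < e"
      using eventually_happens[OF order_tendstoD(2)[OF v(2)]] by force
    then show "\<exists>w\<in>L2_space M \<Omega>. L2_norm M (\<lambda>x. v x - w x) < e"
      using u L2_norm_commute[of M "u n" v] by (intro bexI[of _ "u n"]) auto
  qed
  then show ?thesis using v(2) by blast
qed

section \<open>Minimising sequences in closed forms\<close>

context psform
begin

lemma plus_L2:
  assumes "l \<ge> 0"
  shows "positive_symmetric_form M D (\<lambda>u v. E u v + l * (\<integral>x. u x * v x \<partial>M))"
  unfolding positive_symmetric_form_def
  apply (intro conjI ballI allI impI)
  subgoal using D_L2 by auto
  subgoal using D_cong by blast
  subgoal for u v w using E_cong_left[of u v w] L2.E_cong_left[OF D_L2 D_L2 D_L2, of u v w] by simp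
  subgoal by (rule zero_mem)
  subgoal by (rule add_mem)
  subgoal by (rule scale_mem)
  subgoal for u v w
    using L2.E_add_left[OF D_L2 D_L2 D_L2, of u v w] E_add_left[of u v w] by (simp add: algebra_simps)
  subgoal for c u w
    using L2.E_scale_left[OF D_L2 D_L2, of u w c] E_scale_left[of u w c] by (simp add: algebra_simps)
  subgoal for u v using L2.E_sym[OF D_L2 D_L2, of u v] E_sym[of u v] by simp
  subgoal using assms by (simp add: E_nonneg)
  done

lemma graph_norm_alt: "graph_norm M E u = sqrt (E u u + 1 * (\<integral>x. u x * u x \<partial>M))"
  by (simp add: graph_norm_def L2_norm_alt)

lemma graph_norm_sq: "u \<in> D \<Longrightarrow> (graph_norm M E u)\<^sup>2 = E u u + (L2_norm M u)\<^sup>2"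
  by (simp add: graph_norm_def E_nonneg)

lemma graph_norm_nonneg: "u \<in> D \<Longrightarrow> graph_norm M E u \<ge> 0"
  by (simp add: graph_norm_def E_nonneg)

lemma graph_norm_triangle:
  "u \<in> D \<Longrightarrow> v \<in> D \<Longrightarrow> graph_norm M E (\<lambda>x. u x + v x) \<le> graph_norm M E u + graph_norm M E v"
  unfolding graph_norm_alt by (rule psform.sqrt_triangle[OF psform.intro[OF plus_L2]]) auto

lemma graph_norm_commute:
  "u \<in> D \<Longrightarrow> v \<in> D \<Longrightarrow> graph_norm M E (\<lambda>x. u x - v x) = graph_norm M E (\<lambda>x. v x - u x)"
  unfolding graph_norm_alt by (rule psform.sqrt_diff_commute[OF psform.intro[OF plus_L2]]) auto

lemma graph_norm_scale: "u \<in> D \<Longrightarrow> graph_norm M E (\<lambda>x. c * u x) = \<bar>c\<bar> * graph_norm M E u"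
  unfolding graph_norm_alt by (rule psform.sqrt_scale[OF psform.intro[OF plus_L2]]) auto

lemma graph_norm_triangle_diff:
  assumes "u \<in> D" "v \<in> D" "w \<in> D"
  shows "graph_norm M E (\<lambda>x. u x - w x) \<le> graph_norm M E (\<lambda>x. u x - v x) + graph_norm M E (\<lambda>x. v x - w x)"
  using graph_norm_triangle[OF diff_mem[OF assms(1,2)] diff_mem[OF assms(2,3)]] by simp

lemma graph_norm_cong:
  assumes "u \<in> D" "v \<in> D" "AE x in M. u x = v x"
  shows "graph_norm M E u = graph_norm M E v"
proof -
  have "L2_norm M u = L2_norm M v" using assms D_L2 by (intro L2_norm_cong) (auto dest: L2_spaceD)
  then show ?thesis using E_cong[OF assms] by (simp add: graph_norm_def)
qed

lemma L2_norm_le_graph_norm: "u \<in> D \<Longrightarrow> L2_norm M u \<le> graph_norm M E u"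
  unfolding graph_norm_def by (rule real_le_rsqrt) (simp add: E_nonneg)

lemma sqrt_E_le_graph_norm: "u \<in> D \<Longrightarrow> sqrt (E u u) \<le> graph_norm M E u"
  unfolding graph_norm_def by simp

lemma E_le_graph_norm: "u \<in> D \<Longrightarrow> E u u \<le> (graph_norm M E u)\<^sup>2"
  by (simp add: graph_norm_sq)

lemma abs_E_le_graph_norm:
  assumes "u \<in> D" "v \<in> D"
  shows "\<bar>E u v\<bar> \<le> graph_norm M E u * graph_norm M E v"
proof -
  have "\<bar>E u v\<bar> \<le> sqrt (E u u) * sqrt (E v v)" using assms by (rule Cauchy_Schwarz)
  also have "\<dots> \<le> graph_norm M E u * graph_norm M E v"
    using assms by (intro mult_mono sqrt_E_le_graph_norm graph_norm_nonneg) (auto simp: E_nonneg)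
  finally show ?thesis .
qed

lemma abs_L2_inner_le_graph_norm:
  assumes "u \<in> D" "v \<in> D"
  shows "\<bar>\<integral>x. u x * v x \<partial>M\<bar> \<le> graph_norm M E u * graph_norm M E v"
proof -
  have "\<bar>\<integral>x. u x * v x \<partial>M\<bar> \<le> L2_norm M u * L2_norm M v" using assms D_L2 by (intro L2_inner_le)
  also have "\<dots> \<le> graph_norm M E u * graph_norm M E v"
    using assms by (intro mult_mono L2_norm_le_graph_norm graph_norm_nonneg) auto
  finally show ?thesis .
qed

end

locale closed_psform = psform +
  assumes closed: "closed_form M D E"
begin

lemma complete:
  assumes "\<And>n::nat. u n \<in> D"
    and "\<And>e. e > 0 \<Longrightarrow> \<exists>N. \<forall>m\<ge>N. \<forall>n\<ge>N. graph_norm M E (\<lambda>x. u m x - u n x) < e"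
  shows "\<exists>v\<in>D. (\<lambda>n. graph_norm M E (\<lambda>x. u n x - v x)) \<longlonglongrightarrow> 0"
  using closed assms unfolding closed_form_def by blast

text \<open>The sets \<open>K n\<close> decrease, so the infima of the functional over them increase to a finite
  limit, and the parallelogram law makes near-minimisers a Cauchy sequence.\<close>

lemma minimizing_sequence:
  fixes l b :: real and f :: "'a \<Rightarrow> real" and K :: "nat \<Rightarrow> ('a \<Rightarrow> real) set"
  defines "J \<equiv> \<lambda>u. E u u + l * (L2_norm M (\<lambda>x. u x - f x))\<^sup>2"
  assumes l: "l \<ge> 1" and f: "f \<in> L2_space M UNIV"
    and KD: "\<And>n. K n \<subseteq> D" and dec: "\<And>n. K (Suc n) \<subseteq> K n"
    and mid: "\<And>n u v. u \<in> K n \<Longrightarrow> v \<in> K n \<Longrightarrow> (\<lambda>x. (u x + v x) / 2) \<in> K n"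
    and bound: "\<And>n. \<exists>u\<in>K n. J u \<le> b"
  shows "\<exists>u y. y \<in> D \<and> (\<forall>n. u n \<in> K n \<and> (\<forall>v\<in>K n. J (u n) \<le> J v + 1 / Suc n)) \<and>
    (\<lambda>n. graph_norm M E (\<lambda>x. u n x - y x)) \<longlonglongrightarrow> 0"
proof -
  have J0: "J u \<ge> 0" if "u \<in> D" for u unfolding J_def using l E_nonneg[OF that] by simp
  define d where "d n = (INF u\<in>K n. J u)" for n
  have bdd: "bdd_below (J ` K n)" for n using J0 KD by (intro bdd_belowI2[of _ 0]) auto
  have ne: "K n \<noteq> {}" for n using bound[of n] by auto
  have d_le: "d n \<le> J v" if "v \<in> K n" for n v unfolding d_def using bdd that by (rule cINF_lower)
  have d_b: "d n \<le> b" for n using bound[of n] d_le order_trans by blast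
  have "d n \<le> d (Suc n)" for n
    unfolding d_def using dec ne bdd by (intro cINF_superset_mono) auto
  then have "incseq d" by (rule incseq_SucI)
  then have "convergent d" using d_b by (metis convergentI incseq_convergent)
  then have dC: "Cauchy d" by (simp add: Cauchy_convergent_iff)
  have dmono: "m \<le> n \<Longrightarrow> d m \<le> d n" for m n using \<open>incseq d\<close> by (simp add: incseqD)
  have Kmono: "m \<le> n \<Longrightarrow> K n \<subseteq> K m" for m n using dec by (rule lift_Suc_antimono_le)
  have "\<exists>u\<in>K n. J u < d n + 1 / Suc n" for n
    unfolding d_def using cINF_less_iff[OF ne bdd, of n "(INF u\<in>K n. J u) + 1 / Suc n"] by simp
  then obtain u where u: "\<And>n. u n \<in> K n" "\<And>n. J (u n) < d n + 1 / Suc n" by metis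
  have uD: "u n \<in> D" for n using u(1) KD by blast
  have par: "J (\<lambda>x. (v x + w x) / 2) = (J v + J w) / 2
      - (E (\<lambda>x. v x - w x) (\<lambda>x. v x - w x) + l * (L2_norm M (\<lambda>x. v x - w x))\<^sup>2) / 4"
    if "v \<in> D" "w \<in> D" for v w
  proof -
    have vf: "(\<lambda>x. v x - f x) \<in> L2_space M UNIV" "(\<lambda>x. w x - f x) \<in> L2_space M UNIV"
      using that D_L2 f by (auto intro!: L2.diff_mem)
    have eq: "(\<lambda>x. (v x + w x) / 2 - f x) = (\<lambda>x. ((v x - f x) + (w x - f x)) / 2)"
      by (auto simp: field_simps)
    have "(L2_norm M (\<lambda>x. (v x + w x) / 2 - f x))\<^sup>2
      = ((L2_norm M (\<lambda>x. v x - f x))\<^sup>2 + (L2_norm M (\<lambda>x. w x - f x))\<^sup>2) / 2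
        - (L2_norm M (\<lambda>x. v x - w x))\<^sup>2 / 4"
      unfolding eq L2_norm_sq' L2.E_midpoint(2)[OF vf] by simp
    note L2_part = this
    show ?thesis
      unfolding J_def E_midpoint(2)[OF that] L2_part
      by (simp add: algebra_simps add_divide_distrib diff_divide_distrib)
  qed
  \<comment> \<open>For \<open>m, n \<ge> N\<close> both functions lie in \<open>K N\<close>, hence
    so does their midpoint, whose value is at least \<open>d N\<close>. The parallelogram law then
    bounds the difference; \<open>l \<ge> 1\<close> makes the functional control the graph
    norm.\<close>
  have est: "(graph_norm M E (\<lambda>x. u m x - u n x))\<^sup>2 \<le> 2 * d m + 2 * d n - 4 * d N + 4 * (1 / Suc N)"
    if mn: "m \<ge> N" "n \<ge> N" for m n N
  proof -
    let ?w = "\<lambda>x. u m x - u n x"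
    have "d N \<le> J (\<lambda>x. (u m x + u n x) / 2)"
      using u(1)[of m] u(1)[of n] Kmono[OF mn(1)] Kmono[OF mn(2)] by (intro d_le mid) auto
    moreover have "J (u m) \<le> d m + 1 / Suc N" "J (u n) \<le> d n + 1 / Suc N"
      using u(2)[of m] u(2)[of n] mn frac_le[of 1 1 "real (Suc N)" "real (Suc m)"]
        frac_le[of 1 1 "real (Suc N)" "real (Suc n)"] by auto
    moreover define X where "X = E ?w ?w + l * (L2_norm M ?w)\<^sup>2"
    ultimately have "X \<le> 2 * d m + 2 * d n - 4 * d N + 4 * (1 / Suc N)"
      unfolding par[OF uD uD] X_def[symmetric] by argo
    moreover have "(L2_norm M ?w)\<^sup>2 \<le> l * (L2_norm M ?w)\<^sup>2" using l by (simp add: mult_le_cancel_right1)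
    ultimately show ?thesis using graph_norm_sq[OF diff_mem[OF uD uD], of m n] unfolding X_def by linarith
  qed
  have "\<exists>y\<in>D. (\<lambda>n. graph_norm M E (\<lambda>x. u n x - y x)) \<longlonglongrightarrow> 0"
  proof (rule complete[OF uD])
    fix e :: real assume e: "e > 0"
    \<comment> \<open>The bounds \<open>e\<^sup>2 / 8\<close> and \<open>e\<^sup>2 / 16\<close>
      contribute \<open>e\<^sup>2 / 2\<close> from the values of \<open>d\<close> and
      \<open>e\<^sup>2 / 4\<close> from the error term in \<open>est\<close>.\<close>
    obtain N1 where N1: "\<And>m n. m \<ge> N1 \<Longrightarrow> n \<ge> N1 \<Longrightarrow> dist (d m) (d n) < e\<^sup>2 / 8"
      using dC[unfolded Cauchy_def] e by (metis divide_pos_pos zero_less_numeral zero_less_power)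
    obtain N2 where N2: "1 / real (Suc N2) < e\<^sup>2 / 16"
      using reals_Archimedean[of "e\<^sup>2 / 16"] e by (auto simp: inverse_eq_divide)
    define N where "N = max N1 N2"
    have N: "1 / real (Suc N) \<le> 1 / real (Suc N2)" by (intro divide_left_mono) (auto simp: N_def)
    have "graph_norm M E (\<lambda>x. u m x - u n x) < e" if "m \<ge> N" "n \<ge> N" for m n
    proof -
      have "\<bar>d m - d N\<bar> < e\<^sup>2 / 8" "\<bar>d n - d N\<bar> < e\<^sup>2 / 8"
        using N1[of m N] N1[of n N] that by (auto simp: N_def dist_real_def)
      moreover have "e\<^sup>2 > 0" using e by simp
      ultimately have "(graph_norm M E (\<lambda>x. u m x - u n x))\<^sup>2 < e\<^sup>2"
        using est[OF that] N N2 by linarith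
      then show ?thesis using e by (simp add: power2_less_imp_less)
    qed
    then show "\<exists>N. \<forall>m\<ge>N. \<forall>n\<ge>N. graph_norm M E (\<lambda>x. u m x - u n x) < e" by blast
  qed
  then obtain y where "y \<in> D" "(\<lambda>n. graph_norm M E (\<lambda>x. u n x - y x)) \<longlonglongrightarrow> 0" by blast
  moreover have "J (u n) \<le> J v + 1 / Suc n" if "v \<in> K n" for n v
    using u(2)[of n] d_le[OF that] by linarith
  ultimately show ?thesis using u(1) by blast
qed

text \<open>A substitute for weak compactness: energy-bounded \<open>L\<^sub>2\<close>-limits belong to the form domain.\<close>

lemma bounded_energy_limit:
  fixes C :: "('a \<Rightarrow> real) set"
  assumes CD: "C \<subseteq> D" and f: "f \<in> L2_space M UNIV"
    and mid: "\<And>u v. u \<in> C \<Longrightarrow> v \<in> C \<Longrightarrow> (\<lambda>x. (u x + v x) / 2) \<in> C"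
    and approx: "\<And>e. e > 0 \<Longrightarrow> \<exists>w\<in>C. L2_norm M (\<lambda>x. w x - f x) < e \<and> E w w \<le> b"
  shows "f \<in> D" "e > 0 \<Longrightarrow> \<exists>w\<in>C. graph_norm M E (\<lambda>x. f x - w x) < e"
proof -
  \<comment> \<open>These sets shrink towards \<open>f\<close> in \<open>L\<^sub>2\<close> while the
    infima of the functional stay below \<open>b + 1\<close>. Near-minimisers therefore converge in
    the graph norm, and their limit can only be \<open>f\<close>.\<close>
  define K where "K n = {w\<in>C. L2_norm M (\<lambda>x. w x - f x) \<le> 1 / Suc n}" for n :: nat
  have K1: "K n \<subseteq> D" for n using CD by (auto simp: K_def)
  have K2: "K (Suc n) \<subseteq> K n" for n
  proof -
    have "1 / real (Suc (Suc n)) \<le> 1 / real (Suc n)" by (intro divide_left_mono) auto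
    then show ?thesis by (auto simp: K_def)
  qed
  have K3: "(\<lambda>x. (u x + v x) / 2) \<in> K n" if "u \<in> K n" "v \<in> K n" for n u v
  proof -
    have uv: "(\<lambda>x. 1/2 * (u x - f x)) \<in> L2_space M UNIV" "(\<lambda>x. 1/2 * (v x - f x)) \<in> L2_space M UNIV"
      using that K1 D_L2 f by (intro L2.scale_mem L2.diff_mem; blast)+
    have "(\<lambda>x. (u x + v x) / 2 - f x) = (\<lambda>x. 1/2 * (u x - f x) + 1/2 * (v x - f x))"
      by (auto simp: field_simps)
    then have "L2_norm M (\<lambda>x. (u x + v x) / 2 - f x)
        \<le> 1/2 * L2_norm M (\<lambda>x. u x - f x) + 1/2 * L2_norm M (\<lambda>x. v x - f x)"
      using L2_norm_triangle[OF uv] unfolding L2_norm_scale by simp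
    then show ?thesis using that mid by (auto simp: K_def)
  qed
  have K4: "\<exists>u\<in>K n. E u u + 1 * (L2_norm M (\<lambda>x. u x - f x))\<^sup>2 \<le> b + 1" for n
  proof -
    obtain w where w: "w \<in> C" "L2_norm M (\<lambda>x. w x - f x) < 1 / Suc n" "E w w \<le> b"
      using approx[of "1 / Suc n"] by auto
    have "1 / real (Suc n) \<le> 1" by simp
    with w(2) have "L2_norm M (\<lambda>x. w x - f x) \<le> 1" by linarith
    then have "(L2_norm M (\<lambda>x. w x - f x))\<^sup>2 \<le> 1" by (intro power_le_one) auto
    then show ?thesis using w by (intro bexI[of _ w]) (auto simp: K_def)
  qed
  obtain u y where y: "y \<in> D" and u: "\<And>n. u n \<in> K n"
    and lim: "(\<lambda>n. graph_norm M E (\<lambda>x. u n x - y x)) \<longlonglongrightarrow> 0"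
    using minimizing_sequence[of 1 f K, OF order_refl f K1 K2 K3 K4] by blast
  have uD: "u n \<in> D" for n using u K1 by blast
  have AE: "AE x in M. y x = f x"
  proof (rule L2_eq_of_norm_le)
    fix e :: real assume e: "e > 0"
    have "(\<lambda>n. graph_norm M E (\<lambda>x. u n x - y x) + 1 / Suc n) \<longlonglongrightarrow> 0 + 0"
      by (intro tendsto_add lim LIMSEQ_Suc[OF lim_1_over_n])
    then have "\<forall>\<^sub>F n in sequentially. graph_norm M E (\<lambda>x. u n x - y x) + 1 / Suc n < e"
      using e by (intro order_tendstoD) auto
    then obtain n where n: "graph_norm M E (\<lambda>x. u n x - y x) + 1 / Suc n < e"
      using eventually_happens by force
    have "L2_norm M (\<lambda>x. y x - f x) \<le> L2_norm M (\<lambda>x. y x - u n x) + L2_norm M (\<lambda>x. u n x - f x)"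
      using uD y f D_L2 by (intro L2_norm_triangle_diff) auto
    also have "\<dots> \<le> graph_norm M E (\<lambda>x. u n x - y x) + 1 / Suc n"
      using L2_norm_le_graph_norm[OF diff_mem[OF uD y], of n] u[of n] L2_norm_commute[of M y "u n"]
      by (auto simp: K_def)
    finally show "L2_norm M (\<lambda>x. y x - f x) \<le> e" using n by simp
  qed (use y f D_L2 in auto)
  show fD: "f \<in> D" using D_cong[OF y _ AE] f by (auto dest: L2_spaceD)
  assume "e > 0"
  then obtain n where n: "graph_norm M E (\<lambda>x. u n x - y x) < e"
    using eventually_happens[OF order_tendstoD(2)[OF lim]] by force
  have "graph_norm M E (\<lambda>x. f x - u n x) = graph_norm M E (\<lambda>x. y x - u n x)"
    using AE by (intro graph_norm_cong diff_mem fD uD y) auto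
  then show "\<exists>w\<in>C. graph_norm M E (\<lambda>x. f x - w x) < e"
    using n u[of n] graph_norm_commute[OF uD y, of n] by (intro bexI[of _ "u n"]) (auto simp: K_def)
qed

text \<open>The function \<open>u\<close> minimises \<open>J\<close>, and the stated identity is the
  Euler-Lagrange equation \<open>H u = l (f - u)\<close>, so \<open>u\<close> is
  \<open>l (l + H)\<close> inverse applied to \<open>f\<close>. The set \<open>K\<close> of the
  minimisation is constantly \<open>D\<close>.\<close>

lemma resolvent_exists:
  assumes l: "l \<ge> 1" and f: "f \<in> L2_space M UNIV"
  shows "\<exists>u\<in>D. \<forall>v\<in>D. E u v = (\<integral>x. (l * (f x - u x)) * v x \<partial>M)"
proof -
  define J where "J u = E u u + l * (L2_norm M (\<lambda>x. u x - f x))\<^sup>2" for u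
  have "\<exists>u y. y \<in> D \<and> (\<forall>n. u n \<in> D \<and> (\<forall>v\<in>D. J (u n) \<le> J v + 1 / Suc n)) \<and>
    (\<lambda>n. graph_norm M E (\<lambda>x. u n x - y x)) \<longlonglongrightarrow> 0"
    unfolding J_def
    by (rule minimizing_sequence[of l f "\<lambda>_. D" "J (\<lambda>x. 0)"]) 
      (use l f zero_mem E_midpoint(1) in \<open>auto simp: J_def intro!: bexI[of _ "\<lambda>x. 0"]\<close>)
  then obtain u y where y: "y \<in> D" and u: "\<And>n. u n \<in> D" "\<And>n v. v \<in> D \<Longrightarrow> J (u n) \<le> J v + 1 / Suc n"
    and lim: "(\<lambda>n. graph_norm M E (\<lambda>x. u n x - y x)) \<longlonglongrightarrow> 0"
    by blast
  have "E y v = (\<integral>x. (l * (f x - y x)) * v x \<partial>M)" if v: "v \<in> D" for v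
  proof -
    define B where "B w = E w v + l * (\<integral>x. (w x - f x) * v x \<partial>M)" for w
    define A where "A = E v v + l * (L2_norm M v)\<^sup>2"
    have fv: "f \<in> L2_space M UNIV" "v \<in> L2_space M UNIV" using f v D_L2 by auto
    \<comment> \<open>Near-minimality is turned into an inequality whose only dependence on
      \<open>u n\<close> is through the linear term \<open>B (u n)\<close>, so that only
      \<open>B\<close>, and not \<open>J\<close>, has to be passed to the limit.\<close>
    have step: "0 \<le> 2 * s * B (u n) + s\<^sup>2 * A + 1 / Suc n" for s n
    proof -
      have unf: "(\<lambda>x. u n x - f x) \<in> L2_space M UNIV" using u f D_L2 by (intro L2.diff_mem) auto
      have eq: "(\<lambda>x. u n x + s * v x - f x) = (\<lambda>x. (u n x - f x) + s * v x)" by auto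
      have "J (\<lambda>x. u n x + s * v x) = J (u n) + 2 * s * B (u n) + s\<^sup>2 * A"
        unfolding J_def B_def A_def eq E_add_scale[OF u(1) v] L2_norm_sq' L2.E_add_scale[OF unf fv(2)]
        by (simp only: distrib_left distrib_right mult_ac add_ac)
      moreover have "J (u n) \<le> J (\<lambda>x. u n x + s * v x) + 1 / Suc n"
        by (intro u(2) add_mem scale_mem u(1) v)
      ultimately show ?thesis by linarith
    qed
    have "(\<lambda>n. B (u n)) \<longlonglongrightarrow> B y"
    proof (rule LIM_zero_cancel, rule Lim_null_comparison)
      show "(\<lambda>n. (1 + l) * (graph_norm M E (\<lambda>x. u n x - y x) * graph_norm M E v)) \<longlonglongrightarrow> 0"
        using tendsto_mult_right[OF tendsto_mult_left[OF lim, of "graph_norm M E v"], of "1+l"]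
        by (auto intro!: tendsto_mult_right_zero tendsto_mult_left_zero lim)
      show "\<forall>\<^sub>F n in sequentially. norm (B (u n) - B y)
          \<le> (1 + l) * (graph_norm M E (\<lambda>x. u n x - y x) * graph_norm M E v)"
      proof (rule always_eventually, rule allI)
        fix n
        have uy: "(\<lambda>x. u n x - y x) \<in> D" using u y by (intro diff_mem)
        have "(\<integral>x. (u n x - f x) * v x \<partial>M) - (\<integral>x. (y x - f x) * v x \<partial>M) = (\<integral>x. (u n x - y x) * v x \<partial>M)"
          using u(1)[of n] y fv D_L2 by (subst (1 2 3) L2.E_diff_left) auto
        then have "B (u n) - B y = E (\<lambda>x. u n x - y x) v + l * (\<integral>x. (u n x - y x) * v x \<partial>M)"
          unfolding B_def E_diff_left[OF u(1) y v] by (simp add: algebra_simps)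
        also have "\<bar>\<dots>\<bar> \<le> \<bar>E (\<lambda>x. u n x - y x) v\<bar> + l * \<bar>\<integral>x. (u n x - y x) * v x \<partial>M\<bar>"
          using l by (intro order_trans[OF abs_triangle_ineq]) (simp add: abs_mult)
        also have "\<dots> \<le> graph_norm M E (\<lambda>x. u n x - y x) * graph_norm M E v
            + l * (graph_norm M E (\<lambda>x. u n x - y x) * graph_norm M E v)"
          using l by (intro add_mono mult_left_mono abs_E_le_graph_norm abs_L2_inner_le_graph_norm uy v) auto
        finally show "norm (B (u n) - B y)
          \<le> (1 + l) * (graph_norm M E (\<lambda>x. u n x - y x) * graph_norm M E v)"
          by (simp add: algebra_simps)
      qed
    qed
    then have limB: "(\<lambda>n. 2 * s * B (u n) + s\<^sup>2 * A + 1 / Suc n) \<longlonglongrightarrow> 2 * s * B y + s\<^sup>2 * A + 0" for s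
      by (intro tendsto_intros LIMSEQ_Suc[OF lim_1_over_n])
    have "0 \<le> 2 * s * B y + s\<^sup>2 * A" for s
      using LIMSEQ_le_const[OF limB[of s], of 0] step[of s] by auto
    then have "B y = 0" by (rule nonneg_perturbation_zero)
    then have "E y v = - l * (\<integral>x. (y x - f x) * v x \<partial>M)" by (simp add: B_def)
    also have "\<dots> = (\<integral>x. - l * ((y x - f x) * v x) \<partial>M)" by simp
    also have "\<dots> = (\<integral>x. (l * (f x - y x)) * v x \<partial>M)"
      by (intro Bochner_Integration.integral_cong) (auto simp: algebra_simps)
    finally show ?thesis .
  qed
  then show ?thesis using y by blast
qed

end

section \<open>Local Dirichlet forms\<close>

definition clip :: "real \<Rightarrow> real \<Rightarrow> real" where
  "clip c s = min (max 0 s) c"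

lemma clip_measurable [measurable]: "clip c \<in> borel_measurable borel"
  unfolding clip_def[abs_def] by measurable

lemma clip_scale: "c > 0 \<Longrightarrow> clip c s = c * clip 1 ((1 / c) * s)"
  by (auto simp: clip_def min_def max_def field_simps)

locale local_dirichlet =
  fixes M :: "'a measure" and D :: "('a \<Rightarrow> real) set"
    and E :: "('a \<Rightarrow> real) \<Rightarrow> ('a \<Rightarrow> real) \<Rightarrow> real"
  assumes dform: "dirichlet_form M D E" and loc: "local_form M D E"

sublocale local_dirichlet \<subseteq> closed_psform
  using dform unfolding dirichlet_form_def by unfold_locales blast+

context local_dirichlet
begin

lemma D_meas: "u \<in> D \<Longrightarrow> u \<in> borel_measurable M"
  using D_L2 L2_spaceD(1) by blast

lemma local_zero: "u \<in> D \<Longrightarrow> v \<in> D \<Longrightarrow> AE x in M. u x * v x = 0 \<Longrightarrow> E u v = 0"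
  using loc E_sym unfolding local_form_def by metis

text \<open>The hypothesis says that \<open>u\<close> is \<open>v\<close> cut down to a set.
  Locality makes \<open>u\<close> and \<open>v - u\<close> orthogonal, so their energies add up to
  that of \<open>v\<close>.\<close>

lemma local_le:
  assumes "u \<in> D" "v \<in> D" "AE x in M. u x * (v x - u x) = 0"
  shows "E u u \<le> E v v"
proof -
  have d: "(\<lambda>x. v x - u x) \<in> D" using assms by (intro diff_mem)
  have "E v v = E (\<lambda>x. u x + (v x - u x)) (\<lambda>x. u x + (v x - u x))" by simp
  also have "\<dots> = E u u + E (\<lambda>x. v x - u x) (\<lambda>x. v x - u x)"
    using local_zero[OF assms(1) d assms(3)] E_add_self[OF assms(1) d] by simp
  finally show ?thesis using E_nonneg[OF d] by simp
qed

lemma clip_mem: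
  assumes "u \<in> D" "c > 0"
  shows "(\<lambda>x. clip c (u x)) \<in> D" "E (\<lambda>x. clip c (u x)) (\<lambda>x. clip c (u x)) \<le> E u u"
proof -
  define v where "v x = (1 / c) * u x" for x
  have v: "v \<in> D" unfolding v_def using assms by (intro scale_mem)
  have "(\<lambda>x. min (max 0 (v x)) 1) \<in> D \<and>
      E (\<lambda>x. min (max 0 (v x)) 1) (\<lambda>x. min (max 0 (v x)) 1) \<le> E v v"
    using dform v unfolding dirichlet_form_def by blast
  then have p: "(\<lambda>x. clip 1 (v x)) \<in> D" "E (\<lambda>x. clip 1 (v x)) (\<lambda>x. clip 1 (v x)) \<le> E v v"
    by (auto simp: clip_def)
  have eq: "(\<lambda>x. clip c (u x)) = (\<lambda>x. c * clip 1 (v x))"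
    using clip_scale[OF assms(2)] by (auto simp: v_def)
  show "(\<lambda>x. clip c (u x)) \<in> D" unfolding eq using p by (intro scale_mem)
  have "E (\<lambda>x. c * clip 1 (v x)) (\<lambda>x. c * clip 1 (v x)) = c\<^sup>2 * E (\<lambda>x. clip 1 (v x)) (\<lambda>x. clip 1 (v x))"
    using p by (simp add: E_scale_left E_scale_right scale_mem power2_eq_square)
  also have "\<dots> \<le> c\<^sup>2 * E v v" using p by (intro mult_left_mono) auto
  also have "\<dots> = E u u"
    unfolding v_def[abs_def] using assms
    by (simp add: E_scale_left[OF _ scale_mem] E_scale_right power2_eq_square del: divide_inverse times_divide_eq_left)
  finally show "E (\<lambda>x. clip c (u x)) (\<lambda>x. clip c (u x)) \<le> E u u" unfolding eq .
qed

text \<open>Adding a positive multiple of \<open>u - clip c u\<close> to \<open>clip c u\<close> does not change its image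
  under \<open>clip c\<close>, so the energy cannot decrease in that direction.\<close>

lemma E_clip_nonneg:
  assumes "u \<in> D" "c > 0"
  shows "0 \<le> E u (\<lambda>x. clip c (u x))"
proof -
  define p where "p x = clip c (u x)" for x
  have p: "p \<in> D" unfolding p_def using assms by (rule clip_mem)
  have q: "(\<lambda>x. u x - p x) \<in> D" using assms p by (intro diff_mem)
  have "0 \<le> E p (\<lambda>x. u x - p x)"
  proof (rule nonneg_perturbation)
    fix s :: real assume s: "s > 0"
    have w: "(\<lambda>x. p x + s * (u x - p x)) \<in> D" using p q by (intro add_mem scale_mem)
    have "clip c (p x + s * (u x - p x)) = p x" for x
    proof -
      consider "u x \<le> 0" | "0 \<le> u x" "u x \<le> c" | "c \<le> u x" by linarith
      then show ?thesis
      proof cases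
        case 1
        then show ?thesis using s assms by (simp add: p_def clip_def mult_nonneg_nonpos)
      next
        case 2
        then show ?thesis by (simp add: p_def clip_def)
      next
        case 3
        moreover have "s * (u x - c) \<ge> 0" using 3 s by simp
        ultimately show ?thesis using s assms by (simp add: p_def clip_def)
      qed
    qed
    then have "E p p \<le> E (\<lambda>x. p x + s * (u x - p x)) (\<lambda>x. p x + s * (u x - p x))"
      using clip_mem(2)[OF w assms(2)] by simp
    then show "0 \<le> 2 * s * E p (\<lambda>x. u x - p x) + s\<^sup>2 * E (\<lambda>x. u x - p x) (\<lambda>x. u x - p x)"
      unfolding E_add_scale[OF p q] by simp
  qed
  then have "E p p \<le> E p u" using E_diff_right[OF assms(1) p p] by simp
  then have "0 \<le> E u p" using E_nonneg[OF p] E_sym[OF p assms(1)] by simp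
  then show ?thesis unfolding p_def[abs_def] .
qed

text \<open>The Dirichlet property truncates at finite heights only. The truncations at height
  \<open>n + 1\<close> converge to the positive part in \<open>L\<^sub>2\<close> and have energy at
  most \<open>E u u\<close>.\<close>

lemma pos_part_mem:
  assumes u: "u \<in> D"
  shows "(\<lambda>x. max 0 (u x)) \<in> D"
proof (rule bounded_energy_limit(1)[of D])
  have um: "u \<in> borel_measurable M" using u by (rule D_meas)
  show "(\<lambda>x. max 0 (u x)) \<in> L2_space M UNIV"
    using um by (intro L2_space_bound[OF D_L2[OF u]]) auto
  fix e :: real assume e: "e > 0"
  have lim: "(\<lambda>n. L2_norm M (\<lambda>x. clip (real (Suc n)) (u x) - max 0 (u x))) \<longlonglongrightarrow> 0"
  proof (rule L2_norm_dominated[OF D_L2[OF u]])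
    show "AE x in M. (\<lambda>n. clip (real (Suc n)) (u x)) \<longlonglongrightarrow> max 0 (u x)"
    proof (rule AE_I2)
      fix x
      obtain N :: nat where N: "u x \<le> real N" using real_arch_simple by blast
      have "\<forall>\<^sub>F n in sequentially. clip (real (Suc n)) (u x) = max 0 (u x)"
        using eventually_ge_at_top[of N] by eventually_elim (use N in \<open>auto simp: clip_def\<close>)
      then show "(\<lambda>n. clip (real (Suc n)) (u x)) \<longlonglongrightarrow> max 0 (u x)" by (rule tendsto_eventually)
    qed
  qed (use um in \<open>auto simp: clip_def\<close>)
  obtain n where "L2_norm M (\<lambda>x. clip (real (Suc n)) (u x) - max 0 (u x)) < e"
    using eventually_happens[OF order_tendstoD(2)[OF lim e]] by auto
  then show "\<exists>w\<in>D. L2_norm M (\<lambda>x. w x - max 0 (u x)) < e \<and> E w w \<le> E u u"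
    using clip_mem[OF u, of "real (Suc n)"] by (intro bexI[of _ "\<lambda>x. clip (real (Suc n)) (u x)"]) auto
qed (use E_midpoint in auto)

lemma E_pos_part_le: "u \<in> D \<Longrightarrow> E (\<lambda>x. max 0 (u x)) (\<lambda>x. max 0 (u x)) \<le> E u u"
  by (rule local_le[OF pos_part_mem]) (auto simp: max_def)

text \<open>Subtracting the positive part \<open>w\<close> of \<open>u - v\<close> from
  \<open>u\<close> gives the minimum. The constants come from using \<open>E_diff_le\<close> twice,
  for \<open>u - w\<close> and for \<open>u - v\<close>; only the boundedness of the energy matters
  later.\<close>

lemma min_mem:
  assumes "u \<in> D" "v \<in> D"
  shows "(\<lambda>x. min (u x) (v x)) \<in> D"
    "E (\<lambda>x. min (u x) (v x)) (\<lambda>x. min (u x) (v x)) \<le> 6 * E u u + 4 * E v v"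
proof -
  define w where "w x = max 0 (u x - v x)" for x
  have w: "w \<in> D" unfolding w_def using assms by (intro pos_part_mem diff_mem)
  have eq: "(\<lambda>x. min (u x) (v x)) = (\<lambda>x. u x - w x)" by (auto simp: w_def)
  show "(\<lambda>x. min (u x) (v x)) \<in> D" unfolding eq using assms w by (intro diff_mem)
  have "E w w \<le> E (\<lambda>x. u x - v x) (\<lambda>x. u x - v x)"
    unfolding w_def using assms by (intro E_pos_part_le diff_mem)
  then show "E (\<lambda>x. min (u x) (v x)) (\<lambda>x. min (u x) (v x)) \<le> 6 * E u u + 4 * E v v"
    unfolding eq using E_diff_le[OF assms] E_diff_le[OF assms(1) w] by linarith
qed

end

section \<open>Supports and cutoff functions\<close>

locale dirichlet_space = local_dirichlet M D E
  for M :: "'a::metric_space measure" and D E +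
  assumes locally_compact: "locally compact (UNIV :: 'a set)"
    and sigma_compact: "sigma_compact (UNIV :: 'a set)"
    and radon: "radon_measure M"
    and C0_dense: "dense_in_C0 (D \<inter> Cc_space)"
begin

lemma sets_M [measurable_cong]: "sets M = sets borel"
  using radon by (simp add: radon_measure_def)

lemma space_M [simp]: "space M = UNIV"
  using sets_eq_imp_space_eq[OF sets_M] by simp

lemma emeasure_compact: "compact K \<Longrightarrow> emeasure M K < \<infinity>"
  using radon by (simp add: radon_measure_def)

lemma sets_compact: "compact K \<Longrightarrow> K \<in> sets M"
  by (simp add: sets_M compact_imp_closed)

lemma sets_open: "open U \<Longrightarrow> U \<in> sets M"
  by (simp add: sets_M)

lemma continuous_meas: "continuous_on UNIV f \<Longrightarrow> f \<in> borel_measurable M"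
  using borel_measurable_continuous_onI[of f] measurable_cong_sets[OF sets_M refl] by simp

lemma null_sets_by_compacts:
  assumes "B \<in> sets M" "\<And>K. compact K \<Longrightarrow> K \<subseteq> B \<Longrightarrow> emeasure M K = 0"
  shows "B \<in> null_sets M"
proof -
  have "emeasure M B = (SUP K\<in>{K. compact K \<and> K \<subseteq> B}. emeasure M K)"
    using radon assms(1) by (simp add: radon_measure_def)
  also have "\<dots> \<le> 0" using assms(2) by (intro SUP_least) auto
  finally show ?thesis using assms(1) by (simp add: null_sets_def)
qed

lemma closed_ess_support: "closed (ess_support M f)"
proof -
  have "open (- ess_support M f)"
  proof (subst open_subopen, rule ballI)
    fix x assume "x \<in> - ess_support M f"
    then obtain U where "open U" "x \<in> U" "AE y in M. y \<in> U \<longrightarrow> f y = 0"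
      unfolding ess_support_def by auto
    then show "\<exists>T. open T \<and> x \<in> T \<and> T \<subseteq> - ess_support M f"
      unfolding ess_support_def by (intro exI[of _ U]) auto
  qed
  then show ?thesis by (simp add: closed_def)
qed

lemma ess_support_subset:
  assumes "closed S" "AE x in M. x \<notin> S \<longrightarrow> f x = 0"
  shows "ess_support M f \<subseteq> S"
proof
  fix x assume x: "x \<in> ess_support M f"
  show "x \<in> S"
  proof (rule ccontr)
    assume "x \<notin> S"
    then have "\<not> (AE y in M. y \<in> - S \<longrightarrow> f y = 0)"
      using x assms(1) unfolding ess_support_def by (auto simp: open_Compl)
    then show False using assms(2) by simp
  qed
qed

text \<open>Each point off the support has a null neighbourhood for \<open>f\<close>, but there may
  be uncountably many of these. A compact subset of the exceptional set is covered by finitely many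
  of them, and inner regularity passes from compact sets to the whole set.\<close>

lemma AE_ess_support:
  assumes f: "f \<in> borel_measurable M"
  shows "AE x in M. x \<notin> ess_support M f \<longrightarrow> f x = 0"
proof -
  define B where "B = {x. x \<notin> ess_support M f \<and> f x \<noteq> 0}"
  have "{x\<in>space M. f x \<noteq> 0} \<in> sets M" using f by measurable
  then have "- ess_support M f \<inter> {x\<in>space M. f x \<noteq> 0} \<in> sets M"
    by (rule sets.Int[OF sets_open[OF open_Compl[OF closed_ess_support]]])
  moreover have "- ess_support M f \<inter> {x\<in>space M. f x \<noteq> 0} = B" by (auto simp: B_def)
  ultimately have B: "B \<in> sets M" by simp
  have "B \<in> null_sets M"
  proof (rule null_sets_by_compacts[OF B])
    fix K assume K: "compact K" "K \<subseteq> B"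
    have "\<forall>x\<in>K. \<exists>U. open U \<and> x \<in> U \<and> (AE y in M. y \<in> U \<longrightarrow> f y = 0)"
      using K by (auto simp: B_def ess_support_def)
    then obtain U where U: "\<And>x. x \<in> K \<Longrightarrow> open (U x) \<and> x \<in> U x \<and> (AE y in M. y \<in> U x \<longrightarrow> f y = 0)"
      by metis
    obtain C where C: "C \<subseteq> K" "finite C" "K \<subseteq> (\<Union>c\<in>C. U c)"
      using compactE_image[OF K(1), of K U] U by blast
    have "AE y in M. \<forall>c\<in>C. y \<in> U c \<longrightarrow> f y = 0"
      using U C by (intro AE_finite_allI) auto
    then have "AE y in M. y \<notin> K"
      by eventually_elim (use C K in \<open>auto simp: B_def\<close>)
    then show "emeasure M K = 0"
      using AE_iff_measurable[OF sets_compact[OF K(1)], of "\<lambda>y. y \<notin> K"] by simp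
  qed
  then have "AE x in M. x \<notin> B" by (rule AE_not_in)
  then show ?thesis by eventually_elim (auto simp: B_def)
qed

text \<open>Any compact subset of \<open>\<Omega>\<close> carrying \<open>u\<close> may replace the
  essential support, which spares computing supports of sums, minima and cutoffs.\<close>

lemma compact_support_domain_iff:
  "u \<in> compact_support_domain M D \<Omega> \<longleftrightarrow>
     u \<in> D \<and> (\<exists>K. compact K \<and> K \<subseteq> \<Omega> \<and> (AE x in M. x \<notin> K \<longrightarrow> u x = 0))"
proof
  assume "u \<in> compact_support_domain M D \<Omega>"
  then show "u \<in> D \<and> (\<exists>K. compact K \<and> K \<subseteq> \<Omega> \<and> (AE x in M. x \<notin> K \<longrightarrow> u x = 0))"
    unfolding compact_support_domain_def using AE_ess_support[OF D_meas] by blast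
next
  assume "u \<in> D \<and> (\<exists>K. compact K \<and> K \<subseteq> \<Omega> \<and> (AE x in M. x \<notin> K \<longrightarrow> u x = 0))"
  then obtain K where K: "u \<in> D" "compact K" "K \<subseteq> \<Omega>" "AE x in M. x \<notin> K \<longrightarrow> u x = 0" by blast
  have sub: "ess_support M u \<subseteq> K" using K by (intro ess_support_subset compact_imp_closed)
  then have "compact (ess_support M u)"
    using compact_Int_closed[OF K(2) closed_ess_support, of u] by (simp add: Int_absorb1)
  then show "u \<in> compact_support_domain M D \<Omega>"
    using K sub by (auto simp: compact_support_domain_def)
qed

lemma compact_nbhd:
  fixes K U :: "'a set"
  assumes "compact K" "open U" "K \<subseteq> U"
  obtains W L where "open W" "compact L" "K \<subseteq> W" "W \<subseteq> L" "L \<subseteq> U"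
proof -
  have "\<forall>x\<in>K. \<exists>V L. open V \<and> compact L \<and> x \<in> V \<and> V \<subseteq> L \<and> L \<subseteq> U"
  proof
    fix x assume "x \<in> K"
    then show "\<exists>V L. open V \<and> compact L \<and> x \<in> V \<and> V \<subseteq> L \<and> L \<subseteq> U"
      using locally_compact assms unfolding locally_def by (auto simp: subset_eq) 
  qed
  then obtain V L where VL: "\<And>x. x \<in> K \<Longrightarrow> open (V x) \<and> compact (L x) \<and> x \<in> V x \<and> V x \<subseteq> L x \<and> L x \<subseteq> U"
    by metis
  obtain C where C: "C \<subseteq> K" "finite C" "K \<subseteq> (\<Union>c\<in>C. V c)"
    using compactE_image[OF assms(1), of K V] VL by blast
  show thesis
  proof (rule that)
    show "open (\<Union>c\<in>C. V c)" using VL C by auto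
    show "compact (\<Union>c\<in>C. L c)" using VL C by (intro compact_UN) auto
    show "(\<Union>c\<in>C. V c) \<subseteq> (\<Union>c\<in>C. L c)" "(\<Union>c\<in>C. L c) \<subseteq> U" using VL C by blast+
  qed (rule C)
qed

text \<open>Density in \<open>C0_space\<close> yields elements of \<open>D\<close> only up to a
  uniform error. An Urysohn function of height 2 is approximated within 1/2 by \<open>h\<close>, so
  \<open>h \<ge> 3/2\<close> on \<open>K\<close> and \<open>h \<le> 1/2\<close> off
  \<open>W\<close>; the part of \<open>h\<close> between these two levels has the exact values 1 and
  0.\<close>

lemma cutoff_exists:
  assumes "compact K" "open U" "K \<subseteq> U"
  obtains \<eta> L where "\<eta> \<in> D" "continuous_on UNIV \<eta>" "\<And>x. 0 \<le> \<eta> x" "\<And>x. \<eta> x \<le> 1"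
    "\<And>x. x \<in> K \<Longrightarrow> \<eta> x = 1" "compact L" "L \<subseteq> U" "\<And>x. x \<notin> L \<Longrightarrow> \<eta> x = 0"
proof -
  obtain W L where W: "open W" "compact L" "K \<subseteq> W" "W \<subseteq> L" "L \<subseteq> U"
    using compact_nbhd[OF assms] by blast
  obtain f :: "'a \<Rightarrow> real" where f: "continuous_on UNIV f" "\<And>x. x \<in> K \<Longrightarrow> f x = 2" "\<And>x. x \<notin> W \<Longrightarrow> f x = 0"
  \<comment> \<open>The distance to an empty set is 0 by convention, and a minimum over
    \<open>K\<close> needs \<open>K\<close> nonempty, so both degenerate cases are settled by
    constants.\<close>
  proof (cases "K = {} \<or> - W = {}")
    case True
    then show thesis
    proof
      assume "K = {}" then show thesis using that[of "\<lambda>_. 0"] by auto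
    next
      assume "- W = {}" then show thesis using that[of "\<lambda>_. 2"] by auto
    qed
  next
    case False
    define g where "g x = infdist x (- W)" for x
    have gcont: "continuous_on S g" for S unfolding g_def by (intro continuous_on_infdist continuous_on_id)
    obtain x0 where x0: "x0 \<in> K" "\<And>x. x \<in> K \<Longrightarrow> g x0 \<le> g x"
      using continuous_attains_inf[OF assms(1) _ gcont] False by blast
    have "g x0 \<noteq> 0"
      using in_closed_iff_infdist_zero[of "- W" x0] x0 W False by (auto simp: g_def closed_Compl)
    then have m: "g x0 > 0" using infdist_nonneg[of x0 "- W"] by (simp add: g_def)
    show thesis
    proof (rule that)
      show "continuous_on UNIV (\<lambda>x. 2 * min 1 (g x / g x0))"
        using m by (intro continuous_intros gcont) auto
      show "2 * min 1 (g x / g x0) = 2" if "x \<in> K" for x using x0(2)[OF that] m by simp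
      show "2 * min 1 (g x / g x0) = 0" if "x \<notin> W" for x using that by (simp add: g_def)
    qed
  qed
  have "f \<in> C0_space"
    unfolding C0_space_def
  proof (intro CollectI conjI allI impI f(1) exI[of _ L] W(2))
    show "\<bar>f x\<bar> < e" if "0 < e" "x \<notin> L" for e x
    proof -
      have "f x = 0" using f(3) that(2) W(4) by blast
      then show ?thesis using that(1) by simp
    qed
  qed
  then obtain h where h: "h \<in> D" "h \<in> Cc_space" "\<And>x. \<bar>f x - h x\<bar> \<le> 1/2"
    using C0_dense unfolding dense_in_C0_def by (metis IntE half_gt_zero_iff zero_less_one)
  \<comment> \<open>Constants need not lie in \<open>D\<close>, so \<open>clip 1 (h x - 1/2)\<close>
    is written as a difference of two truncations of \<open>h\<close>.\<close>
  define \<eta> where "\<eta> x = clip (3/2) (h x) - clip (1/2) (h x)" for x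
  have \<eta>: "\<eta> x = clip 1 (h x - 1/2)" for x by (auto simp: \<eta>_def clip_def)
  show thesis
  proof (rule that)
    show "\<eta> \<in> D" unfolding \<eta>_def[abs_def] using h by (intro diff_mem clip_mem) auto
    show "continuous_on UNIV \<eta>"
      using h(2) unfolding \<eta>[abs_def] clip_def Cc_space_def by (auto intro!: continuous_intros)
    show "0 \<le> \<eta> x" "\<eta> x \<le> 1" for x by (auto simp: \<eta> clip_def)
    show "\<eta> x = 1" if "x \<in> K" for x
    proof -
      have "h x \<ge> 3/2" using h(3)[of x] f(2)[OF that] by arith
      then show ?thesis by (simp add: \<eta> clip_def)
    qed
    show "\<eta> x = 0" if "x \<notin> L" for x
    proof -
      have "f x = 0" using f(3) that W by blast
      then have "h x \<le> 1/2" using h(3)[of x] by arith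
      then show ?thesis by (simp add: \<eta> clip_def)
    qed
  qed (use W in auto)
qed

section \<open>The form with Dirichlet boundary conditions\<close>

abbreviation "Dc \<equiv> compact_support_domain M D"
abbreviation "DD \<equiv> dirichlet_domain M D E"

lemma Dc_D: "u \<in> Dc \<Omega> \<Longrightarrow> u \<in> D"
  by (simp add: compact_support_domain_def)

lemma DD_D: "u \<in> DD \<Omega> \<Longrightarrow> u \<in> D"
  by (simp add: dirichlet_domain_def)

lemma Dc_add: "u \<in> Dc \<Omega> \<Longrightarrow> v \<in> Dc \<Omega> \<Longrightarrow> (\<lambda>x. u x + v x) \<in> Dc \<Omega>"
proof -
  assume uv: "u \<in> Dc \<Omega>" "v \<in> Dc \<Omega>"
  then obtain K L where K: "compact K" "K \<subseteq> \<Omega>" "AE x in M. x \<notin> K \<longrightarrow> u x = 0"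
    and L: "compact L" "L \<subseteq> \<Omega>" "AE x in M. x \<notin> L \<longrightarrow> v x = 0"
    unfolding compact_support_domain_iff by blast
  have "AE x in M. x \<notin> K \<union> L \<longrightarrow> u x + v x = 0" using K(3) L(3) by eventually_elim auto
  then show ?thesis
    unfolding compact_support_domain_iff using K L uv Dc_D add_mem compact_Un[of K L] by (metis Un_least)
qed

lemma Dc_scale:
  assumes "u \<in> Dc \<Omega>"
  shows "(\<lambda>x. c * u x) \<in> Dc \<Omega>"
proof -
  obtain K where K: "compact K" "K \<subseteq> \<Omega>" "AE x in M. x \<notin> K \<longrightarrow> u x = 0"
    using assms unfolding compact_support_domain_iff by blast
  have "AE x in M. x \<notin> K \<longrightarrow> c * u x = 0" using K(3) by eventually_elim auto
  then show ?thesis unfolding compact_support_domain_iff using K assms Dc_D scale_mem by blast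
qed

lemma Dc_DD: "u \<in> Dc \<Omega> \<Longrightarrow> u \<in> DD \<Omega>"
  unfolding dirichlet_domain_def graph_norm_def L2_norm_def
  using Dc_D E_scale_left[of _ _ 0] scale_mem[of _ 0] by (force intro: bexI[of _ u])

lemma DD_approx: "u \<in> DD \<Omega> \<Longrightarrow> e > 0 \<Longrightarrow> \<exists>v\<in>Dc \<Omega>. graph_norm M E (\<lambda>x. u x - v x) < e"
  by (simp add: dirichlet_domain_def)

lemma DD_closure:
  assumes u: "u \<in> D" and "\<And>e. e > 0 \<Longrightarrow> \<exists>v\<in>DD \<Omega>. graph_norm M E (\<lambda>x. u x - v x) < e"
  shows "u \<in> DD \<Omega>"
proof -
  have "\<exists>w\<in>Dc \<Omega>. graph_norm M E (\<lambda>x. u x - w x) < e" if e: "e > 0" for e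
  proof -
    obtain v where v: "v \<in> DD \<Omega>" "graph_norm M E (\<lambda>x. u x - v x) < e / 2" using assms(2)[of "e/2"] e by auto
    obtain w where w: "w \<in> Dc \<Omega>" "graph_norm M E (\<lambda>x. v x - w x) < e / 2" using DD_approx[OF v(1), of "e/2"] e by auto
    have "graph_norm M E (\<lambda>x. u x - w x) \<le> graph_norm M E (\<lambda>x. u x - v x) + graph_norm M E (\<lambda>x. v x - w x)"
      using u v w DD_D Dc_D by (intro graph_norm_triangle_diff) auto
    then show ?thesis using v w by (intro bexI[of _ w]) auto
  qed
  then show ?thesis using u by (simp add: dirichlet_domain_def)
qed

lemma DD_add:
  assumes "u \<in> DD \<Omega>" "v \<in> DD \<Omega>"
  shows "(\<lambda>x. u x + v x) \<in> DD \<Omega>"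
proof (rule DD_closure)
  show "(\<lambda>x. u x + v x) \<in> D" using assms DD_D by (intro add_mem) auto
  fix e :: real assume e: "e > 0"
  obtain a where a: "a \<in> Dc \<Omega>" "graph_norm M E (\<lambda>x. u x - a x) < e / 2" using DD_approx[OF assms(1), of "e/2"] e by auto
  obtain b where b: "b \<in> Dc \<Omega>" "graph_norm M E (\<lambda>x. v x - b x) < e / 2" using DD_approx[OF assms(2), of "e/2"] e by auto
  have "graph_norm M E (\<lambda>x. (u x - a x) + (v x - b x))
      \<le> graph_norm M E (\<lambda>x. u x - a x) + graph_norm M E (\<lambda>x. v x - b x)"
    using assms a b DD_D Dc_D by (intro graph_norm_triangle diff_mem) auto
  moreover have "(\<lambda>x. (u x - a x) + (v x - b x)) = (\<lambda>x. u x + v x - (a x + b x))" by auto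
  ultimately show "\<exists>w\<in>DD \<Omega>. graph_norm M E (\<lambda>x. u x + v x - w x) < e"
    using a b Dc_DD[OF Dc_add[OF a(1) b(1)]] by (intro bexI[of _ "\<lambda>x. a x + b x"]) auto
qed

lemma DD_scale:
  assumes "u \<in> DD \<Omega>"
  shows "(\<lambda>x. c * u x) \<in> DD \<Omega>"
proof (rule DD_closure)
  show "(\<lambda>x. c * u x) \<in> D" using assms DD_D by (intro scale_mem) auto
  fix e :: real assume e: "e > 0"
  then have "e / (\<bar>c\<bar> + 1) > 0" by (simp add: add_nonneg_pos)
  then obtain a where a: "a \<in> Dc \<Omega>" "graph_norm M E (\<lambda>x. u x - a x) < e / (\<bar>c\<bar> + 1)"
    using DD_approx[OF assms] by blast
  have d: "(\<lambda>x. u x - a x) \<in> D" using a assms DD_D Dc_D by (intro diff_mem) auto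
  have "(\<lambda>x. c * u x - c * a x) = (\<lambda>x. c * (u x - a x))" by (auto simp: algebra_simps)
  then have "graph_norm M E (\<lambda>x. c * u x - c * a x) = \<bar>c\<bar> * graph_norm M E (\<lambda>x. u x - a x)"
    using graph_norm_scale[OF d] by simp
  also have "\<dots> \<le> (\<bar>c\<bar> + 1) * graph_norm M E (\<lambda>x. u x - a x)"
    using graph_norm_nonneg[OF d] by (intro mult_right_mono) auto
  also have "\<dots> < e" using a(2) by (simp add: pos_less_divide_eq add_nonneg_pos mult.commute)
  finally show "\<exists>w\<in>DD \<Omega>. graph_norm M E (\<lambda>x. c * u x - w x) < e"
    using Dc_DD[OF Dc_scale[OF a(1)]] by (intro bexI[of _ "\<lambda>x. c * a x"]) auto
qed

lemma DD_diff: "u \<in> DD \<Omega> \<Longrightarrow> v \<in> DD \<Omega> \<Longrightarrow> (\<lambda>x. u x - v x) \<in> DD \<Omega>"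
  using DD_add[OF _ DD_scale[of v \<Omega> "-1"], of u] by simp

lemma DD_midpoint: "u \<in> DD \<Omega> \<Longrightarrow> v \<in> DD \<Omega> \<Longrightarrow> (\<lambda>x. (u x + v x) / 2) \<in> DD \<Omega>"
  using DD_scale[OF DD_add, of u \<Omega> v "1/2"] by simp

lemma zero_DD: "(\<lambda>x. 0) \<in> DD \<Omega>"
  by (rule Dc_DD) (auto simp: compact_support_domain_iff zero_mem intro!: exI[of _ "{}"])

lemma graph_norm_self: "u \<in> D \<Longrightarrow> v \<in> D \<Longrightarrow> AE x in M. u x = v x \<Longrightarrow> graph_norm M E (\<lambda>x. u x - v x) = 0"
  using graph_norm_cong[of "\<lambda>x. u x - v x" "\<lambda>x. 0"] diff_mem[of u v] zero_mem E_scale_left[of "\<lambda>x. 0" "\<lambda>x. 0" 0]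
  by (simp add: graph_norm_def L2_norm_def)

lemma DD_cong:
  assumes "u \<in> DD \<Omega>" "v \<in> borel_measurable M" "AE x in M. u x = v x"
  shows "v \<in> DD \<Omega>"
proof (rule DD_closure)
  show v: "v \<in> D" using assms DD_D D_cong by blast
  have "AE x in M. v x = u x" using assms(3) by eventually_elim simp
  then have "graph_norm M E (\<lambda>x. v x - u x) = 0" using v assms DD_D by (intro graph_norm_self) auto
  then show "\<exists>w\<in>DD \<Omega>. graph_norm M E (\<lambda>x. v x - w x) < e" if "e > 0" for e using that assms(1) by (intro bexI[of _ u]) simp_all
qed

lemma DD_psform: "positive_symmetric_form M (DD \<Omega>) E"
  by (rule subset_psform) (use DD_D zero_DD DD_cong DD_add DD_scale in auto)

lemma DD_closed_form: "closed_form M (DD \<Omega>) E"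
  unfolding closed_form_def
proof (intro allI impI)
  fix u :: "nat \<Rightarrow> 'a \<Rightarrow> real"
  assume *: "(\<forall>n. u n \<in> DD \<Omega>) \<and> (\<forall>e>0. \<exists>N. \<forall>m\<ge>N. \<forall>n\<ge>N. graph_norm M E (\<lambda>x. u m x - u n x) < e)"
  then have uD: "\<And>n. u n \<in> D" using DD_D by blast
  obtain v where v: "v \<in> D" "(\<lambda>n. graph_norm M E (\<lambda>x. u n x - v x)) \<longlonglongrightarrow> 0"
    using complete[of u, OF uD] * by blast
  have "v \<in> DD \<Omega>"
  proof (rule DD_closure[OF v(1)])
    fix e :: real assume "e > 0"
    then obtain n where "graph_norm M E (\<lambda>x. u n x - v x) < e"
      using eventually_happens[OF order_tendstoD(2)[OF v(2)]] by force
    then show "\<exists>w\<in>DD \<Omega>. graph_norm M E (\<lambda>x. v x - w x) < e"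
      using * graph_norm_commute[OF uD v(1), of n] by (intro bexI[of _ "u n"]) auto
  qed
  then show "\<exists>v\<in>DD \<Omega>. (\<lambda>n. graph_norm M E (\<lambda>x. u n x - v x)) \<longlonglongrightarrow> 0" using v(2) by blast
qed

lemma DD_bounded_energy_limit:
  assumes "f \<in> L2_space M UNIV"
    and "\<And>e. e > 0 \<Longrightarrow> \<exists>w\<in>DD \<Omega>. L2_norm M (\<lambda>x. w x - f x) < e \<and> E w w \<le> b"
  shows "f \<in> DD \<Omega>"
proof (rule DD_closure)
  have sub: "DD \<Omega> \<subseteq> D" using DD_D by blast
  show "f \<in> D" by (rule bounded_energy_limit(1)[OF sub assms(1) DD_midpoint assms(2)])
  show "\<exists>v\<in>DD \<Omega>. graph_norm M E (\<lambda>x. f x - v x) < e" if "e > 0" for e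
    by (rule bounded_energy_limit(2)[OF sub assms(1) DD_midpoint assms(2) that])
qed

text \<open>The Dirichlet domain is an order ideal in \<open>D\<close>. Cutting \<open>v\<close> by
  the positive part of a compactly supported \<open>w\<close> near \<open>u\<close> gives compactly
  supported functions \<open>z\<close>; they approach \<open>v\<close> in \<open>L\<^sub>2\<close>
  with bounded energy, which suffices.\<close>

lemma DD_ideal:
  assumes v: "v \<in> D" and u: "u \<in> DD \<Omega>" and le: "AE x in M. 0 \<le> v x \<and> v x \<le> max 0 (u x)"
  shows "v \<in> DD \<Omega>"
proof (rule DD_bounded_energy_limit[OF D_L2[OF v]])
  fix e :: real assume e: "e > 0"
  obtain w where w: "w \<in> Dc \<Omega>" "graph_norm M E (\<lambda>x. u x - w x) < min e 1"
    using DD_approx[OF u, of "min e 1"] e by auto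
  have wD: "w \<in> D" and uD: "u \<in> D" using w u Dc_D DD_D by auto
  have d: "(\<lambda>x. u x - w x) \<in> D" using uD wD by (rule diff_mem)
  define z where "z x = min (v x) (max 0 (w x))" for x
  have wp: "(\<lambda>x. max 0 (w x)) \<in> D" using wD by (rule pos_part_mem)
  have zD: "z \<in> D" unfolding z_def[abs_def] using v wp by (rule min_mem)
  obtain K where K: "compact K" "K \<subseteq> \<Omega>" "AE x in M. x \<notin> K \<longrightarrow> w x = 0"
    using w(1) unfolding compact_support_domain_iff by blast
  have "AE x in M. x \<notin> K \<longrightarrow> z x = 0" using K(3) le by eventually_elim (auto simp: z_def)
  then have z: "z \<in> DD \<Omega>" using zD K by (intro Dc_DD) (auto simp: compact_support_domain_iff)
  \<comment> \<open>Since \<open>v\<close> equals its minimum with the positive part of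
    \<open>u\<close>, this is the Lipschitz property of the minimum and of the positive
    part.\<close>
  have "AE x in M. \<bar>z x - v x\<bar> \<le> \<bar>u x - w x\<bar>"
    using le by eventually_elim (auto simp: z_def)
  then have "L2_norm M (\<lambda>x. z x - v x) \<le> L2_norm M (\<lambda>x. u x - w x)"
    using D_L2[OF d] D_meas[OF zD] D_meas[OF v] by (intro L2_norm_mono) auto
  also have "\<dots> < e" using L2_norm_le_graph_norm[OF d] w(2) by simp
  finally have n: "L2_norm M (\<lambda>x. z x - v x) < e" .
  have "E (\<lambda>x. u x - w x) (\<lambda>x. u x - w x) \<le> (graph_norm M E (\<lambda>x. u x - w x))\<^sup>2"
    using d by (rule E_le_graph_norm)
  also have "\<dots> \<le> 1" using w(2) graph_norm_nonneg[OF d] by (intro power_le_one) auto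
  finally have e1: "E (\<lambda>x. u x - w x) (\<lambda>x. u x - w x) \<le> 1" .
  have "E w w \<le> 2 * E u u + 2 * E (\<lambda>x. u x - w x) (\<lambda>x. u x - w x)"
    using E_diff_le[OF uD d] by simp
  then have "E z z \<le> 6 * E v v + 4 * (2 * E u u + 2)"
    using min_mem(2)[OF v wp] E_pos_part_le[OF wD] e1 unfolding z_def[abs_def] by argo
  then show "\<exists>z\<in>DD \<Omega>. L2_norm M (\<lambda>x. z x - v x) < e \<and> E z z \<le> 6 * E v v + 4 * (2 * E u u + 2)"
    using z n by blast
qed

lemma DD_L2:
  assumes Om: "open \<Omega>" and u: "u \<in> DD \<Omega>"
  shows "u \<in> L2_space M \<Omega>"
proof (rule L2_space_closed[OF sets_open[OF Om] D_L2[OF DD_D[OF u]]])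
  fix e :: real assume "e > 0"
  then obtain v where v: "v \<in> Dc \<Omega>" "graph_norm M E (\<lambda>x. u x - v x) < e" using DD_approx[OF u] by blast
  obtain K where K: "K \<subseteq> \<Omega>" "AE x in M. x \<notin> K \<longrightarrow> v x = 0"
    using v(1) unfolding compact_support_domain_iff by blast
  have "AE x in M. x \<notin> \<Omega> \<longrightarrow> v x = 0" using K(2) by eventually_elim (use K(1) in auto)
  then have "v \<in> L2_space M \<Omega>" using D_L2[OF Dc_D[OF v(1)]] L2_space_restrict by blast
  moreover have "L2_norm M (\<lambda>x. u x - v x) < e"
    using L2_norm_le_graph_norm[OF diff_mem[OF DD_D[OF u] Dc_D[OF v(1)]]] v(2) by simp
  ultimately show "\<exists>v\<in>L2_space M \<Omega>. L2_norm M (\<lambda>x. u x - v x) < e" by blast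
qed

section \<open>Density of the Dirichlet domain in the square-integrable functions on
  \<Omega>\<close>

lemma integral_compact_eq_0:
  assumes Om: "open \<Omega>" and g: "g \<in> L2_space M UNIV"
    and orth: "\<And>v. v \<in> Dc \<Omega> \<Longrightarrow> (\<integral>x. g x * v x \<partial>M) = 0"
    and K: "compact K" "K \<subseteq> \<Omega>"
  shows "integrable M (\<lambda>x. g x * indicat_real K x)" "(\<integral>x. g x * indicat_real K x \<partial>M) = 0"
proof -
  have gm: "g \<in> borel_measurable M" using g by (rule L2_spaceD)
  obtain W L where W: "open W" "compact L" "K \<subseteq> W" "W \<subseteq> L" "L \<subseteq> \<Omega>"
    using compact_nbhd[OF K(1) Om K(2)] by blast
  \<comment> \<open>Open sets shrinking to \<open>K\<close> inside a fixed compact set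
    \<open>L\<close>. The empty \<open>K\<close> is treated apart because the distance to it is 0
    everywhere.\<close>
  define U where "U n = (if K = {} then {} else W \<inter> {x. infdist x K < 1 / real (Suc n)})" for n
  have opn: "open {x. infdist x K < c}" for c
    by (intro open_Collect_less continuous_on_infdist continuous_on_id continuous_on_const)
  have U: "open (U n)" "K \<subseteq> U n" "U n \<subseteq> \<Omega>" for n
    using W opn by (auto simp: U_def)
  have "\<exists>\<eta>. \<eta> \<in> Dc \<Omega> \<and> continuous_on UNIV \<eta> \<and> (\<forall>x. 0 \<le> \<eta> x \<and> \<eta> x \<le> 1) \<and> (\<forall>x\<in>K. \<eta> x = 1)
      \<and> (\<forall>x. x \<notin> U n \<longrightarrow> \<eta> x = 0)" for n
  proof -
    obtain \<eta> L' where "\<eta> \<in> D" "continuous_on UNIV \<eta>" "\<And>x. 0 \<le> \<eta> x" "\<And>x. \<eta> x \<le> 1"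
      "\<And>x. x \<in> K \<Longrightarrow> \<eta> x = 1" and L': "compact L'" "L' \<subseteq> U n" "\<And>x. x \<notin> L' \<Longrightarrow> \<eta> x = 0"
      using cutoff_exists[OF K(1) U(1,2)[of n]] by metis
    moreover have "\<eta> x = 0" if "x \<notin> U n" for x using L' that by blast
    moreover have "\<eta> \<in> Dc \<Omega>"
      unfolding compact_support_domain_iff using \<open>\<eta> \<in> D\<close> L' U(3)[of n] by auto
    ultimately show ?thesis by (intro exI[of _ \<eta>]) auto
  qed
  then obtain \<eta> where \<eta>: "\<And>n. \<eta> n \<in> Dc \<Omega>" "\<And>n. continuous_on UNIV (\<eta> n)" "\<And>n x. 0 \<le> \<eta> n x \<and> \<eta> n x \<le> 1"
    "\<And>n x. x \<in> K \<Longrightarrow> \<eta> n x = 1" "\<And>n x. x \<notin> U n \<Longrightarrow> \<eta> n x = 0"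
    by metis
  have ptw: "(\<lambda>n. \<eta> n x) \<longlonglongrightarrow> indicat_real K x" for x
  proof (cases "x \<in> K")
    case True
    then show ?thesis using \<eta>(4) by simp
  next
    case False
    have "\<forall>\<^sub>F n in sequentially. \<eta> n x = 0"
    proof (cases "K = {}")
      case True
      then show ?thesis using \<eta>(5) by (simp add: U_def)
    next
      case ne: False
      then have "infdist x K > 0"
        using False in_closed_iff_infdist_zero[OF compact_imp_closed[OF K(1)] ne, of x] infdist_nonneg[of x K] by auto
      then have "\<forall>\<^sub>F n in sequentially. 1 / real (Suc n) < infdist x K"
        using order_tendstoD(2)[OF LIMSEQ_Suc[OF lim_1_over_n]] by auto
      then show ?thesis by eventually_elim (auto intro!: \<eta>(5) simp: U_def ne)
    qed
    then show ?thesis using False by (simp add: tendsto_eventually)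
  qed
  have fin: "integrable M (indicat_real L)"
    using W emeasure_compact sets_compact by (simp add: integrable_indicator_iff)
  \<comment> \<open>Square integrability gives no global integrability of \<open>g\<close>; on
    \<open>L\<close>, which has finite measure,
    \<open>\<bar>g x\<bar> \<le> (g x)\<^sup>2 + 1\<close> provides an integrable majorant.\<close>
  have dom: "AE x in M. norm (g x * \<eta> n x) \<le> (g x)\<^sup>2 + indicat_real L x" for n
  proof (rule AE_I2)
    fix x
    show "norm (g x * \<eta> n x) \<le> (g x)\<^sup>2 + indicat_real L x"
    proof (cases "x \<in> U n")
      case True
      then have "x \<in> L" using W by (auto simp: U_def split: if_splits)
      have "\<bar>g x\<bar> * \<bar>\<eta> n x\<bar> \<le> \<bar>g x\<bar> * 1" using \<eta>(3)[of n x] by (intro mult_left_mono) auto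
      also have "\<dots> \<le> (g x)\<^sup>2 + 1"
        using zero_le_power2[of "\<bar>g x\<bar> - 1"] unfolding power2_diff power2_abs by simp
      finally show ?thesis using \<open>x \<in> L\<close> by (simp add: abs_mult)
    next
      case False
      then show ?thesis using \<eta>(5) by simp
    qed
  qed
  have m1: "(\<lambda>x. g x * indicat_real K x) \<in> borel_measurable M"
    using gm sets_compact[OF K(1)] by simp
  have m2: "(\<lambda>x. g x * \<eta> n x) \<in> borel_measurable M" for n
    using gm continuous_meas[OF \<eta>(2)] by simp
  have int: "integrable M (\<lambda>x. (g x)\<^sup>2 + indicat_real L x)"
    using g fin by (auto dest: L2_spaceD)
  have lim: "AE x in M. (\<lambda>n. g x * \<eta> n x) \<longlonglongrightarrow> g x * indicat_real K x"
    using ptw by (intro AE_I2 tendsto_intros)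
  show "integrable M (\<lambda>x. g x * indicat_real K x)"
    by (rule integrable_dominated_convergence[OF m1 m2 int lim dom])
  have "(\<lambda>n. \<integral>x. g x * \<eta> n x \<partial>M) \<longlonglongrightarrow> (\<integral>x. g x * indicat_real K x \<partial>M)"
    by (rule integral_dominated_convergence[OF m1 m2 int lim dom])
  then show "(\<integral>x. g x * indicat_real K x \<partial>M) = 0"
    using orth[OF \<eta>(1)] LIMSEQ_unique[OF _ tendsto_const] by simp
qed

text \<open>On a compact \<open>K\<close> inside the part of \<open>\<Omega>\<close> where
  \<open>g > 0\<close>, the integral of \<open>g\<close> vanishes although the integrand is
  positive, so \<open>K\<close> is null; inner regularity does the rest. Applied to \<open>g\<close>
  and to \<open>- g\<close>, it shows that \<open>g\<close> vanishes on
  \<open>\<Omega>\<close>.\<close>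

lemma AE_nonpos_of_orthogonal:
  assumes Om: "open \<Omega>" and g: "g \<in> L2_space M UNIV"
    and orth: "\<And>v. v \<in> Dc \<Omega> \<Longrightarrow> (\<integral>x. g x * v x \<partial>M) = 0"
  shows "AE x in M. x \<in> \<Omega> \<longrightarrow> g x \<le> 0"
proof -
  have gm: "g \<in> borel_measurable M" using g by (rule L2_spaceD)
  define B where "B = \<Omega> \<inter> {x\<in>space M. g x > 0}"
  have "{x\<in>space M. g x > 0} \<in> sets M" using gm by measurable
  then have B: "B \<in> sets M" unfolding B_def by (rule sets.Int[OF sets_open[OF Om]])
  have "B \<in> null_sets M"
  proof (rule null_sets_by_compacts[OF B])
    fix K assume K: "compact K" "K \<subseteq> B"
    then have K': "K \<subseteq> \<Omega>" by (auto simp: B_def)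
    have "AE x in M. 0 \<le> g x * indicat_real K x"
      using K by (intro AE_I2) (auto simp: B_def indicator_def)
    then have "AE x in M. g x * indicat_real K x = 0"
      using integral_nonneg_eq_0_iff_AE[of M "\<lambda>x. g x * indicat_real K x"]
        integral_compact_eq_0[OF Om g orth K(1) K'] by blast
    then have "AE x in M. x \<notin> K"
      by eventually_elim (use K in \<open>auto simp: B_def indicator_def\<close>)
    then show "emeasure M K = 0"
      using AE_iff_measurable[OF sets_compact[OF K(1)], of "\<lambda>y. y \<notin> K"] by simp
  qed
  then have "AE x in M. x \<notin> B" by (rule AE_not_in)
  then show ?thesis by eventually_elim (auto simp: B_def)
qed

text \<open>The \<open>L\<^sub>2\<close>-projection onto the closure of the form domain is the case \<open>E = 0\<close> of
  \<open>resolvent_exists\<close>.\<close>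

lemma DD_dense:
  assumes Om: "open \<Omega>" and f: "f \<in> L2_space M \<Omega>" and e: "e > 0"
  shows "\<exists>u\<in>DD \<Omega>. L2_norm M (\<lambda>x. f x - u x) < e"
proof -
  define Cl where "Cl = {u\<in>L2_space M UNIV. \<forall>e>0. \<exists>v\<in>DD \<Omega>. L2_norm M (\<lambda>x. u x - v x) < e}"
  have DDL: "v \<in> L2_space M UNIV" if "v \<in> DD \<Omega>" for v using D_L2 DD_D that by blast
  have ClD: "u \<in> L2_space M UNIV" if "u \<in> Cl" for u using that by (simp add: Cl_def)
  have ClI: "u \<in> Cl" if "u \<in> L2_space M UNIV" "\<And>e. e > 0 \<Longrightarrow> \<exists>v\<in>Cl. L2_norm M (\<lambda>x. u x - v x) < e" for u
  proof -
    have "\<exists>w\<in>DD \<Omega>. L2_norm M (\<lambda>x. u x - w x) < e" if "e > 0" for e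
    proof -
      obtain v where v: "v \<in> Cl" "L2_norm M (\<lambda>x. u x - v x) < e / 2"
        using \<open>\<And>e. e > 0 \<Longrightarrow> \<exists>v\<in>Cl. L2_norm M (\<lambda>x. u x - v x) < e\<close>[of "e/2"] \<open>e > 0\<close> by auto
      obtain w where w: "w \<in> DD \<Omega>" "L2_norm M (\<lambda>x. v x - w x) < e / 2"
        using v(1) half_gt_zero[OF \<open>e > 0\<close>] unfolding Cl_def by blast
      have "L2_norm M (\<lambda>x. u x - w x) \<le> L2_norm M (\<lambda>x. u x - v x) + L2_norm M (\<lambda>x. v x - w x)"
        using \<open>u \<in> L2_space M UNIV\<close> ClD[OF v(1)] DDL[OF w(1)] by (rule L2_norm_triangle_diff)
      then show ?thesis using v w by (intro bexI[of _ w]) auto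
    qed
    then show ?thesis using that(1) by (simp add: Cl_def)
  qed
  have DDCl: "v \<in> Cl" if "v \<in> DD \<Omega>" for v
    using that DDL by (auto simp: Cl_def L2_norm_def intro!: bexI[of _ v])
  have add: "(\<lambda>x. u x + v x) \<in> Cl" if uv: "u \<in> Cl" "v \<in> Cl" for u v
  proof (rule ClI)
    show "(\<lambda>x. u x + v x) \<in> L2_space M UNIV" using uv ClD by (intro L2.add_mem) auto
    fix e :: real assume "e > 0"
    then have "e / 2 > 0" by simp
    then obtain a b where a: "a \<in> DD \<Omega>" "L2_norm M (\<lambda>x. u x - a x) < e / 2"
      and b: "b \<in> DD \<Omega>" "L2_norm M (\<lambda>x. v x - b x) < e / 2"
      using uv unfolding Cl_def by blast
    have "L2_norm M (\<lambda>x. (u x - a x) + (v x - b x)) \<le> L2_norm M (\<lambda>x. u x - a x) + L2_norm M (\<lambda>x. v x - b x)"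
      using uv a b ClD DDL by (intro L2_norm_triangle L2.diff_mem) auto
    moreover have "(\<lambda>x. (u x - a x) + (v x - b x)) = (\<lambda>x. u x + v x - (a x + b x))" by auto
    ultimately show "\<exists>w\<in>Cl. L2_norm M (\<lambda>x. u x + v x - w x) < e"
      using a b DDCl[OF DD_add[OF a(1) b(1)]] by (intro bexI[of _ "\<lambda>x. a x + b x"]) auto
  qed
  have scale: "(\<lambda>x. c * u x) \<in> Cl" if u: "u \<in> Cl" for c u
  proof (rule ClI)
    show "(\<lambda>x. c * u x) \<in> L2_space M UNIV" using u ClD by (intro L2.scale_mem) auto
    fix e :: real assume "e > 0"
    then have "e / (\<bar>c\<bar> + 1) > 0" by (simp add: add_nonneg_pos)
    then obtain a where a: "a \<in> DD \<Omega>" "L2_norm M (\<lambda>x. u x - a x) < e / (\<bar>c\<bar> + 1)"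
      using u unfolding Cl_def by blast
    have "(\<lambda>x. c * u x - c * a x) = (\<lambda>x. c * (u x - a x))" by (auto simp: algebra_simps)
    then have "L2_norm M (\<lambda>x. c * u x - c * a x) = \<bar>c\<bar> * L2_norm M (\<lambda>x. u x - a x)"
      by (simp add: L2_norm_scale)
    also have "\<dots> \<le> (\<bar>c\<bar> + 1) * L2_norm M (\<lambda>x. u x - a x)" by (intro mult_right_mono) auto
    also have "\<dots> < e" using a(2) by (simp add: pos_less_divide_eq add_nonneg_pos mult.commute)
    finally show "\<exists>w\<in>Cl. L2_norm M (\<lambda>x. c * u x - w x) < e"
      using DDCl[OF DD_scale[OF a(1)]] by (intro bexI[of _ "\<lambda>x. c * a x"]) auto
  qed
  have cong: "v \<in> Cl" if "u \<in> Cl" "v \<in> borel_measurable M" "AE x in M. u x = v x" for u v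
  proof (rule ClI)
    show v: "v \<in> L2_space M UNIV" using L2_space_cong[OF ClD[OF that(1)] that(2,3)] .
    have "L2_norm M (\<lambda>x. v x - u x) = L2_norm M (\<lambda>x. 0)"
      using that(3) L2_spaceD(1)[OF v] L2_spaceD(1)[OF ClD[OF that(1)]] by (intro L2_norm_cong) auto
    then show "\<exists>w\<in>Cl. L2_norm M (\<lambda>x. v x - w x) < e" if "e > 0" for e
      using that \<open>u \<in> Cl\<close> by (intro bexI[of _ u]) (auto simp: L2_norm_def)
  qed
  have zero: "(\<lambda>x. 0) \<in> Cl" using DDCl[OF zero_DD] .
  have ps: "positive_symmetric_form M Cl (\<lambda>_ _. 0)"
    unfolding positive_symmetric_form_def using zero add scale cong ClD by auto
  have "closed_form M Cl (\<lambda>_ _. 0)"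
    unfolding closed_form_def
  proof (intro allI impI)
    fix u :: "nat \<Rightarrow> 'a \<Rightarrow> real"
    have gn: "graph_norm M (\<lambda>_ _. 0) w = L2_norm M w" for w by (simp add: graph_norm_def)
    assume *: "(\<forall>n. u n \<in> Cl) \<and>
      (\<forall>e>0. \<exists>N. \<forall>m\<ge>N. \<forall>n\<ge>N. graph_norm M (\<lambda>_ _. 0) (\<lambda>x. u m x - u n x) < e)"
    then obtain v where v: "v \<in> L2_space M UNIV" "(\<lambda>n. L2_norm M (\<lambda>x. u n x - v x)) \<longlonglongrightarrow> 0"
      using L2_complete[of u M] ClD unfolding gn by blast
    have "v \<in> Cl"
    proof (rule ClI[OF v(1)])
      fix e :: real assume "e > 0"
      then obtain n where "L2_norm M (\<lambda>x. u n x - v x) < e"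
        using eventually_happens[OF order_tendstoD(2)[OF v(2)]] by force
      then show "\<exists>w\<in>Cl. L2_norm M (\<lambda>x. v x - w x) < e"
        using * L2_norm_commute[of M "u n" v] by (intro bexI[of _ "u n"]) auto
    qed
    then show "\<exists>v\<in>Cl. (\<lambda>n. graph_norm M (\<lambda>_ _. 0) (\<lambda>x. u n x - v x)) \<longlonglongrightarrow> 0"
      using v unfolding gn by blast
  qed
  then have Z: "closed_psform M Cl (\<lambda>_ _. 0)" using ps by unfold_locales
  have fU: "f \<in> L2_space M UNIV" using f by (rule L2_space_UNIV)
  obtain p where p: "p \<in> Cl" "\<And>v. v \<in> Cl \<Longrightarrow> 0 = (\<integral>x. (1 * (f x - p x)) * v x \<partial>M)"
    using closed_psform.resolvent_exists[OF Z order_refl fU] by blast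
  define g where "g x = f x - p x" for x
  have g: "g \<in> L2_space M UNIV" unfolding g_def using fU ClD[OF p(1)] by (rule L2.diff_mem)
  have orth: "(\<integral>x. g x * v x \<partial>M) = 0" if "v \<in> Dc \<Omega>" for v
    using p(2)[OF DDCl[OF Dc_DD[OF that]]] by (simp add: g_def)
  \<comment> \<open>Orthogonality controls \<open>f - p\<close> on \<open>\<Omega>\<close> only. Off
    \<open>\<Omega>\<close> both vanish: \<open>f\<close> by assumption, \<open>p\<close> as a limit
    of elements of \<open>DD \<Omega>\<close>.\<close>
  have "p \<in> L2_space M \<Omega>"
  proof (rule L2_space_closed[OF sets_open[OF Om] ClD[OF p(1)]])
    fix e :: real assume "e > 0"
    then obtain v where "v \<in> DD \<Omega>" "L2_norm M (\<lambda>x. p x - v x) < e" using p(1) unfolding Cl_def by blast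
    then show "\<exists>v\<in>L2_space M \<Omega>. L2_norm M (\<lambda>x. p x - v x) < e" using DD_L2[OF Om] by blast
  qed
  then have "AE x in M. x \<notin> \<Omega> \<longrightarrow> p x = 0" by (rule L2_spaceD)
  moreover have "AE x in M. x \<notin> \<Omega> \<longrightarrow> f x = 0" using f by (rule L2_spaceD)
  moreover have "AE x in M. x \<in> \<Omega> \<longrightarrow> g x \<le> 0"
    using AE_nonpos_of_orthogonal[OF Om g orth] .
  moreover have "AE x in M. x \<in> \<Omega> \<longrightarrow> - g x \<le> 0"
    by (rule AE_nonpos_of_orthogonal[OF Om L2.uminus_mem[OF g]]) (simp add: orth)
  ultimately have "AE x in M. p x = f x" by eventually_elim (force simp: g_def)
  from cong[OF p(1) L2_spaceD(1)[OF f] this] have "f \<in> Cl" .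
  then show ?thesis using e by (simp add: Cl_def)
qed

end

section \<open>Bounded operators and uniform boundedness\<close>

locale L2_operator =
  fixes M :: "'a measure" and \<Omega> :: "'a set" and T :: "('a \<Rightarrow> real) \<Rightarrow> ('a \<Rightarrow> real)"
  assumes bop: "bounded_operator M (L2_space M \<Omega>) (L2_norm M) T"
begin

lemma V_U: "u \<in> L2_space M \<Omega> \<Longrightarrow> u \<in> L2_space M UNIV"
  by (rule L2_space_UNIV)

lemma T_mem: "u \<in> L2_space M \<Omega> \<Longrightarrow> T u \<in> L2_space M \<Omega>"
  using bop by (simp add: bounded_operator_def)

lemma T_meas: "u \<in> L2_space M \<Omega> \<Longrightarrow> T u \<in> borel_measurable M"
  using T_mem L2_spaceD(1) by blast

lemma T_add: "u \<in> L2_space M \<Omega> \<Longrightarrow> v \<in> L2_space M \<Omega> \<Longrightarrow> AE x in M. T (\<lambda>y. u y + v y) x = T u x + T v x"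
  using bop by (simp add: bounded_operator_def)

lemma T_scale: "u \<in> L2_space M \<Omega> \<Longrightarrow> AE x in M. T (\<lambda>y. c * u y) x = c * T u x"
  using bop by (simp add: bounded_operator_def)

lemma T_bound: "\<exists>C\<ge>0. \<forall>u\<in>L2_space M \<Omega>. L2_norm M (T u) \<le> C * L2_norm M u"
proof -
  obtain C where C: "\<And>u. u \<in> L2_space M \<Omega> \<Longrightarrow> L2_norm M (T u) \<le> C * L2_norm M u"
    using bop unfolding bounded_operator_def by blast
  have "L2_norm M (T u) \<le> max C 0 * L2_norm M u" if "u \<in> L2_space M \<Omega>" for u
    using C[OF that] mult_right_mono[of C "max C 0" "L2_norm M u"] by simp
  then show ?thesis by (intro exI[of _ "max C 0"]) auto
qed

lemma T_diff:
  assumes "u \<in> L2_space M \<Omega>" "v \<in> L2_space M \<Omega>"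
  shows "AE x in M. T (\<lambda>y. u y - v y) x = T u x - T v x"
proof -
  have v: "(\<lambda>y. (-1) * v y) \<in> L2_space M \<Omega>" by (rule L2.scale_mem[OF assms(2)])
  have "AE x in M. T (\<lambda>y. u y + (-1) * v y) x = T u x + T (\<lambda>y. (-1) * v y) x"
    by (rule T_add[OF assms(1) v])
  moreover have "AE x in M. T (\<lambda>y. (-1) * v y) x = (-1) * T v x" by (rule T_scale[OF assms(2)])
  ultimately show ?thesis by eventually_elim simp
qed

lemma T_norm_diff:
  assumes "u \<in> L2_space M \<Omega>" "v \<in> L2_space M \<Omega>"
  shows "L2_norm M (\<lambda>x. T u x - T v x) = L2_norm M (T (\<lambda>x. u x - v x))"
  using T_diff[OF assms] T_meas[OF L2.diff_mem[OF assms]] T_meas[OF assms(1)] T_meas[OF assms(2)]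
  by (intro L2_norm_cong) (auto elim: AE_mp)

end

text \<open>Baire's argument by nested closed balls.\<close>

lemma uniform_boundedness:
  fixes T :: "nat \<Rightarrow> ('a \<Rightarrow> real) \<Rightarrow> ('a \<Rightarrow> real)"
  assumes Om: "\<Omega> \<in> sets M"
    and bop: "\<And>n. bounded_operator M (L2_space M \<Omega>) (L2_norm M) (T n)"
    and ptw: "\<And>u. u \<in> L2_space M \<Omega> \<Longrightarrow> \<exists>B. \<forall>n. L2_norm M (T n u) \<le> B"
  shows "\<exists>C. \<forall>n. \<forall>u\<in>L2_space M \<Omega>. L2_norm M (T n u) \<le> C * L2_norm M u"
proof (rule ccontr)
  assume contra: "\<not> ?thesis"
  let ?V = "L2_space M \<Omega>"
  have op: "L2_operator M \<Omega> (T n)" for n using bop by unfold_locales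
  have U: "u \<in> L2_space M UNIV" if "u \<in> ?V" for u using that by (rule L2_space_UNIV)
  have unbounded: "\<exists>m. \<exists>y\<in>?V. L2_norm M (\<lambda>x. y x - a x) < r \<and> L2_norm M (T m y) > k"
    if a: "a \<in> ?V" and r: "r > 0" for a r k
  proof (rule ccontr)
    assume neg: "\<not> ?thesis"
    have k: "L2_norm M (T m y) \<le> k" if "y \<in> ?V" "L2_norm M (\<lambda>x. y x - a x) < r" for m y
    proof (rule ccontr)
      assume "\<not> L2_norm M (T m y) \<le> k"
      then have "L2_norm M (T m y) > k" by simp
      with neg that show False by blast
    qed
    \<comment> \<open>Rescaling \<open>u\<close> to norm \<open>r / 2\<close> and adding it to
      \<open>a\<close> stays in the ball. The image of the rescaled function is a difference of two
      images of norm at most \<open>k\<close>, and undoing the scaling turns \<open>2 * k\<close>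
      into \<open>4 * k / r\<close>.\<close>
    have "L2_norm M (T m u) \<le> (4 * k / r) * L2_norm M u" if u: "u \<in> ?V" for m u
    proof -
      interpret L2_operator M \<Omega> "T m" by (rule op)
      show ?thesis
      proof (cases "L2_norm M u = 0")
        case True
        then show ?thesis using T_bound u by fastforce
      next
        case False
        then have pos: "L2_norm M u > 0" using L2_norm_nonneg[of M u] by linarith
        define c where "c = r / (2 * L2_norm M u)"
        have c: "c > 0" using pos r by (simp add: c_def)
        have cu: "(\<lambda>x. c * u x) \<in> ?V" using u by (rule L2.scale_mem)
        define y where "y x = a x + c * u x" for x
        have y: "y \<in> ?V" unfolding y_def using a cu by (rule L2.add_mem)
        have "L2_norm M (\<lambda>x. y x - a x) = r / 2"
          using pos c by (simp add: y_def L2_norm_scale) (simp add: c_def)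
        then have ky: "L2_norm M (T m y) \<le> k" using k[OF y] r by simp
        have ka: "L2_norm M (T m a) \<le> k" using k[OF a] r by (simp add: L2_norm_def)
        have "AE x in M. c * T m u x = T m y x - T m a x"
          using T_add[OF a cu] T_scale[OF u, of c] by eventually_elim (simp add: y_def[abs_def])
        then have "L2_norm M (\<lambda>x. c * T m u x) = L2_norm M (\<lambda>x. T m y x - T m a x)"
          using T_meas u y a by (intro L2_norm_cong) auto
        then have "c * L2_norm M (T m u) = L2_norm M (\<lambda>x. T m y x - T m a x)"
          using c by (simp add: L2_norm_scale)
        also have "\<dots> \<le> L2_norm M (T m y) + L2_norm M (\<lambda>x. (-1) * T m a x)"
          using L2_norm_triangle[OF U[OF T_mem[OF y]] U[OF L2.scale_mem[OF T_mem[OF a], of "-1"]]] by simp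
        also have "\<dots> \<le> 2 * k" using ky ka unfolding L2_norm_scale by simp
        finally have "r * L2_norm M (T m u) \<le> 4 * k * L2_norm M u"
          using pos by (simp add: c_def field_simps)
        then show ?thesis using r by (simp add: field_simps)
      qed
    qed
    then show False using contra by blast
  qed
  \<comment> \<open>A state is a centre with a radius. \<open>Q\<close> says that the next closed
    ball lies inside the present one and that each of its points \<open>z\<close> has some
    \<open>T m z\<close> of norm above \<open>n\<close>.\<close>
  define P where "P n s \<longleftrightarrow> fst s \<in> ?V \<and> 0 < snd s \<and> snd s \<le> (1/2)^n" for n :: nat and s :: "('a \<Rightarrow> real) \<times> real"
  define Q where "Q n s s' \<longleftrightarrow> (\<forall>z\<in>?V. L2_norm M (\<lambda>x. z x - fst s' x) \<le> snd s' \<longrightarrow>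
      L2_norm M (\<lambda>x. z x - fst s x) \<le> snd s \<and> (\<exists>m. L2_norm M (T m z) > real n))"
    for n :: nat and s s' :: "('a \<Rightarrow> real) \<times> real"
  have "\<exists>f. \<forall>n. P n (f n) \<and> Q n (f n) (f (Suc n))"
  proof (rule dependent_nat_choice)
    show "\<exists>s. P 0 s" by (rule exI[of _ "(\<lambda>x. 0, 1)"]) (simp add: P_def L2.zero_mem)
  next
    fix s :: "('a \<Rightarrow> real) \<times> real" and n :: nat
    assume s: "P n s"
    obtain a r where ar: "s = (a, r)" by (cases s)
    have a: "a \<in> ?V" and r: "r > 0" "r \<le> (1/2)^n" using s by (auto simp: P_def ar)
    obtain m y where y: "y \<in> ?V" "L2_norm M (\<lambda>x. y x - a x) < r" "L2_norm M (T m y) > real n"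
      using unbounded[OF a r(1)] by blast
    interpret L2_operator M \<Omega> "T m" by (rule op)
    obtain C where C: "C \<ge> 0" "\<And>u. u \<in> ?V \<Longrightarrow> L2_norm M (T m u) \<le> C * L2_norm M u" using T_bound by blast
    \<comment> \<open>Moving \<open>y\<close> by less than \<open>d\<close> changes
      \<open>T m y\<close> too little for its norm to drop to \<open>n\<close>. The denominator is
      \<open>C + 1\<close> since \<open>C\<close> may be 0.\<close>
    define d where "d = (L2_norm M (T m y) - real n) / (C + 1)"
    have d: "d > 0" using y(3) C(1) by (simp add: d_def)
    define r' where "r' = min (d / 2) (min ((1/2)^Suc n) (r - L2_norm M (\<lambda>x. y x - a x)))"
    have r': "r' > 0" "r' \<le> (1/2)^Suc n" "r' \<le> r - L2_norm M (\<lambda>x. y x - a x)" "r' < d"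
      using d y(2) by (auto simp: r'_def simp del: power_Suc)
    have "Q n s (y, r')"
      unfolding Q_def ar
    proof (intro ballI impI conjI; simp only: fst_conv snd_conv)
      fix z assume z: "z \<in> ?V" and zy: "L2_norm M (\<lambda>x. z x - y x) \<le> r'"
      show "L2_norm M (\<lambda>x. z x - a x) \<le> r"
        using L2_norm_triangle_diff[OF U[OF z] U[OF y(1)] U[OF a]] zy r'(3) by linarith
      have "L2_norm M (T m y) \<le> L2_norm M (T m z) + L2_norm M (\<lambda>x. T m y x - T m z x)"
        using T_mem U y z by (intro L2_norm_triangle_diff') auto
      also have "L2_norm M (\<lambda>x. T m y x - T m z x) \<le> C * L2_norm M (\<lambda>x. y x - z x)"
        using C(2)[OF L2.diff_mem[OF y(1) z]] T_norm_diff[OF y(1) z] by simp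
      also have "\<dots> \<le> (C + 1) * r'"
        using zy C(1) L2_norm_commute[of M z y] by (intro mult_mono) auto
      also have "\<dots> < (C + 1) * d" using r'(4) C(1) by (intro mult_strict_left_mono) auto
      also have "\<dots> = L2_norm M (T m y) - real n" using C(1) by (simp add: d_def)
      finally show "\<exists>m. L2_norm M (T m z) > real n" by (intro exI[of _ m]) simp
    qed
    then show "\<exists>s'. P (Suc n) s' \<and> Q n s s'" using y(1) r' by (intro exI[of _ "(y, r')"]) (auto simp: P_def)
  qed
  then obtain s where P: "\<And>n. P n (s n)" and Q: "\<And>n. Q n (s n) (s (Suc n))" by blast
  define a where "a n = fst (s n)" for n
  define r where "r n = snd (s n)" for n
  have a: "a n \<in> ?V" and r: "r n > 0" "r n \<le> (1/2)^n" for n using P[of n] by (auto simp: P_def a_def r_def)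
  have Q1: "L2_norm M (\<lambda>x. z x - a n x) \<le> r n" "\<exists>m. L2_norm M (T m z) > real n"
    if "z \<in> ?V" "L2_norm M (\<lambda>x. z x - a (Suc n) x) \<le> r (Suc n)" for z n
    using Q[of n] that by (auto simp: Q_def a_def r_def)
  have nest: "L2_norm M (\<lambda>x. z x - a n x) \<le> r n" if "n \<le> m" "z \<in> ?V" "L2_norm M (\<lambda>x. z x - a m x) \<le> r m" for z n m
    using that by (induction m rule: dec_induct) (auto intro: Q1(1))
  have an: "L2_norm M (\<lambda>x. a m x - a n x) \<le> r n" if "n \<le> m" for m n
    by (rule nest[OF that a]) (use r[of m] in \<open>simp add: L2_norm_def\<close>)
  have "\<exists>v\<in>?V. (\<lambda>n. L2_norm M (\<lambda>x. a n x - v x)) \<longlonglongrightarrow> 0"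
  proof (rule L2_space_complete[OF Om a])
    fix e :: real assume "e > 0"
    then obtain N where N: "(1/2::real)^N < e / 2" using real_arch_pow_inv[of "e/2" "1/2"] by auto
    have "L2_norm M (\<lambda>x. a m x - a n x) < e" if "m \<ge> N" "n \<ge> N" for m n
    proof -
      have "L2_norm M (\<lambda>x. a m x - a n x) \<le> L2_norm M (\<lambda>x. a m x - a N x) + L2_norm M (\<lambda>x. a N x - a n x)"
        using U a by (intro L2_norm_triangle_diff) auto
      then show ?thesis
        using an[OF that(1)] an[OF that(2)] r(2)[of N] N L2_norm_commute[of M "a N" "a n"] by linarith
    qed
    then show "\<exists>N. \<forall>m\<ge>N. \<forall>n\<ge>N. L2_norm M (\<lambda>x. a m x - a n x) < e" by blast
  qed
  then obtain v where v: "v \<in> ?V" and lim: "(\<lambda>n. L2_norm M (\<lambda>x. a n x - v x)) \<longlonglongrightarrow> 0" by blast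
  have va: "L2_norm M (\<lambda>x. v x - a n x) \<le> r n" for n
  proof (rule field_le_epsilon)
    fix e :: real assume "e > 0"
    then have "\<forall>\<^sub>F m in sequentially. L2_norm M (\<lambda>x. a m x - v x) < e \<and> n \<le> m"
      using order_tendstoD(2)[OF lim] eventually_ge_at_top[of n] by (auto intro: eventually_conj)
    then obtain m where m: "L2_norm M (\<lambda>x. a m x - v x) < e" "n \<le> m"
      using eventually_happens by force
    have "L2_norm M (\<lambda>x. v x - a n x) \<le> L2_norm M (\<lambda>x. v x - a m x) + L2_norm M (\<lambda>x. a m x - a n x)"
      using U a v by (intro L2_norm_triangle_diff) auto
    then show "L2_norm M (\<lambda>x. v x - a n x) \<le> r n + e"
      using m an[OF m(2)] L2_norm_commute[of M "a m" v] by linarith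
  qed
  obtain B where B: "\<And>n. L2_norm M (T n v) \<le> B" using ptw[OF v] by blast
  obtain n :: nat where n: "B \<le> real n" using real_arch_simple by blast
  obtain m where "L2_norm M (T m v) > real n" using Q1(2)[OF v va] by blast
  then show False using B[of m] n by simp
qed

section \<open>Differentiation of integral functionals along curves\<close>

definition L2_deriv :: "'a measure \<Rightarrow> (real \<Rightarrow> 'a \<Rightarrow> real) \<Rightarrow> ('a \<Rightarrow> real) \<Rightarrow> real \<Rightarrow> bool" where
  "L2_deriv M w w' t \<longleftrightarrow> ((\<lambda>h. L2_norm M (\<lambda>x. (w (t + h) x - w t x) / h - w' x)) \<longlongrightarrow> 0) (at 0)"

text \<open>Here \<open>p\<close> is the derivative of \<open>\<Phi>\<close>. A quadratic remainder
  and linear growth of \<open>p\<close> keep all terms integrable on \<open>L\<^sub>2\<close> even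
  over a space of infinite measure. The instances are the square and the functions
  \<open>huber c\<close>.\<close>

locale quadratic_gauge =
  fixes \<Phi> p :: "real \<Rightarrow> real" and K :: real
  assumes taylor: "\<And>a h. \<bar>\<Phi> (a + h) - \<Phi> a - p a * h\<bar> \<le> K * h\<^sup>2"
    and \<Phi>0: "\<Phi> 0 = 0" and p_bound: "\<And>a. \<bar>p a\<bar> \<le> K * \<bar>a\<bar>"
    and \<Phi>_meas [measurable]: "\<Phi> \<in> borel_measurable borel"
    and p_meas [measurable]: "p \<in> borel_measurable borel"
begin

lemma K_nonneg: "K \<ge> 0"
  using p_bound[of 1] by simp

lemma p_mem:
  assumes "g \<in> L2_space M UNIV"
  shows "(\<lambda>x. p (g x)) \<in> L2_space M UNIV" "L2_norm M (\<lambda>x. p (g x)) \<le> K * L2_norm M g"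
proof -
  have Kg: "(\<lambda>x. K * g x) \<in> L2_space M UNIV" using assms by (rule L2.scale_mem)
  have m: "(\<lambda>x. p (g x)) \<in> borel_measurable M" using L2_spaceD(1)[OF assms] by measurable
  have le: "AE x in M. \<bar>p (g x)\<bar> \<le> \<bar>K * g x\<bar>" using p_bound K_nonneg by (auto simp: abs_mult)
  show "(\<lambda>x. p (g x)) \<in> L2_space M UNIV" using Kg m le by (rule L2_space_bound)
  show "L2_norm M (\<lambda>x. p (g x)) \<le> K * L2_norm M g"
    using L2_norm_mono[OF Kg m le] K_nonneg by (simp add: L2_norm_scale)
qed

lemma \<Phi>_integrable:
  assumes "g \<in> L2_space M UNIV"
  shows "integrable M (\<lambda>x. \<Phi> (g x))"
proof (rule Bochner_Integration.integrable_bound)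
  show "integrable M (\<lambda>x. K * (g x)\<^sup>2)" using L2_spaceD(2)[OF assms] by simp
  show "(\<lambda>x. \<Phi> (g x)) \<in> borel_measurable M" using L2_spaceD(1)[OF assms] by measurable
  have "\<bar>\<Phi> (g x)\<bar> \<le> K * (g x)\<^sup>2" for x using taylor[of 0 "g x"] p_bound[of 0] by (simp add: \<Phi>0)
  then show "AE x in M. norm (\<Phi> (g x)) \<le> norm (K * (g x)\<^sup>2)" using K_nonneg by simp
qed

lemma integral_taylor:
  assumes f: "f \<in> L2_space M UNIV" and g: "g \<in> L2_space M UNIV"
  shows "\<bar>(\<integral>x. \<Phi> (f x) \<partial>M) - (\<integral>x. \<Phi> (g x) \<partial>M) - (\<integral>x. (f x - g x) * p (g x) \<partial>M)\<bar>
    \<le> K * (L2_norm M (\<lambda>x. f x - g x))\<^sup>2"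
proof -
  have d: "(\<lambda>x. f x - g x) \<in> L2_space M UNIV" using f g by (rule L2.diff_mem)
  have i1: "integrable M (\<lambda>x. (f x - g x) * p (g x))" using d p_mem(1)[OF g] by (rule integrable_mult_L2)
  have i2: "integrable M (\<lambda>x. \<Phi> (f x) - \<Phi> (g x) - (f x - g x) * p (g x))"
    using i1 \<Phi>_integrable[OF f] \<Phi>_integrable[OF g] by (intro Bochner_Integration.integrable_diff)
  have "(\<integral>x. \<Phi> (f x) \<partial>M) - (\<integral>x. \<Phi> (g x) \<partial>M) - (\<integral>x. (f x - g x) * p (g x) \<partial>M)
      = (\<integral>x. \<Phi> (f x) - \<Phi> (g x) - (f x - g x) * p (g x) \<partial>M)"
    using i1 \<Phi>_integrable[OF f] \<Phi>_integrable[OF g] by simp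
  also have "\<bar>\<dots>\<bar> \<le> (\<integral>x. \<bar>\<Phi> (f x) - \<Phi> (g x) - (f x - g x) * p (g x)\<bar> \<partial>M)"
    by (rule integral_abs_bound)
  also have "\<dots> \<le> (\<integral>x. K * (f x - g x)\<^sup>2 \<partial>M)"
  proof (rule integral_mono)
    show "integrable M (\<lambda>x. \<bar>\<Phi> (f x) - \<Phi> (g x) - (f x - g x) * p (g x)\<bar>)" using i2 by (rule integrable_abs)
    show "integrable M (\<lambda>x. K * (f x - g x)\<^sup>2)" using L2_spaceD(2)[OF d] by simp
    show "\<bar>\<Phi> (f x) - \<Phi> (g x) - (f x - g x) * p (g x)\<bar> \<le> K * (f x - g x)\<^sup>2" for x
      using taylor[of "g x" "f x - g x"] by (simp add: mult.commute)
  qed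
  also have "\<dots> = K * (L2_norm M (\<lambda>x. f x - g x))\<^sup>2" by (simp add: L2_norm_sq)
  finally show ?thesis .
qed

lemma integral_diff_le:
  assumes f: "f \<in> L2_space M UNIV" and g: "g \<in> L2_space M UNIV"
  shows "\<bar>(\<integral>x. \<Phi> (f x) \<partial>M) - (\<integral>x. \<Phi> (g x) \<partial>M)\<bar>
    \<le> K * L2_norm M (\<lambda>x. f x - g x) * (L2_norm M (\<lambda>x. f x - g x) + L2_norm M g)"
proof -
  let ?n = "L2_norm M (\<lambda>x. f x - g x)"
  have "\<bar>\<integral>x. (f x - g x) * p (g x) \<partial>M\<bar> \<le> ?n * L2_norm M (\<lambda>x. p (g x))"
    using f g p_mem(1)[OF g] by (intro L2_inner_le L2.diff_mem)
  also have "\<dots> \<le> ?n * (K * L2_norm M g)" using p_mem(2)[OF g] by (intro mult_left_mono) auto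
  finally have "\<bar>(\<integral>x. \<Phi> (f x) \<partial>M) - (\<integral>x. \<Phi> (g x) \<partial>M)\<bar> \<le> K * ?n\<^sup>2 + ?n * (K * L2_norm M g)"
    using integral_taylor[OF f g] by linarith
  then show ?thesis by (simp add: power2_eq_square algebra_simps)
qed

lemma integral_tendsto:
  assumes "\<And>h. f h \<in> L2_space M UNIV" "g \<in> L2_space M UNIV"
    and lim: "((\<lambda>h. L2_norm M (\<lambda>x. f h x - g x)) \<longlongrightarrow> 0) F"
  shows "((\<lambda>h. \<integral>x. \<Phi> (f h x) \<partial>M) \<longlongrightarrow> (\<integral>x. \<Phi> (g x) \<partial>M)) F"
proof (rule LIM_zero_cancel, rule Lim_null_comparison)
  have "((\<lambda>h. K * L2_norm M (\<lambda>x. f h x - g x) * (L2_norm M (\<lambda>x. f h x - g x) + L2_norm M g))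
      \<longlongrightarrow> K * 0 * (0 + L2_norm M g)) F"
    by (intro tendsto_intros lim)
  then show "((\<lambda>h. K * L2_norm M (\<lambda>x. f h x - g x) * (L2_norm M (\<lambda>x. f h x - g x) + L2_norm M g)) \<longlongrightarrow> 0) F"
    by simp
  show "\<forall>\<^sub>F h in F. norm ((\<integral>x. \<Phi> (f h x) \<partial>M) - (\<integral>x. \<Phi> (g x) \<partial>M))
      \<le> K * L2_norm M (\<lambda>x. f h x - g x) * (L2_norm M (\<lambda>x. f h x - g x) + L2_norm M g)"
    using integral_diff_le[OF assms(1,2)] by (intro always_eventually) simp
qed

lemma integral_le_by_approx:
  assumes f: "f \<in> L2_space M UNIV" and g: "g \<in> L2_space M UNIV"
    and approx: "\<And>e. e > 0 \<Longrightarrow> \<exists>f' g'. f' \<in> L2_space M UNIV \<and> g' \<in> L2_space M UNIV \<and>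
      L2_norm M (\<lambda>x. f' x - f x) < e \<and> L2_norm M (\<lambda>x. g' x - g x) < e \<and>
      (\<integral>x. \<Phi> (f' x) \<partial>M) \<le> (\<integral>x. \<Phi> (g' x) \<partial>M)"
  shows "(\<integral>x. \<Phi> (f x) \<partial>M) \<le> (\<integral>x. \<Phi> (g x) \<partial>M)"
proof -
  define R where "R n f' g' \<longleftrightarrow> f' \<in> L2_space M UNIV \<and> g' \<in> L2_space M UNIV \<and>
      L2_norm M (\<lambda>x. f' x - f x) < 1 / Suc n \<and> L2_norm M (\<lambda>x. g' x - g x) < 1 / Suc n \<and>
      (\<integral>x. \<Phi> (f' x) \<partial>M) \<le> (\<integral>x. \<Phi> (g' x) \<partial>M)" for n :: nat and f' g'
  have "\<exists>f' g'. R n f' g'" for n unfolding R_def by (rule approx) simp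
  then obtain f' g' where R: "\<And>n. R n (f' n) (g' n)" by metis
  note * = R[unfolded R_def]
  have f': "f' n \<in> L2_space M UNIV" and g': "g' n \<in> L2_space M UNIV"
    and le: "(\<integral>x. \<Phi> (f' n x) \<partial>M) \<le> (\<integral>x. \<Phi> (g' n x) \<partial>M)" for n using *[of n] by auto
  have z: "(\<lambda>n. 1 / real (Suc n)) \<longlonglongrightarrow> 0" by (rule LIMSEQ_Suc[OF lim_1_over_n])
  have "(\<lambda>n. L2_norm M (\<lambda>x. f' n x - f x)) \<longlonglongrightarrow> 0" "(\<lambda>n. L2_norm M (\<lambda>x. g' n x - g x)) \<longlonglongrightarrow> 0"
    using * by (auto intro!: Lim_null_comparison[OF _ z] always_eventually less_imp_le)
  from tendsto_le[OF trivial_limit_sequentially integral_tendsto[OF g' g this(2)] integral_tendsto[OF f' f this(1)]]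
  show ?thesis using le by simp
qed

text \<open>A chain rule: the Taylor remainder is of second order in \<open>h\<close>, and the
  linear term converges by Cauchy-Schwarz because \<open>p (w t x)\<close> is square integrable in
  \<open>x\<close>.\<close>

lemma integral_deriv:
  assumes w: "\<And>t. w t \<in> L2_space M UNIV" and w': "w' \<in> L2_space M UNIV" and d: "L2_deriv M w w' t"
  shows "((\<lambda>t. \<integral>x. \<Phi> (w t x) \<partial>M) has_real_derivative (\<integral>x. w' x * p (w t x) \<partial>M)) (at t)"
proof -
  define q where "q h x = (w (t + h) x - w t x) / h - w' x" for h x
  define n where "n h = L2_norm M (q h)" for h
  have lim: "(n \<longlongrightarrow> 0) (at 0)" using d unfolding L2_deriv_def n_def q_def[abs_def] .
  let ?F = "\<lambda>t. \<integral>x. \<Phi> (w t x) \<partial>M" and ?I = "\<integral>x. w' x * p (w t x) \<partial>M"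
  have qm: "q h \<in> L2_space M UNIV" for h
  proof -
    have "q h = (\<lambda>x. (1 / h) * (w (t + h) x - w t x) - w' x)" by (auto simp: q_def)
    then show ?thesis using w w' by (auto intro!: L2.diff_mem L2.scale_mem simp del: times_divide_eq_left)
  qed
  have est: "\<bar>(?F (t + h) - ?F t) / h - ?I\<bar> \<le> K * \<bar>h\<bar> * (n h + L2_norm M w')\<^sup>2 + n h * (K * L2_norm M (w t))"
    if h: "h \<noteq> 0" for h
  proof -
    have dm: "(\<lambda>x. w (t + h) x - w t x) \<in> L2_space M UNIV" using w by (intro L2.diff_mem)
    have eq: "(\<lambda>x. w (t + h) x - w t x) = (\<lambda>x. h * (q h x + w' x))" using h by (auto simp: q_def)
    have ip: "(\<integral>x. (w (t + h) x - w t x) * p (w t x) \<partial>M) = h * ((\<integral>x. q h x * p (w t x) \<partial>M) + ?I)"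
      unfolding eq[THEN fun_cong]
      using integrable_mult_L2[OF qm p_mem(1)[OF w], of h t] integrable_mult_L2[OF w' p_mem(1)[OF w], of t]
      by (simp add: mult.assoc distrib_right)
    have "L2_norm M (\<lambda>x. w (t + h) x - w t x) \<le> \<bar>h\<bar> * (n h + L2_norm M w')"
      unfolding eq L2_norm_scale n_def using qm w' by (intro mult_left_mono L2_norm_triangle) auto
    then have "K * (L2_norm M (\<lambda>x. w (t + h) x - w t x))\<^sup>2 \<le> K * (\<bar>h\<bar> * (n h + L2_norm M w'))\<^sup>2"
      using K_nonneg by (intro mult_left_mono power_mono) auto
    then have "\<bar>?F (t + h) - ?F t - h * ((\<integral>x. q h x * p (w t x) \<partial>M) + ?I)\<bar> \<le> K * (\<bar>h\<bar> * (n h + L2_norm M w'))\<^sup>2"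
      using integral_taylor[OF w w, of "t + h" t] unfolding ip by linarith
    also have "\<dots> = \<bar>h\<bar> * (K * \<bar>h\<bar> * (n h + L2_norm M w')\<^sup>2)"
      by (simp add: power_mult_distrib power2_eq_square mult_ac)
    finally have "\<bar>?F (t + h) - ?F t - h * ((\<integral>x. q h x * p (w t x) \<partial>M) + ?I)\<bar> \<le> \<bar>h\<bar> * (K * \<bar>h\<bar> * (n h + L2_norm M w')\<^sup>2)" .
    moreover have "h * (A / h - X) = A - h * X" for A X using h by (simp add: right_diff_distrib)
    ultimately have "\<bar>h * ((?F (t + h) - ?F t) / h - ((\<integral>x. q h x * p (w t x) \<partial>M) + ?I))\<bar> \<le> \<bar>h\<bar> * (K * \<bar>h\<bar> * (n h + L2_norm M w')\<^sup>2)"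
      by simp
    from this[unfolded abs_mult]
    have 1: "\<bar>(?F (t + h) - ?F t) / h - ((\<integral>x. q h x * p (w t x) \<partial>M) + ?I)\<bar> \<le> K * \<bar>h\<bar> * (n h + L2_norm M w')\<^sup>2"
      by (rule mult_left_le_imp_le) (use h in simp)
    have "\<bar>\<integral>x. q h x * p (w t x) \<partial>M\<bar> \<le> n h * L2_norm M (\<lambda>x. p (w t x))"
      unfolding n_def using qm p_mem(1)[OF w] by (rule L2_inner_le)
    also have "\<dots> \<le> n h * (K * L2_norm M (w t))"
      using p_mem(2)[OF w] by (intro mult_left_mono) (auto simp: n_def)
    finally show ?thesis using 1 by linarith
  qed
  have "((\<lambda>h. (?F (t + h) - ?F t) / h - ?I) \<longlongrightarrow> 0) (at 0)"
  proof (rule Lim_null_comparison)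
    show "\<forall>\<^sub>F h in at 0. norm ((?F (t + h) - ?F t) / h - ?I)
        \<le> K * \<bar>h\<bar> * (n h + L2_norm M w')\<^sup>2 + n h * (K * L2_norm M (w t))"
      unfolding eventually_at using est by (intro exI[of _ 1]) auto
    have "((\<lambda>h. K * \<bar>h\<bar> * (n h + L2_norm M w')\<^sup>2 + n h * (K * L2_norm M (w t)))
        \<longlongrightarrow> K * \<bar>0\<bar> * (0 + L2_norm M w')\<^sup>2 + 0 * (K * L2_norm M (w t))) (at 0)"
      by (intro tendsto_intros lim)
    then show "((\<lambda>h. K * \<bar>h\<bar> * (n h + L2_norm M w')\<^sup>2 + n h * (K * L2_norm M (w t))) \<longlongrightarrow> 0) (at 0)" by simp
  qed
  then show ?thesis unfolding DERIV_def by (rule LIM_zero_cancel)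
qed

lemma energy_nonincreasing:
  assumes w: "\<And>t. w t \<in> L2_space M UNIV" and w': "\<And>t. w' t \<in> L2_space M UNIV"
    and d: "\<And>t. 0 < t \<Longrightarrow> t < T \<Longrightarrow> L2_deriv M w (w' t) t"
    and cont0: "((\<lambda>t. L2_norm M (\<lambda>x. w t x - w 0 x)) \<longlongrightarrow> 0) (at_right 0)"
    and sign: "\<And>t. 0 < t \<Longrightarrow> t < T \<Longrightarrow> (\<integral>x. w' t x * p (w t x) \<partial>M) \<le> 0"
    and t: "0 \<le> t" "t < T"
  shows "(\<integral>x. \<Phi> (w t x) \<partial>M) \<le> (\<integral>x. \<Phi> (w 0 x) \<partial>M)"
proof (rule DERIV_nonpos_imp_decreasing_open[OF t(1), of "\<lambda>t. \<integral>x. \<Phi> (w t x) \<partial>M"])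
  fix s assume s: "0 < s" "s < t"
  then show "\<exists>y. ((\<lambda>t. \<integral>x. \<Phi> (w t x) \<partial>M) has_real_derivative y) (at s) \<and> y \<le> 0"
    using integral_deriv[OF w w' d, of s] sign[of s] t by (intro exI[of _ "\<integral>x. w' s x * p (w s x) \<partial>M"]) auto
next
  show "continuous_on {0..t} (\<lambda>t. \<integral>x. \<Phi> (w t x) \<partial>M)"
    unfolding continuous_on_eq_continuous_within
  proof
    fix s assume s: "s \<in> {0..t}"
    show "continuous (at s within {0..t}) (\<lambda>t. \<integral>x. \<Phi> (w t x) \<partial>M)"
    proof (cases "s = 0")
      case True
      \<comment> \<open>At time 0 only right continuity of the curve is assumed, which is all that
        an interval starting at 0 requires.\<close>
      have "at (0::real) within {0..t} \<le> at_right 0"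
        unfolding at_within_Ici_at_right[symmetric] by (rule at_le) auto
      then have "((\<lambda>t. L2_norm M (\<lambda>x. w t x - w 0 x)) \<longlongrightarrow> 0) (at 0 within {0..t})"
        using cont0 tendsto_mono by blast
      from integral_tendsto[OF w w this] show ?thesis unfolding continuous_within True .
    next
      case False
      then have "((\<lambda>t. \<integral>x. \<Phi> (w t x) \<partial>M) has_real_derivative (\<integral>x. w' s x * p (w s x) \<partial>M)) (at s)"
        using s t by (intro integral_deriv[OF w w' d]) auto
      then show ?thesis using DERIV_isCont continuous_at_imp_continuous_at_within by blast
    qed
  qed
qed

end

lemma L2_deriv_cong:
  assumes "L2_deriv M w w' t" "t > 0" "\<And>s. s > 0 \<Longrightarrow> w s = v s"
  shows "L2_deriv M v w' t"
  unfolding L2_deriv_def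
proof (rule Lim_transform_eventually[OF assms(1)[unfolded L2_deriv_def]])
  show "\<forall>\<^sub>F h in at 0. L2_norm M (\<lambda>x. (w (t + h) x - w t x) / h - w' x) = L2_norm M (\<lambda>x. (v (t + h) x - v t x) / h - w' x)"
    unfolding eventually_at using assms(2,3) by (intro exI[of _ t]) (auto simp: dist_real_def)
qed

text \<open>Curves need not be measurable at negative times, so they are frozen there.\<close>

lemma (in quadratic_gauge) energy_nonincreasing_halfline:
  assumes w: "\<And>t. 0 \<le> t \<Longrightarrow> w t \<in> L2_space M UNIV" and w': "\<And>t. 0 \<le> t \<Longrightarrow> w' t \<in> L2_space M UNIV"
    and d: "\<And>t. 0 < t \<Longrightarrow> t < T \<Longrightarrow> L2_deriv M w (w' t) t"
    and cont0: "((\<lambda>t. L2_norm M (\<lambda>x. w t x - w 0 x)) \<longlongrightarrow> 0) (at_right 0)"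
    and sign: "\<And>t. 0 < t \<Longrightarrow> t < T \<Longrightarrow> (\<integral>x. w' t x * p (w t x) \<partial>M) \<le> 0"
    and t: "0 \<le> t" "t < T"
  shows "(\<integral>x. \<Phi> (w t x) \<partial>M) \<le> (\<integral>x. \<Phi> (w 0 x) \<partial>M)"
proof -
  define v where "v t = w (max 0 t)" for t
  have "(\<integral>x. \<Phi> (v t x) \<partial>M) \<le> (\<integral>x. \<Phi> (v 0 x) \<partial>M)"
  proof (rule energy_nonincreasing[where w = v and w' = "\<lambda>t. w' (max 0 t)" and T = T])
    show "L2_deriv M v (w' (max 0 s)) s" if s: "0 < s" "s < T" for s
    proof -
      have "L2_deriv M v (w' s) s" by (rule L2_deriv_cong[OF d[OF s] s(1)]) (simp add: v_def)
      then show ?thesis using s by simp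
    qed
    show "((\<lambda>t. L2_norm M (\<lambda>x. v t x - v 0 x)) \<longlongrightarrow> 0) (at_right 0)"
    proof (rule Lim_transform_eventually[OF cont0])
      show "\<forall>\<^sub>F t in at_right 0. L2_norm M (\<lambda>x. w t x - w 0 x) = L2_norm M (\<lambda>x. v t x - v 0 x)"
        using eventually_at_right_less[of "0::real"] by eventually_elim (simp add: v_def)
    qed
    show "(\<integral>x. w' (max 0 s) x * p (v s x) \<partial>M) \<le> 0" if "0 < s" "s < T" for s
      using sign[OF that] that by (simp add: v_def)
  qed (use w w' t in \<open>simp_all add: v_def\<close>)
  then show ?thesis using t by (simp add: v_def)
qed

section \<open>The semigroup associated with a closed form\<close>

text \<open>Instantiated twice: for \<open>E\<close> on \<open>D\<close> over the whole space, and
  for its restriction to the Dirichlet domain over \<open>\<Omega>\<close>. Density of the form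
  domain is an assumption here and for the second instance comes from
  \<open>DD_dense\<close>.\<close>

locale form_semigroup = closed_psform M D E
  for M :: "'a measure" and D E +
  fixes \<Omega> :: "'a set" and S :: "real \<Rightarrow> ('a \<Rightarrow> real) \<Rightarrow> ('a \<Rightarrow> real)"
  assumes Om: "\<Omega> \<in> sets M"
    and D_sub: "\<And>u. u \<in> D \<Longrightarrow> u \<in> L2_space M \<Omega>"
    and D_dense: "\<And>f e. f \<in> L2_space M \<Omega> \<Longrightarrow> e > 0 \<Longrightarrow> \<exists>u\<in>D. L2_norm M (\<lambda>x. f x - u x) < e"
    and assoc: "associated_semigroup M \<Omega> D E S"
begin

abbreviation "V \<equiv> L2_space M \<Omega>"

lemma V_U: "u \<in> V \<Longrightarrow> u \<in> L2_space M UNIV"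
  by (rule L2_space_UNIV)

lemma C0: "C0_semigroup M \<Omega> S"
  using assoc by (simp add: associated_semigroup_def)

lemma op: "t \<ge> 0 \<Longrightarrow> L2_operator M \<Omega> (S t)"
  using C0 by (simp add: C0_semigroup_def L2_operator_def)

lemma S_mem: "t \<ge> 0 \<Longrightarrow> u \<in> V \<Longrightarrow> S t u \<in> V"
  using L2_operator.T_mem[OF op] .

lemma S_U: "t \<ge> 0 \<Longrightarrow> u \<in> V \<Longrightarrow> S t u \<in> L2_space M UNIV"
  using S_mem V_U by blast

lemma S_meas: "t \<ge> 0 \<Longrightarrow> u \<in> V \<Longrightarrow> S t u \<in> borel_measurable M"
  using S_mem L2_spaceD(1) by blast

lemma S_0: "u \<in> V \<Longrightarrow> AE x in M. S 0 u x = u x"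
  using C0 by (simp add: C0_semigroup_def)

lemma S_plus: "s \<ge> 0 \<Longrightarrow> t \<ge> 0 \<Longrightarrow> u \<in> V \<Longrightarrow> AE x in M. S (s + t) u x = S s (S t u) x"
  using C0 by (simp add: C0_semigroup_def)

lemma S_cont: "u \<in> V \<Longrightarrow> ((\<lambda>t. L2_norm M (\<lambda>x. S t u x - u x)) \<longlongrightarrow> 0) (at_right 0)"
  using C0 by (simp add: C0_semigroup_def)

lemma form_operator_iff: "form_operator M \<Omega> D E u f \<longleftrightarrow> generator M \<Omega> S u (\<lambda>x. - f x)"
  using assoc by (simp add: associated_semigroup_def)

lemma generator_form:
  assumes "generator M \<Omega> S u g"
  shows "u \<in> D" "v \<in> D \<Longrightarrow> E u v = - (\<integral>x. g x * v x \<partial>M)"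
proof -
  have f: "form_operator M \<Omega> D E u (\<lambda>x. - g x)" using assms by (simp add: form_operator_iff)
  then show "u \<in> D" by (simp add: form_operator_def)
  show "E u v = - (\<integral>x. g x * v x \<partial>M)" if "v \<in> D" using f that by (simp add: form_operator_def)
qed

text \<open>Local boundedness is not part of the definition of a strongly continuous semigroup.\<close>

lemma local_bound:
  obtains d C where "d > 0" "C \<ge> 0" "\<And>t u. 0 \<le> t \<Longrightarrow> t \<le> d \<Longrightarrow> u \<in> V \<Longrightarrow> L2_norm M (S t u) \<le> C * L2_norm M u"
proof (rule ccontr)
  assume "\<not> thesis"
  then have neg: "\<not> (d > 0 \<and> C \<ge> 0 \<and> (\<forall>t u. 0 \<le> t \<longrightarrow> t \<le> d \<longrightarrow> u \<in> V \<longrightarrow> L2_norm M (S t u) \<le> C * L2_norm M u))" for d C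
    using that by blast
  \<comment> \<open>Failure of every bound yields times \<open>t n\<close> tending to 0 at which
    \<open>S\<close> exceeds the factor \<open>n\<close>. Strong continuity at 0 keeps each single
    orbit bounded along these times, contradicting uniform boundedness.\<close>
  have "\<exists>t u. 0 \<le> t \<and> t \<le> 1 / Suc n \<and> u \<in> V \<and> L2_norm M (S t u) > real n * L2_norm M u" for n :: nat
    using neg[of "1 / Suc n" "real n"] by (auto simp: not_le)
  then have "\<exists>t. 0 \<le> t \<and> t \<le> 1 / Suc n \<and> (\<exists>u\<in>V. L2_norm M (S t u) > real n * L2_norm M u)" for n :: nat
    by blast
  then obtain t where t: "\<And>n::nat. 0 \<le> t n" "\<And>n. t n \<le> 1 / Suc n"
    "\<And>n. \<exists>u\<in>V. L2_norm M (S (t n) u) > real n * L2_norm M u" by metis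
  have bop: "bounded_operator M V (L2_norm M) (S (t n))" for n
    using C0 t(1) by (simp add: C0_semigroup_def)
  have "\<exists>C. \<forall>n. \<forall>u\<in>V. L2_norm M (S (t n) u) \<le> C * L2_norm M u"
  proof (rule uniform_boundedness[OF Om bop])
    fix u assume u: "u \<in> V"
    obtain d where d: "d > 0" "\<And>s. 0 < s \<Longrightarrow> s < d \<Longrightarrow> L2_norm M (\<lambda>x. S s u x - u x) < 1"
      using order_tendstoD(2)[OF S_cont[OF u], of 1] unfolding eventually_at_right_field by auto
    obtain N :: nat where N: "1 / Suc N < d" using nat_approx_posE[OF d(1)] by blast
    have late: "L2_norm M (S (t n) u) \<le> L2_norm M u + 1" if n: "n \<ge> N" for n
    proof (cases "t n = 0")
      case True
      then have "L2_norm M (S (t n) u) = L2_norm M u"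
        using S_0[OF u] S_meas[OF _ u, of 0] L2_spaceD(1)[OF u] by (intro L2_norm_cong) auto
      then show ?thesis by simp
    next
      case False
      have "1 / real (Suc n) \<le> 1 / real (Suc N)" using n by (intro divide_left_mono) auto
      then have "t n < d" using t(2)[of n] N by linarith
      then have "L2_norm M (\<lambda>x. S (t n) u x - u x) < 1" using d(2)[of "t n"] t(1)[of n] False by auto
      then show ?thesis using L2_norm_triangle_diff'[OF S_U[OF t(1) u] V_U[OF u], of n] by linarith
    qed
    define B where "B = max (L2_norm M u + 1) (Max ((\<lambda>n. L2_norm M (S (t n) u)) ` {..N}))"
    have "L2_norm M (S (t n) u) \<le> B" for n
    proof (cases "n \<ge> N")
      case True
      then show ?thesis using late by (simp add: B_def le_max_iff_disj)
    next
      case False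
      then have "L2_norm M (S (t n) u) \<le> Max ((\<lambda>n. L2_norm M (S (t n) u)) ` {..N})"
        by (intro Max_ge) auto
      then show ?thesis by (simp add: B_def)
    qed
    then show "\<exists>B. \<forall>n. L2_norm M (S (t n) u) \<le> B" by blast
  qed
  then obtain C where C: "\<And>n u. u \<in> V \<Longrightarrow> L2_norm M (S (t n) u) \<le> C * L2_norm M u" by blast
  obtain n :: nat where n: "C \<le> real n" using real_arch_simple by blast
  obtain u where u: "u \<in> V" "L2_norm M (S (t n) u) > real n * L2_norm M u" using t(3)[of n] by blast
  have "C * L2_norm M u \<le> real n * L2_norm M u" using n by (intro mult_right_mono) auto
  then show False using C[OF u(1), of n] u(2) by linarith
qed

lemma S_quotient:
  assumes t: "t \<ge> 0" and u: "u \<in> V" and v: "v \<in> V" and g: "g \<in> V"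
  shows "(\<lambda>x. (v x - u x) / k - g x) \<in> V"
    "AE x in M. S t (\<lambda>x. (v x - u x) / k - g x) x = (S t v x - S t u x) / k - S t g x"
proof -
  interpret L2_operator M \<Omega> "S t" using t by (rule op)
  have d: "(\<lambda>x. v x - u x) \<in> V" using v u by (rule L2.diff_mem)
  have sd: "(\<lambda>x. (1/k) * (v x - u x)) \<in> V" using d by (rule L2.scale_mem)
  have eq: "(\<lambda>x. (v x - u x) / k - g x) = (\<lambda>x. (1/k) * (v x - u x) - g x)" by auto
  show "(\<lambda>x. (v x - u x) / k - g x) \<in> V" unfolding eq using sd g by (rule L2.diff_mem)
  show "AE x in M. S t (\<lambda>x. (v x - u x) / k - g x) x = (S t v x - S t u x) / k - S t g x"
    unfolding eq using T_diff[OF sd g] T_scale[OF d, of "1/k"] T_diff[OF v u]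
    by eventually_elim simp
qed

text \<open>The operator \<open>S t\<close> is bounded and, up to null sets, commutes with the
  difference quotients at time 0.\<close>

lemma generator_orbit:
  assumes gen: "generator M \<Omega> S u g" and t: "t \<ge> 0"
  shows "generator M \<Omega> S (S t u) (S t g)"
proof -
  have u: "u \<in> V" and g: "g \<in> V" and lim: "((\<lambda>h. L2_norm M (\<lambda>x. (S h u x - u x) / h - g x)) \<longlongrightarrow> 0) (at_right 0)"
    using gen by (auto simp: generator_def)
  interpret L2_operator M \<Omega> "S t" using t by (rule op)
  obtain C where C: "C \<ge> 0" "\<And>u. u \<in> V \<Longrightarrow> L2_norm M (S t u) \<le> C * L2_norm M u" using T_bound by blast
  have est: "L2_norm M (\<lambda>x. (S h (S t u) x - S t u x) / h - S t g x) \<le> C * L2_norm M (\<lambda>x. (S h u x - u x) / h - g x)"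
    if h: "h > 0" for h
  proof -
    have Su: "S h u \<in> V" and SSu: "S h (S t u) \<in> V" using h u t by (auto intro!: S_mem)
    note q = S_quotient[OF t u Su g, of h]
    have "AE x in M. S (h + t) u x = S h (S t u) x" using h t u by (intro S_plus) auto
    moreover have "AE x in M. S (h + t) u x = S t (S h u) x"
      using S_plus[of t h u] h t u by (simp add: add.commute)
    ultimately have "AE x in M. (S h (S t u) x - S t u x) / h - S t g x = S t (\<lambda>x. (S h u x - u x) / h - g x) x"
      using q(2) by eventually_elim simp
    then have "L2_norm M (\<lambda>x. (S h (S t u) x - S t u x) / h - S t g x) = L2_norm M (S t (\<lambda>x. (S h u x - u x) / h - g x))"
      using L2_spaceD(1)[OF SSu] T_meas[OF u] T_meas[OF g] T_meas[OF q(1)] by (intro L2_norm_cong) auto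
    then show ?thesis using C(2)[OF q(1)] by simp
  qed
  have "((\<lambda>h. L2_norm M (\<lambda>x. (S h (S t u) x - S t u x) / h - S t g x)) \<longlongrightarrow> 0) (at_right 0)"
  proof (rule Lim_null_comparison)
    show "((\<lambda>h. C * L2_norm M (\<lambda>x. (S h u x - u x) / h - g x)) \<longlongrightarrow> 0) (at_right 0)"
      using tendsto_mult_left[OF lim, of C] by simp
    show "\<forall>\<^sub>F h in at_right 0. norm (L2_norm M (\<lambda>x. (S h (S t u) x - S t u x) / h - S t g x))
        \<le> C * L2_norm M (\<lambda>x. (S h u x - u x) / h - g x)"
      using eventually_at_right_less[of "0::real"] by eventually_elim (use est in simp)
  qed
  then show ?thesis using T_mem u g by (simp add: generator_def)
qed

text \<open>The generator provides a right derivative only. For a step back by \<open>k\<close> one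
  factors out \<open>S (t - k)\<close>, leaving the quotient error at time 0 and the term
  \<open>g - S k g\<close>. The operator \<open>S (t - k)\<close> varies with \<open>k\<close>,
  which is why a bound uniform in time is assumed.\<close>

lemma orbit_deriv:
  assumes gen: "generator M \<Omega> S u g" and t: "0 < t" "t < T" and C0: "C \<ge> 0"
    and C: "\<And>s v. 0 \<le> s \<Longrightarrow> s \<le> T \<Longrightarrow> v \<in> V \<Longrightarrow> L2_norm M (S s v) \<le> C * L2_norm M v"
  shows "L2_deriv M (\<lambda>t. S t u) (S t g) t"
proof -
  have u: "u \<in> V" and g: "g \<in> V" and lim: "((\<lambda>h. L2_norm M (\<lambda>x. (S h u x - u x) / h - g x)) \<longlongrightarrow> 0) (at_right 0)"
    using gen by (auto simp: generator_def)
  define F where "F k = C * (L2_norm M (\<lambda>x. (S k u x - u x) / k - g x) + L2_norm M (\<lambda>x. S k g x - g x))" for k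
  have Flim: "(F \<longlongrightarrow> 0) (at_right 0)"
    using tendsto_mult_left[OF tendsto_add[OF lim S_cont[OF g]], of C] by (simp add: F_def[abs_def])
  have absF: "((\<lambda>h::real. F \<bar>h\<bar>) \<longlongrightarrow> 0) (at 0)"
  proof (rule filterlim_compose[OF Flim])
    have "((\<lambda>h::real. \<bar>h\<bar>) \<longlongrightarrow> \<bar>0\<bar>) (at 0)" by (intro tendsto_intros)
    moreover have "\<forall>\<^sub>F h::real in at 0. \<bar>h\<bar> \<in> {0<..} \<and> \<bar>h\<bar> \<noteq> 0"
      unfolding eventually_at by (intro exI[of _ 1]) auto
    ultimately show "filterlim (\<lambda>h::real. \<bar>h\<bar>) (at_right 0) (at 0)"
      by (simp add: filterlim_at)
  qed
  have est: "L2_norm M (\<lambda>x. (S (t + h) u x - S t u x) / h - S t g x) \<le> F \<bar>h\<bar>"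
    if h: "h \<noteq> 0" "\<bar>h\<bar> < min t (T - t)" for h
  proof (cases "h > 0")
    case True
    have Su: "S h u \<in> V" using True u by (intro S_mem) auto
    have t0: "t \<ge> 0" using t by simp
    note q = S_quotient[OF t0 u Su g, of h]
    have "AE x in M. (S (t + h) u x - S t u x) / h - S t g x = S t (\<lambda>x. (S h u x - u x) / h - g x) x"
      using q(2) S_plus[OF t0 less_imp_le[OF True] u] by eventually_elim simp
    then have "L2_norm M (\<lambda>x. (S (t + h) u x - S t u x) / h - S t g x) = L2_norm M (S t (\<lambda>x. (S h u x - u x) / h - g x))"
      using t True u g q(1) S_meas[of "t + h" u] S_meas[of t u] S_meas[of t g] S_meas[OF t0 q(1)]
      by (intro L2_norm_cong) auto
    also have "\<dots> \<le> C * L2_norm M (\<lambda>x. (S h u x - u x) / h - g x)" using t q(1) by (intro C) auto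
    also have "\<dots> \<le> F \<bar>h\<bar>" unfolding F_def using True C0 by (intro mult_left_mono) auto
    finally show ?thesis .
  next
    case False
    define k where "k = - h"
    have k: "k > 0" "k < t" "h = - k" using h False by (auto simp: k_def)
    define s where "s = t - k"
    have s: "s \<ge> 0" "s \<le> T" "t = s + k" "t + h = s" using k t by (auto simp: s_def)
    have Su: "S k u \<in> V" and Sg: "S k g \<in> V" using k u g by (auto intro!: S_mem)
    interpret L2_operator M \<Omega> "S s" using s(1) by (rule op)
    note q = S_quotient[OF s(1) u Su g, of k]
    have gd: "(\<lambda>x. g x - S k g x) \<in> V" using g Sg by (rule L2.diff_mem)
    let ?q = "\<lambda>x. (S k u x - u x) / k - g x"
    have "AE x in M. (S (t + h) u x - S t u x) / h - S t g x = S s ?q x + S s (\<lambda>x. g x - S k g x) x"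
      using q(2) S_plus[OF s(1) less_imp_le[OF k(1)] u] S_plus[OF s(1) less_imp_le[OF k(1)] g] T_diff[OF g Sg]
      unfolding s(4) s(3)[symmetric]
      by eventually_elim (simp add: k(3) minus_divide_left[symmetric] diff_divide_distrib)
    then have "L2_norm M (\<lambda>x. (S (t + h) u x - S t u x) / h - S t g x)
        = L2_norm M (\<lambda>x. S s ?q x + S s (\<lambda>x. g x - S k g x) x)"
      using t s(1) u g S_meas[of s u] S_meas[of t u] S_meas[of t g] T_meas[OF q(1)] T_meas[OF gd]
      unfolding s(4) by (intro L2_norm_cong) auto
    also have "\<dots> \<le> L2_norm M (S s ?q) + L2_norm M (S s (\<lambda>x. g x - S k g x))"
      using T_mem V_U q(1) gd by (intro L2_norm_triangle) auto
    also have "\<dots> \<le> C * L2_norm M ?q + C * L2_norm M (\<lambda>x. g x - S k g x)"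
      using s q(1) gd by (intro add_mono C) auto
    also have "\<dots> = F \<bar>h\<bar>" using k L2_norm_commute[of M "S k g" g] by (simp add: F_def distrib_left)
    finally show ?thesis .
  qed
  show ?thesis
    unfolding L2_deriv_def
  proof (rule Lim_null_comparison[OF _ absF])
    show "\<forall>\<^sub>F h in at 0. norm (L2_norm M (\<lambda>x. (S (t + h) u x - S t u x) / h - S t g x)) \<le> F \<bar>h\<bar>"
      unfolding eventually_at using est t by (intro exI[of _ "min t (T - t)"]) auto
  qed
qed

text \<open>Testing the equation for \<open>r\<close> with \<open>v - r\<close> bounds
  \<open>l\<close> times the squared distance by \<open>E r v - E r r\<close>, which is at most
  \<open>E v v / 4\<close> since the energy of \<open>r - v / 2\<close> is nonnegative. A large
  \<open>l\<close> therefore brings \<open>r\<close> close to \<open>v\<close>.\<close>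

lemma resolvent_near:
  assumes v: "v \<in> D" and e: "e > 0"
  obtains l r where "l \<ge> 1" "form_operator M \<Omega> D E r (\<lambda>x. l * (v x - r x))" "L2_norm M (\<lambda>x. v x - r x) < e"
proof -
  define l where "l = max 1 (E v v / e\<^sup>2)"
  have l: "l \<ge> 1" "E v v \<le> l * e\<^sup>2" using e by (auto simp: l_def max_def field_simps)
  obtain r where r: "r \<in> D" "\<And>w. w \<in> D \<Longrightarrow> E r w = (\<integral>x. (l * (v x - r x)) * w x \<partial>M)"
    using resolvent_exists[OF l(1) D_L2[OF v]] by blast
  have d: "(\<lambda>x. v x - r x) \<in> D" using v r(1) by (rule diff_mem)
  have "form_operator M \<Omega> D E r (\<lambda>x. l * (v x - r x))"
    using r L2.scale_mem[OF D_sub[OF d]] by (simp add: form_operator_def)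
  moreover have "L2_norm M (\<lambda>x. v x - r x) < e"
  proof -
    have "l * (L2_norm M (\<lambda>x. v x - r x))\<^sup>2 = E r (\<lambda>x. v x - r x)"
      unfolding r(2)[OF d] L2_norm_sq' by (simp add: mult.assoc)
    then have 1: "l * (L2_norm M (\<lambda>x. v x - r x))\<^sup>2 = E r v - E r r" using E_diff_right[OF v r(1) r(1)] by simp
    have "0 \<le> E r r + 2 * (- 1/2) * E r v + (- 1/2)\<^sup>2 * E v v"
      using E_nonneg[OF add_mem[OF r(1) scale_mem[OF v, of "- 1/2"]]] unfolding E_add_scale[OF r(1) v] .
    then have 2: "E r v - E r r \<le> E v v / 4" by (simp add: power2_eq_square)
    have "E v v / 4 \<le> l * e\<^sup>2 / 4" using l(2) by simp
    also have "\<dots> < l * e\<^sup>2" using l(1) e by simp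
    finally have "l * (L2_norm M (\<lambda>x. v x - r x))\<^sup>2 < l * e\<^sup>2" using 1 2 by linarith
    then have "(L2_norm M (\<lambda>x. v x - r x))\<^sup>2 < e\<^sup>2" using l(1) by simp
    then show ?thesis using e by (simp add: power2_less_imp_less)
  qed
  ultimately show thesis using that l(1) by blast
qed

lemma generator_dense:
  assumes f: "f \<in> V" and e: "e > 0"
  obtains u g where "generator M \<Omega> S u g" "L2_norm M (\<lambda>x. f x - u x) < e"
proof -
  obtain v where v: "v \<in> D" "L2_norm M (\<lambda>x. f x - v x) < e / 2" using D_dense[OF f, of "e/2"] e by auto
  obtain l r where r: "form_operator M \<Omega> D E r (\<lambda>x. l * (v x - r x))" "L2_norm M (\<lambda>x. v x - r x) < e / 2"
    using resolvent_near[OF v(1) half_gt_zero[OF e]] by metis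
  have rD: "r \<in> D" using r(1) by (simp add: form_operator_def)
  have "L2_norm M (\<lambda>x. f x - r x) < e"
    using L2_norm_triangle_diff[OF V_U[OF f] D_L2[OF v(1)] D_L2[OF rD]] v(2) r(2) by linarith
  then show thesis using that r(1) by (auto simp: form_operator_iff)
qed

lemma S_cont_0:
  assumes u: "u \<in> V"
  shows "((\<lambda>t. L2_norm M (\<lambda>x. S t u x - S 0 u x)) \<longlongrightarrow> 0) (at_right 0)"
proof (rule Lim_transform_eventually[OF S_cont[OF u]])
  show "\<forall>\<^sub>F t in at_right 0. L2_norm M (\<lambda>x. S t u x - u x) = L2_norm M (\<lambda>x. S t u x - S 0 u x)"
    using eventually_at_right_less[of "0::real"]
  proof eventually_elim
    case (elim t)
    show ?case
      using S_0[OF u] S_meas[of t u] S_meas[of 0 u] L2_spaceD(1)[OF u] u elim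
      by (intro L2_norm_cong) auto
  qed
qed

lemma S_0_norm: "u \<in> V \<Longrightarrow> L2_norm M (S 0 u) = L2_norm M u"
  using S_0[of u] S_meas[of 0 u] L2_spaceD(1)[of u M \<Omega>] by (intro L2_norm_cong) auto

text \<open>Along an orbit the squared norm has derivative minus twice the energy. Differentiability
  rests on the local bound, so this first works for \<open>t < d\<close> on the generator domain;
  density removes the second restriction and splitting \<open>t\<close> into short steps the
  first.\<close>

lemma contractive:
  assumes u: "u \<in> V" and t: "t \<ge> 0"
  shows "L2_norm M (S t u) \<le> L2_norm M u"
proof -
  obtain d C where d: "d > 0" and C: "C \<ge> 0"
    "\<And>t u. 0 \<le> t \<Longrightarrow> t \<le> d \<Longrightarrow> u \<in> V \<Longrightarrow> L2_norm M (S t u) \<le> C * L2_norm M u"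
    using local_bound by metis
  have dom: "L2_norm M (S t v) \<le> L2_norm M v" if gen: "generator M \<Omega> S v g" and t: "0 \<le> t" "t < d" for v g t
  proof -
    interpret quadratic_gauge "\<lambda>s. s\<^sup>2" "\<lambda>s. 2 * s" 2
      by unfold_locales (auto simp: power2_sum abs_mult)
    have v: "v \<in> V" and g: "g \<in> V" using gen by (auto simp: generator_def)
    have "(\<integral>x. (S t v x)\<^sup>2 \<partial>M) \<le> (\<integral>x. (S 0 v x)\<^sup>2 \<partial>M)"
    proof (rule energy_nonincreasing_halfline[where w = "\<lambda>t. S t v" and w' = "\<lambda>t. S t g" and T = d])
      show "L2_deriv M (\<lambda>t. S t v) (S s g) s" if "0 < s" "s < d" for s
        using orbit_deriv[OF gen that C] .
      show "(\<integral>x. S s g x * (2 * S s v x) \<partial>M) \<le> 0" if "0 < s" "s < d" for s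
      proof -
        have gs: "generator M \<Omega> S (S s v) (S s g)" using that by (intro generator_orbit[OF gen]) auto
        have "(\<integral>x. S s g x * (2 * S s v x) \<partial>M) = 2 * (\<integral>x. S s g x * S s v x \<partial>M)"
          by (simp add: mult.left_commute)
        then show ?thesis
          using generator_form(2)[OF gs generator_form(1)[OF gs]] E_nonneg[OF generator_form(1)[OF gs]] by simp
      qed
    qed (use v g t S_U S_cont_0 in auto)
    then have "(L2_norm M (S t v))\<^sup>2 \<le> (L2_norm M v)\<^sup>2" using S_0_norm[OF v] by (metis L2_norm_sq)
    then show ?thesis by (rule power2_le_imp_le) simp
  qed
  have loc: "L2_norm M (S t v) \<le> L2_norm M v" if v: "v \<in> V" and t: "0 \<le> t" "t < d" for v t
  proof (rule field_le_epsilon)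
    fix e :: real assume e: "e > 0"
    interpret L2_operator M \<Omega> "S t" using t(1) by (rule op)
    \<comment> \<open>Replacing \<open>v\<close> by \<open>z\<close> costs the distance once in the
      initial norm and \<open>C\<close> times under \<open>S t\<close>, hence the factor
      \<open>1 + C\<close>.\<close>
    obtain z g where z: "generator M \<Omega> S z g" "L2_norm M (\<lambda>x. v x - z x) < e / (1 + C)"
      using generator_dense[OF v, of "e / (1 + C)"] e C(1) by auto
    have zV: "z \<in> V" using z(1) by (simp add: generator_def)
    have "L2_norm M (S t v) \<le> L2_norm M (S t z) + L2_norm M (\<lambda>x. S t v x - S t z x)"
      using T_mem V_U v zV by (intro L2_norm_triangle_diff') auto
    also have "L2_norm M (\<lambda>x. S t v x - S t z x) \<le> C * L2_norm M (\<lambda>x. v x - z x)"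
      unfolding T_norm_diff[OF v zV] using t v zV by (intro C(2) L2.diff_mem) auto
    also have "L2_norm M (S t z) \<le> L2_norm M v + L2_norm M (\<lambda>x. v x - z x)"
      using dom[OF z(1) t] L2_norm_triangle_diff'[OF V_U[OF zV] V_U[OF v]] L2_norm_commute[of M z v] by linarith
    finally have "L2_norm M (S t v) \<le> L2_norm M v + (1 + C) * L2_norm M (\<lambda>x. v x - z x)"
      by (simp add: algebra_simps)
    also have "(1 + C) * L2_norm M (\<lambda>x. v x - z x) \<le> e"
      using z(2) C(1) by (simp add: pos_less_divide_eq mult.commute)
    finally show "L2_norm M (S t v) \<le> L2_norm M v + e" by simp
  qed
  obtain n where n: "inverse (real (Suc n)) < d / (t + 1)" using reals_Archimedean[of "d / (t + 1)"] d t by auto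
  define s where "s = t / Suc n"
  have s: "0 \<le> s" "s < d"
  proof -
    have "s \<le> (t + 1) * inverse (real (Suc n))" using t by (simp add: s_def divide_inverse mult_right_mono)
    also have "\<dots> < (t + 1) * (d / (t + 1))" using n t by (intro mult_strict_left_mono) auto
    also have "\<dots> = d" using t by simp
    finally show "s < d" .
  qed (use t in \<open>simp add: s_def\<close>)
  have "L2_norm M (S (real k * s) u) \<le> L2_norm M u" for k
  proof (induction k)
    case 0
    then show ?case using S_0_norm[OF u] by simp
  next
    case (Suc k)
    have ks: "0 \<le> real k * s" using s by simp
    have "L2_norm M (S (s + real k * s) u) = L2_norm M (S s (S (real k * s) u))"
      using S_plus[OF s(1) ks u] s ks u
      by (intro L2_norm_cong S_meas S_mem) auto
    also have "\<dots> \<le> L2_norm M (S (real k * s) u)" using s ks u by (intro loc S_mem) auto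
    finally show ?case using Suc by (simp add: algebra_simps)
  qed
  from this[of "Suc n"] show ?thesis by (simp add: s_def)
qed

lemma contractive_diff:
  assumes "u \<in> V" "v \<in> V" "t \<ge> 0"
  shows "L2_norm M (\<lambda>x. S t u x - S t v x) \<le> L2_norm M (\<lambda>x. u x - v x)"
  using contractive[OF L2.diff_mem[OF assms(1,2)] assms(3)] L2_operator.T_norm_diff[OF op[OF assms(3)] assms(1,2)]
  by simp

lemma orbit_L2_deriv:
  assumes "generator M \<Omega> S u g" "t > 0"
  shows "L2_deriv M (\<lambda>t. S t u) (S t g) t"
  by (rule orbit_deriv[OF assms, of "t + 1" 1]) (use contractive in auto)

end

section \<open>Comparison of the two semigroups\<close>

lemma L2_deriv_diff:
  assumes dw: "L2_deriv M w w' t" and dv: "L2_deriv M v v' t" and t: "t > 0"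
    and w: "\<And>s. s > 0 \<Longrightarrow> w s \<in> L2_space M UNIV" and v: "\<And>s. s > 0 \<Longrightarrow> v s \<in> L2_space M UNIV"
    and w': "w' \<in> L2_space M UNIV" and v': "v' \<in> L2_space M UNIV"
  shows "L2_deriv M (\<lambda>s x. w s x - v s x) (\<lambda>x. w' x - v' x) t"
  unfolding L2_deriv_def
proof (rule Lim_null_comparison)
  let ?q = "\<lambda>h x. (w (t + h) x - w t x) / h - w' x" and ?r = "\<lambda>h x. (v (t + h) x - v t x) / h - v' x"
  show "((\<lambda>h. L2_norm M (?q h) + L2_norm M (?r h)) \<longlongrightarrow> 0) (at 0)"
    using tendsto_add[OF dw[unfolded L2_deriv_def] dv[unfolded L2_deriv_def]] by simp
  have "norm (L2_norm M (\<lambda>x. ((w (t + h) x - v (t + h) x) - (w t x - v t x)) / h - (w' x - v' x)))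
      \<le> L2_norm M (?q h) + L2_norm M (?r h)" if h: "\<bar>h\<bar> < t" for h
  proof -
    have th: "t + h > 0" using h by auto
    have "(\<lambda>x. (1/h) * (w (t + h) x - w t x) - w' x) \<in> L2_space M UNIV"
      by (rule L2.diff_mem[OF L2.scale_mem[OF L2.diff_mem[OF w[OF th] w[OF t]]] w'])
    then have q: "?q h \<in> L2_space M UNIV" by simp
    have "(\<lambda>x. (1/h) * (v (t + h) x - v t x) - v' x) \<in> L2_space M UNIV"
      by (rule L2.diff_mem[OF L2.scale_mem[OF L2.diff_mem[OF v[OF th] v[OF t]]] v'])
    then have r: "?r h \<in> L2_space M UNIV" by simp
    have "(\<lambda>x. ((w (t + h) x - v (t + h) x) - (w t x - v t x)) / h - (w' x - v' x)) = (\<lambda>x. ?q h x + (-1) * ?r h x)"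
      by (auto simp: diff_divide_distrib)
    then show ?thesis
      using L2_norm_triangle[OF q L2.scale_mem[OF r, of "-1"]] unfolding L2_norm_scale by simp
  qed
  then show "\<forall>\<^sub>F h in at 0. norm (L2_norm M (\<lambda>x. ((w (t + h) x - v (t + h) x) - (w t x - v t x)) / h - (w' x - v' x)))
      \<le> L2_norm M (?q h) + L2_norm M (?r h)"
    unfolding eventually_at using t by (intro exI[of _ t]) auto
qed

text \<open>The primitive of \<open>clip c\<close>: a \<open>C\<^sup>1\<close> regularisation of \<open>s \<mapsto> c * max 0 s\<close>.\<close>

definition huber :: "real \<Rightarrow> real \<Rightarrow> real" where
  "huber c s = (max 0 s)\<^sup>2 / 2 - (max 0 (s - c))\<^sup>2 / 2"

lemma half_square_taylor:
  fixes a h :: real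
  shows "0 \<le> (max 0 (a + h))\<^sup>2 / 2 - (max 0 a)\<^sup>2 / 2 - max 0 a * h"
    "(max 0 (a + h))\<^sup>2 / 2 - (max 0 a)\<^sup>2 / 2 - max 0 a * h \<le> h\<^sup>2 / 2"
proof -
  consider "0 \<le> a" "0 \<le> a + h" | "0 \<le> a" "a + h \<le> 0" | "a \<le> 0" "0 \<le> a + h" | "a \<le> 0" "a + h \<le> 0" by linarith
  then have "0 \<le> (max 0 (a + h))\<^sup>2 / 2 - (max 0 a)\<^sup>2 / 2 - max 0 a * h \<and>
    (max 0 (a + h))\<^sup>2 / 2 - (max 0 a)\<^sup>2 / 2 - max 0 a * h \<le> h\<^sup>2 / 2"
  proof cases
    case 1
    then show ?thesis by (simp add: power2_eq_square field_simps)
  next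
    case 2
    have "a * (a + 2 * h) \<le> 0" using 2 by (intro mult_nonneg_nonpos) auto
    moreover have "0 \<le> (a + h)\<^sup>2" by simp
    ultimately show ?thesis using 2 by (simp add: max_def power2_eq_square field_simps)
  next
    case 3
    have "(a + h)\<^sup>2 \<le> h\<^sup>2" using 3 by (intro power_mono) auto
    then show ?thesis using 3 by (simp add: max_def)
  next
    case 4
    then show ?thesis by (simp add: max_def)
  qed
  then show "0 \<le> (max 0 (a + h))\<^sup>2 / 2 - (max 0 a)\<^sup>2 / 2 - max 0 a * h"
    "(max 0 (a + h))\<^sup>2 / 2 - (max 0 a)\<^sup>2 / 2 - max 0 a * h \<le> h\<^sup>2 / 2" by auto
qed

text \<open>The function is a difference of two half squares of positive parts. Each has a Taylor
  remainder between 0 and \<open>h\<^sup>2 / 2\<close>, so the difference of the remainders is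
  bounded as well.\<close>

lemma huber_gauge:
  assumes c: "c > 0"
  shows "quadratic_gauge (huber c) (clip c) 1"
proof
  fix a h :: real
  have cl: "clip c a = max 0 a - max 0 (a - c)" using c by (auto simp: clip_def)
  define A where "A = (max 0 (a + h))\<^sup>2 / 2 - (max 0 a)\<^sup>2 / 2 - max 0 a * h"
  define B where "B = (max 0 (a - c + h))\<^sup>2 / 2 - (max 0 (a - c))\<^sup>2 / 2 - max 0 (a - c) * h"
  have "huber c (a + h) - huber c a - clip c a * h = A - B"
    unfolding A_def B_def cl huber_def by (simp add: algebra_simps)
  moreover have "0 \<le> A" "A \<le> h\<^sup>2 / 2" "0 \<le> B" "B \<le> h\<^sup>2 / 2"
    unfolding A_def B_def using half_square_taylor by blast+
  moreover have "0 \<le> h\<^sup>2" by simp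
  ultimately show "\<bar>huber c (a + h) - huber c a - clip c a * h\<bar> \<le> 1 * h\<^sup>2" by linarith
  show "\<bar>clip c a\<bar> \<le> 1 * \<bar>a\<bar>" using c by (auto simp: clip_def)
next
  show "huber c 0 = 0" using c by (simp add: huber_def)
  show "huber c \<in> borel_measurable borel" unfolding huber_def[abs_def] by measurable
  show "clip c \<in> borel_measurable borel" by (rule clip_measurable)
qed

lemma huber_nonpos: "c > 0 \<Longrightarrow> s \<le> 0 \<Longrightarrow> huber c s = 0"
  by (simp add: huber_def)

lemma huber_nonneg: "c > 0 \<Longrightarrow> 0 \<le> huber c s"
  unfolding huber_def by (auto intro!: power_mono simp: max_def)

lemma huber_pos: "c > 0 \<Longrightarrow> s > 0 \<Longrightarrow> huber c s > 0"
  unfolding huber_def by (auto simp: max_def intro!: power_strict_mono)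

lemma huber_le: "c > 0 \<Longrightarrow> s \<ge> 0 \<Longrightarrow> huber c s \<le> c * s"
proof -
  assume c: "c > 0" and s: "s \<ge> 0"
  have "s * s \<le> 2 * (c * s)" if "s \<le> c" using mult_right_mono[OF that s] mult_nonneg_nonneg[of c s] c s by linarith
  then show "huber c s \<le> c * s"
    unfolding huber_def using c s by (simp add: max_def power2_eq_square field_simps)
qed

text \<open>For \<open>s > c\<close> the quotient \<open>huber c s / c\<close> is exactly
  \<open>s - c / 2\<close>; here \<open>c = 1 / (n + 1)\<close>.\<close>

lemma huber_tendsto:
  assumes s: "s \<ge> 0"
  shows "(\<lambda>n. real (Suc n) * huber (1 / Suc n) s) \<longlonglongrightarrow> s"
proof (cases "s = 0")
  case True
  then show ?thesis by (simp add: huber_nonpos)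
next
  case False
  then have pos: "s > 0" using s by simp
  have z: "(\<lambda>n. 1 / real (Suc n)) \<longlonglongrightarrow> 0" by (rule LIMSEQ_Suc[OF lim_1_over_n])
  have "\<forall>\<^sub>F n in sequentially. s - (1/2) * (1 / real (Suc n)) = real (Suc n) * huber (1 / Suc n) s"
    using order_tendstoD(2)[OF z pos]
  proof eventually_elim
    case (elim n)
    define c where "c = 1 / real (Suc n)"
    have c: "real (Suc n) = 1 / c" "c > 0" "c < s" using elim by (auto simp: c_def)
    show ?case
      unfolding c_def[symmetric] unfolding c(1) huber_def using c pos
      by (simp add: max_def power2_eq_square field_simps)
  qed
  moreover have "(\<lambda>n. s - (1/2) * (1 / real (Suc n))) \<longlonglongrightarrow> s - (1/2) * 0" by (intro tendsto_intros z)
  ultimately show ?thesis using Lim_transform_eventually by force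
qed

locale dirichlet_setting = dirichlet_space M D E
  for M :: "'a::metric_space measure" and D E +
  fixes \<Omega> :: "'a set" and S SD :: "real \<Rightarrow> ('a \<Rightarrow> real) \<Rightarrow> ('a \<Rightarrow> real)"
  assumes open_Om: "open \<Omega>"
    and assoc_S: "associated_semigroup M UNIV D E S"
    and assoc_SD: "associated_semigroup M \<Omega> (dirichlet_domain M D E \<Omega>) E SD"

sublocale dirichlet_setting \<subseteq> F: form_semigroup M D E UNIV S
proof unfold_locales
  show "UNIV \<in> sets M" using sets.top[of M] by simp
  show "\<exists>u\<in>D. L2_norm M (\<lambda>x. f x - u x) < e" if "f \<in> L2_space M UNIV" "e > 0" for f e
    using dform that unfolding dirichlet_form_def densely_defined_def by blast
qed (use D_L2 assoc_S in auto)

sublocale dirichlet_setting \<subseteq> G: form_semigroup M "dirichlet_domain M D E \<Omega>" E \<Omega> SD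
proof unfold_locales
  show "positive_symmetric_form M (DD \<Omega>) E" by (rule DD_psform)
  show "closed_form M (DD \<Omega>) E" by (rule DD_closed_form)
  show "\<Omega> \<in> sets M" using open_Om by (rule sets_open)
  show "u \<in> L2_space M \<Omega>" if "u \<in> DD \<Omega>" for u using open_Om that by (rule DD_L2)
  show "\<exists>u\<in>DD \<Omega>. L2_norm M (\<lambda>x. f x - u x) < e" if "f \<in> L2_space M \<Omega>" "e > 0" for f e
    using open_Om that by (rule DD_dense)
qed (rule assoc_SD)

context dirichlet_setting
begin

text \<open>Dissipation for the difference of two orbits of different semigroups. No single form
  governs it, so the sign of the derivative stays a hypothesis; the square as \<open>\<Phi>\<close>
  gives equality of the semigroups, \<open>huber 1\<close> gives domination.\<close>

lemma difference_energy:
  assumes gauge: "quadratic_gauge \<Phi> p K"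
    and a: "generator M \<Omega> SD a ga" and b: "generator M UNIV S b gb"
    and sign: "\<And>s. s > 0 \<Longrightarrow> (\<integral>x. (SD s ga x - S s gb x) * p (SD s a x - S s b x) \<partial>M) \<le> 0"
    and t: "t \<ge> 0"
  shows "(\<integral>x. \<Phi> (SD t a x - S t b x) \<partial>M) \<le> (\<integral>x. \<Phi> (a x - b x) \<partial>M)"
proof -
  interpret quadratic_gauge \<Phi> p K by (rule gauge)
  have aV: "a \<in> L2_space M \<Omega>" "ga \<in> L2_space M \<Omega>" and bV: "b \<in> L2_space M UNIV" "gb \<in> L2_space M UNIV"
    using a b by (auto simp: generator_def)
  define w where "w s x = SD s a x - S s b x" for s x
  have wL: "w s \<in> L2_space M UNIV" if "s \<ge> 0" for s
    unfolding w_def using that aV bV by (intro L2.diff_mem G.S_U F.S_U)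
  have "(\<integral>x. \<Phi> (w t x) \<partial>M) \<le> (\<integral>x. \<Phi> (w 0 x) \<partial>M)"
  proof (rule energy_nonincreasing_halfline[where T = "t + 1" and w' = "\<lambda>s x. SD s ga x - S s gb x"])
    show "(\<lambda>x. SD s ga x - S s gb x) \<in> L2_space M UNIV" if "0 \<le> s" for s
      using that aV bV by (intro L2.diff_mem G.S_U F.S_U)
    show "L2_deriv M w (\<lambda>x. SD s ga x - S s gb x) s" if "0 < s" "s < t + 1" for s
      unfolding w_def using that aV bV
      by (intro L2_deriv_diff G.orbit_L2_deriv[OF a] F.orbit_L2_deriv[OF b] G.S_U F.S_U) auto
    show "((\<lambda>s. L2_norm M (\<lambda>x. w s x - w 0 x)) \<longlongrightarrow> 0) (at_right 0)"
    proof (rule Lim_null_comparison)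
      show "((\<lambda>s. L2_norm M (\<lambda>x. SD s a x - SD 0 a x) + L2_norm M (\<lambda>x. S s b x - S 0 b x)) \<longlongrightarrow> 0) (at_right 0)"
        using tendsto_add[OF G.S_cont_0[OF aV(1)] F.S_cont_0[OF bV(1)]] by simp
      show "\<forall>\<^sub>F s in at_right 0. norm (L2_norm M (\<lambda>x. w s x - w 0 x))
          \<le> L2_norm M (\<lambda>x. SD s a x - SD 0 a x) + L2_norm M (\<lambda>x. S s b x - S 0 b x)"
        using eventually_at_right_less[of "0::real"]
      proof eventually_elim
        case (elim s)
        have 1: "(\<lambda>x. SD s a x - SD 0 a x) \<in> L2_space M UNIV" "(\<lambda>x. S s b x - S 0 b x) \<in> L2_space M UNIV"
          using elim aV bV by (auto intro!: L2.diff_mem G.S_U F.S_U)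
        have "(\<lambda>x. w s x - w 0 x) = (\<lambda>x. (SD s a x - SD 0 a x) + (-1) * (S s b x - S 0 b x))"
          by (auto simp: w_def)
        then show ?case
          using L2_norm_triangle[OF 1(1) L2.scale_mem[OF 1(2), of "-1"]] unfolding L2_norm_scale by simp
      qed
    qed
    show "(\<integral>x. (SD s ga x - S s gb x) * p (w s x) \<partial>M) \<le> 0" if "0 < s" "s < t + 1" for s
      using sign[OF that(1)] by (simp add: w_def)
  qed (use wL t in auto)
  moreover have "(\<integral>x. \<Phi> (w 0 x) \<partial>M) = (\<integral>x. \<Phi> (a x - b x) \<partial>M)"
  proof (rule integral_cong_AE)
    show "(\<lambda>x. \<Phi> (w 0 x)) \<in> borel_measurable M" using L2_spaceD(1)[OF wL[OF order_refl]] by measurable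
    show "(\<lambda>x. \<Phi> (a x - b x)) \<in> borel_measurable M"
      using L2_spaceD(1)[OF aV(1)] L2_spaceD(1)[OF bV(1)] by measurable
    show "AE x in M. \<Phi> (w 0 x) = \<Phi> (a x - b x)"
      using G.S_0[OF aV(1)] F.S_0[OF bV(1)] by eventually_elim (simp add: w_def)
  qed
  ultimately show ?thesis by (simp add: w_def)
qed

text \<open>The test functions in \<open>ext\<close> range over \<open>D\<close> and not only over
  the Dirichlet domain, so both orbits of \<open>u\<close> solve the equation of \<open>H\<close>.
  Their difference starts at 0 and its squared norm decreases.\<close>

lemma semigroups_agree:
  assumes ext: "\<And>u g v. generator M \<Omega> SD u g \<Longrightarrow> v \<in> D \<Longrightarrow> E u v = - (\<integral>x. g x * v x \<partial>M)"
    and f: "f \<in> L2_space M \<Omega>" and t: "t \<ge> 0"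
  shows "AE x in M. S t f x = SD t f x"
proof -
  have gauge: "quadratic_gauge (\<lambda>s. s\<^sup>2) (\<lambda>s. 2 * s) 2"
    by unfold_locales (auto simp: power2_sum abs_mult)
  have agree: "L2_norm M (\<lambda>x. SD t u x - S t u x) \<le> 0" if u: "generator M \<Omega> SD u g" for u g
  proof -
    have uV: "u \<in> L2_space M \<Omega>" "g \<in> L2_space M \<Omega>" using u by (auto simp: generator_def)
    have "form_operator M UNIV D E u (\<lambda>x. - g x)"
      using ext[OF u] DD_D[OF G.generator_form(1)[OF u]] L2.uminus_mem[OF L2_space_UNIV[OF uV(2)]]
      by (simp add: form_operator_def)
    then have uS: "generator M UNIV S u g" by (simp add: F.form_operator_iff)
    have "(\<integral>x. (SD t u x - S t u x)\<^sup>2 \<partial>M) \<le> (\<integral>x. (u x - u x)\<^sup>2 \<partial>M)"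
    proof (rule difference_energy[OF gauge u uS _ t])
      fix s :: real assume s: "s > 0"
      have gD: "generator M \<Omega> SD (SD s u) (SD s g)" using s by (intro G.generator_orbit[OF u]) auto
      have gS: "generator M UNIV S (S s u) (S s g)" using s by (intro F.generator_orbit[OF uS]) auto
      note a = DD_D[OF G.generator_form(1)[OF gD]] and b = F.generator_form(1)[OF gS]
      define w where "w x = SD s u x - S s u x" for x
      have w: "w \<in> D" unfolding w_def using a b by (rule diff_mem)
      have L: "SD s g \<in> L2_space M UNIV" "S s g \<in> L2_space M UNIV"
        using uV s L2_space_UNIV by (auto intro!: G.S_U F.S_U)
      have "E w w = E (SD s u) w - E (S s u) w" using E_diff_left[OF a b w] by (simp add: w_def[abs_def])
      also have "\<dots> = - ((\<integral>x. SD s g x * w x \<partial>M) - (\<integral>x. S s g x * w x \<partial>M))"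
        using ext[OF gD w] F.generator_form(2)[OF gS w] by simp
      also have "(\<integral>x. SD s g x * w x \<partial>M) - (\<integral>x. S s g x * w x \<partial>M) = (\<integral>x. (SD s g x - S s g x) * w x \<partial>M)"
        using L2.E_diff_left[OF L D_L2[OF w]] by simp
      finally have "(\<integral>x. (SD s g x - S s g x) * w x \<partial>M) \<le> 0" using E_nonneg[OF w] by simp
      moreover have "(\<integral>x. (SD s g x - S s g x) * (2 * w x) \<partial>M) = 2 * (\<integral>x. (SD s g x - S s g x) * w x \<partial>M)"
        unfolding mult.left_commute[of _ 2] by simp
      ultimately have "(\<integral>x. (SD s g x - S s g x) * (2 * w x) \<partial>M) \<le> 0" by simp
      then show "(\<integral>x. (SD s g x - S s g x) * (2 * (SD s u x - S s u x)) \<partial>M) \<le> 0"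
        unfolding w_def .
    qed
    then show ?thesis by (simp add: L2_norm_def)
  qed
  have fU: "f \<in> L2_space M UNIV" using f by (rule L2_space_UNIV)
  show ?thesis
  proof (rule L2_eq_of_norm_le)
    show Sf: "S t f \<in> L2_space M UNIV" using t fU by (rule F.S_U)
    show SDf: "SD t f \<in> L2_space M UNIV" using t f by (rule G.S_U)
    fix e :: real assume e: "e > 0"
    obtain u g where u: "generator M \<Omega> SD u g" "L2_norm M (\<lambda>x. f x - u x) < e / 2"
      using G.generator_dense[OF f half_gt_zero[OF e]] by metis
    have uV: "u \<in> L2_space M \<Omega>" using u by (simp add: generator_def)
    have uU: "u \<in> L2_space M UNIV" using uV by (rule L2_space_UNIV)
    note Su = F.S_U[OF t uU] and SDu = G.S_U[OF t uV]
    have "L2_norm M (\<lambda>x. S t f x - SD t f x) \<le> L2_norm M (\<lambda>x. S t f x - S t u x) + L2_norm M (\<lambda>x. S t u x - SD t f x)"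
      using Sf Su SDf by (rule L2_norm_triangle_diff)
    moreover have "L2_norm M (\<lambda>x. S t u x - SD t f x) \<le> L2_norm M (\<lambda>x. S t u x - SD t u x) + L2_norm M (\<lambda>x. SD t u x - SD t f x)"
      using Su SDu SDf by (rule L2_norm_triangle_diff)
    moreover have "L2_norm M (\<lambda>x. S t u x - SD t u x) \<le> 0"
      using agree[OF u(1)] by (subst L2_norm_commute)
    moreover have "L2_norm M (\<lambda>x. S t f x - S t u x) < e / 2"
      using F.contractive_diff[OF fU uU t] u(2) by simp
    moreover have "L2_norm M (\<lambda>x. SD t u x - SD t f x) < e / 2"
      using G.contractive_diff[OF uV f t] u(2) L2_norm_commute[of M f u] by simp
    ultimately show "L2_norm M (\<lambda>x. S t f x - SD t f x) \<le> e" by linarith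
  qed
qed

section \<open>Positivity, contraction of mass and domination\<close>

lemma huber_decreasing:
  assumes f: "f \<in> L2_space M UNIV" and c: "c > 0" and t: "t \<ge> 0"
  shows "(\<integral>x. huber c (S t f x) \<partial>M) \<le> (\<integral>x. huber c (f x) \<partial>M)"
proof -
  interpret quadratic_gauge "huber c" "clip c" 1 using c by (rule huber_gauge)
  have gen: "(\<integral>x. huber c (S t u x) \<partial>M) \<le> (\<integral>x. huber c (u x) \<partial>M)" if u: "generator M UNIV S u g" for u g
  proof -
    have uV: "u \<in> L2_space M UNIV" "g \<in> L2_space M UNIV" using u by (auto simp: generator_def)
    have "(\<integral>x. huber c (S t u x) \<partial>M) \<le> (\<integral>x. huber c (S 0 u x) \<partial>M)"
    proof (rule energy_nonincreasing_halfline[where T = "t + 1" and w = "\<lambda>t. S t u" and w' = "\<lambda>t. S t g"])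
      \<comment> \<open>The derivative equals \<open>- E v (clip c v)\<close> at the orbit point
        \<open>v = S s u\<close>, with \<open>clip c v\<close> read pointwise;
        \<open>E_clip_nonneg\<close> gives the sign.\<close>
      show "(\<integral>x. S s g x * clip c (S s u x) \<partial>M) \<le> 0" if "0 < s" "s < t + 1" for s
      proof -
        have gs: "generator M UNIV S (S s u) (S s g)" using that by (intro F.generator_orbit[OF u]) auto
        note D = F.generator_form(1)[OF gs]
        show ?thesis using F.generator_form(2)[OF gs clip_mem(1)[OF D c]] E_clip_nonneg[OF D c] by simp
      qed
    qed (use uV t F.S_U F.S_cont_0 F.orbit_L2_deriv[OF u] in auto)
    also have "\<dots> = (\<integral>x. huber c (u x) \<partial>M)"
    proof (rule integral_cong_AE)
      show "(\<lambda>x. huber c (S 0 u x)) \<in> borel_measurable M" using F.S_meas[OF order_refl uV(1)] by measurable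
      show "(\<lambda>x. huber c (u x)) \<in> borel_measurable M" using L2_spaceD(1)[OF uV(1)] by measurable
      show "AE x in M. huber c (S 0 u x) = huber c (u x)" using F.S_0[OF uV(1)] by eventually_elim simp
    qed
    finally show ?thesis .
  qed
  show ?thesis
  proof (rule integral_le_by_approx[OF F.S_U[OF t f] f])
    fix e :: real assume "e > 0"
    then obtain u g where u: "generator M UNIV S u g" "L2_norm M (\<lambda>x. f x - u x) < e"
      using F.generator_dense[OF f] by metis
    have uV: "u \<in> L2_space M UNIV" using u by (auto simp: generator_def)
    have "L2_norm M (\<lambda>x. u x - f x) < e" using u(2) by (subst L2_norm_commute)
    moreover have "L2_norm M (\<lambda>x. S t u x - S t f x) < e"
      using F.contractive_diff[OF uV f t] calculation by simp
    ultimately show "\<exists>f' g'. f' \<in> L2_space M UNIV \<and> g' \<in> L2_space M UNIV \<and>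
      L2_norm M (\<lambda>x. f' x - S t f x) < e \<and> L2_norm M (\<lambda>x. g' x - f x) < e \<and>
      (\<integral>x. huber c (f' x) \<partial>M) \<le> (\<integral>x. huber c (g' x) \<partial>M)"
      using gen[OF u(1)] F.S_U[OF t uV] uV by blast
  qed
qed

lemma nonpos_of_huber:
  assumes f: "f \<in> L2_space M UNIV" and le: "(\<integral>x. huber 1 (f x) \<partial>M) \<le> 0"
  shows "AE x in M. f x \<le> 0"
proof -
  interpret quadratic_gauge "huber 1" "clip 1" 1 by (rule huber_gauge) simp
  have nn: "AE x in M. 0 \<le> huber 1 (f x)" by (simp add: huber_nonneg)
  have "(\<integral>x. huber 1 (f x) \<partial>M) = 0"
    using le integral_nonneg_AE[OF nn] by linarith
  then have "AE x in M. huber 1 (f x) = 0"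
    using integral_nonneg_eq_0_iff_AE[OF \<Phi>_integrable[OF f] nn] by blast
  then show ?thesis by eventually_elim (use huber_pos[of 1] in \<open>force simp: not_less[symmetric]\<close>)
qed

lemma S_nonneg:
  assumes f: "f \<in> L2_space M UNIV" and pos: "AE x in M. 0 \<le> f x" and t: "t \<ge> 0"
  shows "AE x in M. 0 \<le> S t f x"
proof -
  interpret op: L2_operator M UNIV "S t" using t by (rule F.op)
  have mf: "(\<lambda>x. (-1) * f x) \<in> L2_space M UNIV" using f by (rule L2.scale_mem)
  have "(\<integral>x. huber 1 (S t (\<lambda>x. (-1) * f x) x) \<partial>M) \<le> (\<integral>x. huber 1 ((-1) * f x) \<partial>M)"
    using mf t by (intro huber_decreasing) auto
  also have "AE x in M. huber 1 ((-1) * f x) = 0"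
    using pos by eventually_elim (simp add: huber_nonpos)
  then have "(\<integral>x. huber 1 ((-1) * f x) \<partial>M) = 0" by (rule integral_eq_zero_AE)
  finally have "AE x in M. S t (\<lambda>x. (-1) * f x) x \<le> 0"
    by (rule nonpos_of_huber[OF F.S_U[OF t mf]])
  then show ?thesis using op.T_scale[OF f, of "-1"] by eventually_elim simp
qed

text \<open>Integrability of \<open>S t f\<close> is not known beforehand. The rescaled functions
  \<open>huber (1 / (n + 1))\<close> are integrable along the orbit, their integrals do not increase
  in time, and initially they lie below that of \<open>f\<close> by \<open>huber_le\<close>; Fatou's
  lemma lets \<open>n\<close> grow.\<close>

lemma S_L1:
  assumes f: "f \<in> L2_space M UNIV" and pos: "AE x in M. 0 \<le> f x" and int: "integrable M f" and t: "t \<ge> 0"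
  shows "integrable M (S t f)" "(\<integral>x. S t f x \<partial>M) \<le> (\<integral>x. f x \<partial>M)"
proof -
  note Sm = F.S_meas[OF t f] and SU = F.S_U[OF t f]
  have Spos: "AE x in M. 0 \<le> S t f x" using f pos t by (rule S_nonneg)
  have bound: "(\<integral>\<^sup>+x. ennreal (real (Suc n) * huber (1 / Suc n) (S t f x)) \<partial>M) \<le> ennreal (\<integral>x. f x \<partial>M)" for n :: nat
  proof -
    define c where "c = 1 / real (Suc n)"
    have c: "c > 0" "real (Suc n) = 1 / c" by (auto simp: c_def)
    interpret quadratic_gauge "huber c" "clip c" 1 using c(1) by (rule huber_gauge)
    have "(\<integral>\<^sup>+x. ennreal (real (Suc n) * huber c (S t f x)) \<partial>M) = ennreal (\<integral>x. real (Suc n) * huber c (S t f x) \<partial>M)"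
      using \<Phi>_integrable[OF SU] huber_nonneg[OF c(1)]
      by (intro nn_integral_eq_integral AE_I2 mult_nonneg_nonneg integrable_mult_right) auto
    also have "\<dots> \<le> ennreal (\<integral>x. f x \<partial>M)"
    proof (rule ennreal_leI)
      have "(\<integral>x. huber c (S t f x) \<partial>M) \<le> (\<integral>x. huber c (f x) \<partial>M)" using f c(1) t by (rule huber_decreasing)
      also have "\<dots> \<le> (\<integral>x. c * f x \<partial>M)"
        using \<Phi>_integrable[OF f] int pos by (intro integral_mono_AE) (auto intro: huber_le[OF c(1)])
      finally show "(\<integral>x. real (Suc n) * huber c (S t f x) \<partial>M) \<le> (\<integral>x. f x \<partial>M)"
        unfolding c(2) using c(1) by (simp add: field_simps)
    qed
    finally show ?thesis by (simp add: c_def)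
  qed
  have hm: "(\<lambda>x. huber c (S t f x)) \<in> borel_measurable M" for c
    unfolding huber_def using Sm by measurable
  have "(\<integral>\<^sup>+x. ennreal (S t f x) \<partial>M) = (\<integral>\<^sup>+x. liminf (\<lambda>n. ennreal (real (Suc n) * huber (1 / Suc n) (S t f x))) \<partial>M)"
  proof (rule nn_integral_cong_AE)
    show "AE x in M. ennreal (S t f x) = liminf (\<lambda>n. ennreal (real (Suc n) * huber (1 / Suc n) (S t f x)))"
      using Spos
    proof eventually_elim
      case (elim x)
      then have "(\<lambda>n. ennreal (real (Suc n) * huber (1 / Suc n) (S t f x))) \<longlonglongrightarrow> ennreal (S t f x)"
        by (intro tendsto_ennrealI huber_tendsto)
      then show ?case by (rule lim_imp_Liminf[OF trivial_limit_sequentially, symmetric])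
    qed
  qed
  also have "\<dots> \<le> liminf (\<lambda>n. \<integral>\<^sup>+x. ennreal (real (Suc n) * huber (1 / Suc n) (S t f x)) \<partial>M)"
    by (intro nn_integral_liminf measurable_compose[OF _ measurable_ennreal] borel_measurable_times
      borel_measurable_const hm)
  also have "\<dots> \<le> liminf (\<lambda>n::nat. ennreal (\<integral>x. f x \<partial>M))"
    using bound by (intro Liminf_mono always_eventually allI)
  also have "\<dots> = ennreal (\<integral>x. f x \<partial>M)" by (simp add: Liminf_const)
  finally have le: "(\<integral>\<^sup>+x. ennreal (S t f x) \<partial>M) \<le> ennreal (\<integral>x. f x \<partial>M)" .
  then show i: "integrable M (S t f)"
    using Sm Spos by (intro integrableI_nonneg) (auto intro: le_less_trans)
  have "0 \<le> (\<integral>x. f x \<partial>M)" using pos by (rule integral_nonneg_AE)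
  then show "(\<integral>x. S t f x \<partial>M) \<le> (\<integral>x. f x \<partial>M)"
    using le nn_integral_eq_integral[OF i Spos] by simp
qed

text \<open>Domination needs initial data that are nonnegative and lie in the generator domain. They
  arise as resolvents of a nonnegative \<open>z\<close> in \<open>D\<close>, and the proof shows
  that the resolvent preserves positivity by testing with the truncated negative part
  \<open>c\<close> of \<open>r\<close>.\<close>

lemma nonneg_generator_dense:
  assumes f: "f \<in> L2_space M UNIV" and pos: "AE x in M. 0 \<le> f x" and e: "e > 0"
  obtains u g where "generator M UNIV S u g" "AE x in M. 0 \<le> u x" "L2_norm M (\<lambda>x. f x - u x) < e"
proof -
  obtain v where v: "v \<in> D" "L2_norm M (\<lambda>x. f x - v x) < e / 2" using F.D_dense[OF f, of "e/2"] e by auto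
  define z where "z x = max 0 (v x)" for x
  have z: "z \<in> D" unfolding z_def[abs_def] using v(1) by (rule pos_part_mem)
  have "L2_norm M (\<lambda>x. f x - z x) \<le> L2_norm M (\<lambda>x. f x - v x)"
  proof (rule L2_norm_mono)
    show "(\<lambda>x. f x - v x) \<in> L2_space M UNIV" using f D_L2[OF v(1)] by (rule L2.diff_mem)
    show "(\<lambda>x. f x - z x) \<in> borel_measurable M" using L2_spaceD(1)[OF f] D_meas[OF z] by simp
    show "AE x in M. \<bar>f x - z x\<bar> \<le> \<bar>f x - v x\<bar>" using pos by eventually_elim (auto simp: z_def)
  qed
  then have fz: "L2_norm M (\<lambda>x. f x - z x) < e / 2" using v(2) by simp
  obtain l r where l: "l \<ge> 1" and r: "form_operator M UNIV D E r (\<lambda>x. l * (z x - r x))" "L2_norm M (\<lambda>x. z x - r x) < e / 2"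
    using F.resolvent_near[OF z half_gt_zero[OF e]] by metis
  have rD: "r \<in> D" using r(1) by (simp add: form_operator_def)
  have mr: "(\<lambda>x. - r x) \<in> D" using rD by (rule uminus_mem)
  define c where "c x = clip 1 (- r x)" for x
  have c: "c \<in> D" unfolding c_def[abs_def] using mr by (rule clip_mem) simp
  have zr: "(\<lambda>x. z x - r x) \<in> D" using z rD by (rule diff_mem)
  have int: "integrable M (\<lambda>x. (z x - r x) * c x)" using D_L2[OF zr] D_L2[OF c] by (rule integrable_mult_L2)
  have "0 \<le> E (\<lambda>x. - r x) c" unfolding c_def[abs_def] by (rule E_clip_nonneg[OF mr]) simp
  then have "E r c \<le> 0" using E_uminus_left[OF rD c] by simp
  moreover have "E r c = l * (\<integral>x. (z x - r x) * c x \<partial>M)"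
    using r(1) c by (simp add: form_operator_def mult.assoc)
  ultimately have "(\<integral>x. (z x - r x) * c x \<partial>M) \<le> 0" using l by (simp add: mult_le_0_iff)
  \<comment> \<open>Where \<open>c > 0\<close>, both \<open>- r \<ge> c\<close> and
    \<open>z \<ge> 0\<close> hold. Together with the nonpositive integral just obtained, this forces
    \<open>c = 0\<close>.\<close>
  moreover have ge: "(c x)\<^sup>2 \<le> (z x - r x) * c x" for x
  proof -
    have "0 \<le> c x" "0 < c x \<Longrightarrow> c x \<le> - r x" "0 \<le> z x" by (auto simp: c_def clip_def z_def)
    then have "c x * c x \<le> (z x - r x) * c x" by (cases "c x = 0") (auto intro!: mult_right_mono)
    then show ?thesis by (simp add: power2_eq_square)
  qed
  moreover have nn: "AE x in M. 0 \<le> (z x - r x) * c x" using ge by (intro AE_I2 order_trans[OF _ ge]) simp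
  ultimately have "(\<integral>x. (z x - r x) * c x \<partial>M) = 0" using integral_nonneg_AE[OF nn] by linarith
  then have "AE x in M. (z x - r x) * c x = 0" using integral_nonneg_eq_0_iff_AE[OF int nn] by blast
  then have "AE x in M. 0 \<le> r x"
  proof eventually_elim
    case (elim x)
    then have "(c x)\<^sup>2 \<le> 0" using ge[of x] by linarith
    then have "c x = 0" by simp
    then show ?case by (auto simp: c_def clip_def min_def max_def split: if_splits)
  qed
  moreover have "generator M UNIV S r (\<lambda>x. - (l * (z x - r x)))" using r(1) by (simp add: F.form_operator_iff)
  moreover have "L2_norm M (\<lambda>x. f x - r x) < e"
    using L2_norm_triangle_diff[OF f D_L2[OF z] D_L2[OF rD]] fz r(2) by linarith
  ultimately show thesis using that by blast
qed

text \<open>The positive part of \<open>SD t f - S t f\<close> lies below that of \<open>SD t f\<close>, so it is an admissible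
  test function for both forms by \<open>DD_ideal\<close>.\<close>

lemma domination:
  assumes f: "f \<in> L2_space M \<Omega>" and pos: "AE x in M. 0 \<le> f x" and t: "t \<ge> 0"
  shows "AE x in M. SD t f x \<le> S t f x"
proof -
  have gauge: "quadratic_gauge (huber 1) (clip 1) 1" by (rule huber_gauge) simp
  interpret quadratic_gauge "huber 1" "clip 1" 1 by (rule gauge)
  have fU: "f \<in> L2_space M UNIV" using f by (rule L2_space_UNIV)
  note Sf = F.S_U[OF t fU] and SDf = G.S_U[OF t f]
  \<comment> \<open>The right-hand side is 0 but is kept in this form: \<open>f\<close> is
    approximated by \<open>a\<close> in one generator domain and by \<open>b\<close> in the other,
    and the comparison of orbits then has \<open>a - b\<close> as its initial value.\<close>
  have "(\<integral>x. huber 1 (SD t f x - S t f x) \<partial>M) \<le> (\<integral>x. huber 1 (f x - f x) \<partial>M)"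
  proof (rule integral_le_by_approx)
    show "(\<lambda>x. SD t f x - S t f x) \<in> L2_space M UNIV" using SDf Sf by (rule L2.diff_mem)
    show "(\<lambda>x. f x - f x) \<in> L2_space M UNIV" using fU fU by (rule L2.diff_mem)
    fix e :: real assume e: "e > 0"
    obtain a ga where a: "generator M \<Omega> SD a ga" "L2_norm M (\<lambda>x. f x - a x) < e / 2"
      using G.generator_dense[OF f half_gt_zero[OF e]] by metis
    obtain b gb where b: "generator M UNIV S b gb" "AE x in M. 0 \<le> b x" "L2_norm M (\<lambda>x. f x - b x) < e / 2"
      using nonneg_generator_dense[OF fU pos half_gt_zero[OF e]] by metis
    have aV: "a \<in> L2_space M \<Omega>" "ga \<in> L2_space M \<Omega>" and bU: "b \<in> L2_space M UNIV" "gb \<in> L2_space M UNIV"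
      using a b by (auto simp: generator_def)
    have aU: "a \<in> L2_space M UNIV" using aV(1) by (rule L2_space_UNIV)
    note Sb = F.S_U[OF t bU(1)] and SDa = G.S_U[OF t aV(1)]
    have "(\<integral>x. huber 1 (SD t a x - S t b x) \<partial>M) \<le> (\<integral>x. huber 1 (a x - b x) \<partial>M)"
    proof (rule difference_energy[OF gauge a(1) b(1) _ t])
      fix s :: real assume s: "s > 0"
      have gD: "generator M \<Omega> SD (SD s a) (SD s ga)" using s by (intro G.generator_orbit[OF a(1)]) auto
      have gS: "generator M UNIV S (S s b) (S s gb)" using s by (intro F.generator_orbit[OF b(1)]) auto
      note aD = G.generator_form(1)[OF gD] and bD = F.generator_form(1)[OF gS]
      define w where "w x = SD s a x - S s b x" for x
      have w: "w \<in> D" unfolding w_def using DD_D[OF aD] bD by (rule diff_mem)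
      define z where "z x = clip 1 (w x)" for x
      have z: "z \<in> D" unfolding z_def[abs_def] using w by (rule clip_mem) simp
      have "AE x in M. 0 \<le> S s b x" using bU(1) b(2) s by (intro S_nonneg) auto
      then have "AE x in M. 0 \<le> z x \<and> z x \<le> max 0 (SD s a x)"
        by eventually_elim (auto simp: z_def w_def clip_def)
      then have zD: "z \<in> DD \<Omega>" by (rule DD_ideal[OF z aD])
      have L: "SD s ga \<in> L2_space M UNIV" "S s gb \<in> L2_space M UNIV"
        using aV bU s by (auto intro!: G.S_U F.S_U)
      have "0 \<le> E w z" unfolding z_def[abs_def] by (rule E_clip_nonneg[OF w]) simp
      also have "E w z = E (SD s a) z - E (S s b) z" using E_diff_left[OF DD_D[OF aD] bD z] by (simp add: w_def[abs_def])
      also have "\<dots> = - ((\<integral>x. SD s ga x * z x \<partial>M) - (\<integral>x. S s gb x * z x \<partial>M))"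
        using G.generator_form(2)[OF gD zD] F.generator_form(2)[OF gS z] by simp
      also have "(\<integral>x. SD s ga x * z x \<partial>M) - (\<integral>x. S s gb x * z x \<partial>M) = (\<integral>x. (SD s ga x - S s gb x) * z x \<partial>M)"
        using L2.E_diff_left[OF L D_L2[OF z]] by simp
      finally show "(\<integral>x. (SD s ga x - S s gb x) * clip 1 (SD s a x - S s b x) \<partial>M) \<le> 0"
        by (simp add: z_def w_def)
    qed
    moreover have "L2_norm M (\<lambda>x. (SD t a x - S t b x) - (SD t f x - S t f x)) < e"
    proof -
      have "(\<lambda>x. (SD t a x - S t b x) - (SD t f x - S t f x)) = (\<lambda>x. (SD t a x - SD t f x) + (S t f x - S t b x))"
        by auto
      then have "L2_norm M (\<lambda>x. (SD t a x - S t b x) - (SD t f x - S t f x))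
          \<le> L2_norm M (\<lambda>x. SD t a x - SD t f x) + L2_norm M (\<lambda>x. S t f x - S t b x)"
        using L2_norm_triangle[OF L2.diff_mem[OF SDa SDf] L2.diff_mem[OF Sf Sb]] by simp
      then show ?thesis
        using G.contractive_diff[OF aV(1) f t] F.contractive_diff[OF fU bU(1) t] a(2) b(3) L2_norm_commute[of M a f]
        by linarith
    qed
    moreover have "L2_norm M (\<lambda>x. (a x - b x) - (f x - f x)) < e"
    proof -
      have "(\<lambda>x. (a x - b x) - (f x - f x)) = (\<lambda>x. a x - b x)" by auto
      then show ?thesis
        using L2_norm_triangle_diff[OF aU fU bU(1)] a(2) b(3) L2_norm_commute[of M a f] by simp
    qed
    ultimately show "\<exists>f' g'. f' \<in> L2_space M UNIV \<and> g' \<in> L2_space M UNIV \<and>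
        L2_norm M (\<lambda>x. f' x - (SD t f x - S t f x)) < e \<and> L2_norm M (\<lambda>x. g' x - (f x - f x)) < e \<and>
        (\<integral>x. huber 1 (f' x) \<partial>M) \<le> (\<integral>x. huber 1 (g' x) \<partial>M)"
      using L2.diff_mem[OF SDa Sb] L2.diff_mem[OF aU bU(1)]
      by (intro exI[of _ "\<lambda>x. SD t a x - S t b x"] exI[of _ "\<lambda>x. a x - b x"]) blast
  qed
  then have "(\<integral>x. huber 1 (SD t f x - S t f x) \<partial>M) \<le> 0" by (simp add: huber_nonpos)
  from nonpos_of_huber[OF L2.diff_mem[OF SDf Sf] this] show ?thesis by simp
qed

end

section \<open>Conservation, invariance and capacity\<close>

context dirichlet_setting
begin

section \<open>From I to II by conservation of mass\<close>

lemma Om_sets: "\<Omega> \<in> sets M"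
  using open_Om by (rule sets_open)

text \<open>The masses form a closed chain: duality with the indicator of \<open>\<Omega>\<close>
  gives equal mass for \<open>f\<close> and \<open>SD t f\<close>, domination gives no less for
  \<open>S t f\<close>, and contraction gives no more than for \<open>f\<close>. So the nonnegative
  difference has integral 0.\<close>

lemma agree_integrable:
  assumes cons: "conservative M \<Omega> SD" and t: "t > 0"
    and f: "f \<in> L2_space M \<Omega>" and pos: "AE x in M. 0 \<le> f x" and int: "integrable M f"
  shows "AE x in M. S t f x = SD t f x"
proof -
  have t0: "t \<ge> 0" using t by simp
  have fU: "f \<in> L2_space M UNIV" using f by (rule L2_space_UNIV)
  have f1: "f \<in> L1_space M \<Omega>" using int L2_spaceD(3)[OF f] by (simp add: L1_space_def)
  obtain T where Text: "Linf_extension M \<Omega> (SD t) T"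
    and one: "AE x in M. T (indicat_real \<Omega>) x = indicat_real \<Omega> x"
    using cons t unfolding conservative_def by blast
  obtain T1 where T1: "L1_extension M \<Omega> (SD t) T1"
    and T: "\<And>g. g \<in> Linf_space M \<Omega> \<Longrightarrow> T g \<in> Linf_space M \<Omega>"
      "\<And>g h. g \<in> Linf_space M \<Omega> \<Longrightarrow> h \<in> L1_space M \<Omega> \<Longrightarrow> (\<integral>x. T g x * h x \<partial>M) = (\<integral>x. g x * T1 h x \<partial>M)"
    using Text unfolding Linf_extension_def by blast
  have ind: "indicat_real \<Omega> \<in> Linf_space M \<Omega>"
    unfolding Linf_space_def using Om_sets by (auto simp: indicator_def intro!: exI[of _ 1])
  have T1f: "T1 f \<in> L1_space M \<Omega>" "AE x in M. T1 f x = SD t f x"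
    using T1 f1 f unfolding L1_extension_def bounded_operator_def by auto
  have fm: "f \<in> borel_measurable M" and T1m: "T1 f \<in> borel_measurable M" and SDm: "SD t f \<in> borel_measurable M"
    using int T1f(1) G.S_meas[OF t0 f] by (auto simp: L1_space_def)
  have SDint: "integrable M (SD t f)"
    using T1f integrable_cong_AE[OF T1m SDm T1f(2)] by (simp add: L1_space_def)
  have "(\<integral>x. f x \<partial>M) = (\<integral>x. T (indicat_real \<Omega>) x * f x \<partial>M)"
  proof (rule integral_cong_AE)
    show "AE x in M. f x = T (indicat_real \<Omega>) x * f x"
      using one L2_spaceD(3)[OF f] by eventually_elim (auto simp: indicator_def)
    show "(\<lambda>x. T (indicat_real \<Omega>) x * f x) \<in> borel_measurable M"
      using T(1)[OF ind] fm unfolding Linf_space_def by (intro borel_measurable_times) blast+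
  qed (rule fm)
  also have "\<dots> = (\<integral>x. indicat_real \<Omega> x * T1 f x \<partial>M)" by (rule T(2)[OF ind f1])
  also have "\<dots> = (\<integral>x. SD t f x \<partial>M)"
  proof (rule integral_cong_AE)
    show "(\<lambda>x. indicat_real \<Omega> x * T1 f x) \<in> borel_measurable M" using T1m Om_sets by simp
    show "AE x in M. indicat_real \<Omega> x * T1 f x = SD t f x"
      using T1f(2) L2_spaceD(3)[OF G.S_mem[OF t0 f]] by eventually_elim (auto simp: indicator_def)
  qed (rule SDm)
  finally have eq: "(\<integral>x. f x \<partial>M) = (\<integral>x. SD t f x \<partial>M)" .
  note S1 = S_L1[OF fU pos int t0]
  have nn: "AE x in M. 0 \<le> S t f x - SD t f x" using domination[OF f pos t0] by eventually_elim simp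
  have int': "integrable M (\<lambda>x. S t f x - SD t f x)" using S1(1) SDint by (rule Bochner_Integration.integrable_diff)
  have "(\<integral>x. S t f x - SD t f x \<partial>M) \<le> 0" using S1 SDint eq by simp
  then have "(\<integral>x. S t f x - SD t f x \<partial>M) = 0" using integral_nonneg_AE[OF nn] by linarith
  then have "AE x in M. S t f x - SD t f x = 0" using integral_nonneg_eq_0_iff_AE[OF int' nn] by blast
  then show ?thesis by eventually_elim simp
qed

lemma agree_closed:
  assumes f: "f \<in> L2_space M \<Omega>" and t: "t \<ge> 0"
    and approx: "\<And>e. e > 0 \<Longrightarrow> \<exists>u\<in>L2_space M \<Omega>. L2_norm M (\<lambda>x. u x - f x) < e \<and> (AE x in M. S t u x = SD t u x)"
  shows "AE x in M. S t f x = SD t f x"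
proof (rule L2_eq_of_norm_le)
  have fU: "f \<in> L2_space M UNIV" using f by (rule L2_space_UNIV)
  show Sf: "S t f \<in> L2_space M UNIV" using t fU by (rule F.S_U)
  show SDf: "SD t f \<in> L2_space M UNIV" using t f by (rule G.S_U)
  fix e :: real assume "e > 0"
  then obtain u where u: "u \<in> L2_space M \<Omega>" "L2_norm M (\<lambda>x. u x - f x) < e / 2" "AE x in M. S t u x = SD t u x"
    using approx[of "e/2"] by auto
  have uU: "u \<in> L2_space M UNIV" using u(1) by (rule L2_space_UNIV)
  note Su = F.S_U[OF t uU] and SDu = G.S_U[OF t u(1)]
  have "L2_norm M (\<lambda>x. S t u x - SD t f x) = L2_norm M (\<lambda>x. SD t u x - SD t f x)"
    using u(3) L2_spaceD(1)[OF Su] L2_spaceD(1)[OF SDu] L2_spaceD(1)[OF SDf] by (intro L2_norm_cong) auto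
  then show "L2_norm M (\<lambda>x. S t f x - SD t f x) \<le> e"
    using L2_norm_triangle_diff[OF Sf Su SDf] F.contractive_diff[OF fU uU t] G.contractive_diff[OF u(1) f t] u(2)
      L2_norm_commute[of M u f] by linarith
qed

lemma conservative_imp_agree:
  assumes cons: "conservative M \<Omega> SD" and t: "t > 0" and f: "f \<in> L2_space M \<Omega>"
  shows "AE x in M. S t f x = SD t f x"
proof -
  have t0: "t \<ge> 0" using t by simp
  have nonneg: "AE x in M. S t h x = SD t h x" if h: "h \<in> L2_space M \<Omega>" and pos: "\<And>x. 0 \<le> h x" for h
  proof (rule agree_closed[OF h t0])
    fix e :: real assume e: "e > 0"
    have hm: "h \<in> borel_measurable M" using h by (rule L2_spaceD)
    \<comment> \<open>Small values are cut off: where \<open>h x \<ge> 1 / (n + 1)\<close> one has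
      \<open>h x \<le> (n + 1) * (h x)\<^sup>2\<close>, which makes \<open>k n\<close> integrable
      over a space of possibly infinite measure.\<close>
    define k where "k n x = (if 1 / real (Suc n) \<le> h x then h x else 0)" for n x
    have km: "k n \<in> borel_measurable M" for n unfolding k_def using hm by measurable
    have kL: "k n \<in> L2_space M \<Omega>" for n
    proof -
      have "k n \<in> L2_space M UNIV" using km by (intro L2_space_bound[OF L2_space_UNIV[OF h]]) (auto simp: k_def)
      moreover have "AE x in M. x \<notin> \<Omega> \<longrightarrow> k n x = 0" using L2_spaceD(3)[OF h] by eventually_elim (auto simp: k_def)
      ultimately show ?thesis using L2_space_restrict by blast
    qed
    have kint: "integrable M (k n)" for n
    proof (rule Bochner_Integration.integrable_bound)
      show "integrable M (\<lambda>x. real (Suc n) * (h x)\<^sup>2)" using L2_spaceD(2)[OF h] by simp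
      have "k n x \<le> real (Suc n) * (h x)\<^sup>2" for x
      proof (cases "1 / real (Suc n) \<le> h x")
        case True
        then have "1 \<le> real (Suc n) * h x" by (simp add: field_simps)
        then have "1 * h x \<le> (real (Suc n) * h x) * h x" using pos by (intro mult_right_mono)
        then show ?thesis using True by (simp add: k_def power2_eq_square mult.assoc)
      qed (simp add: k_def)
      moreover have "0 \<le> k n x" for x using pos by (simp add: k_def)
      ultimately show "AE x in M. norm (k n x) \<le> norm (real (Suc n) * (h x)\<^sup>2)" by simp
    qed (rule km)
    have "(\<lambda>n. L2_norm M (\<lambda>x. k n x - h x)) \<longlonglongrightarrow> 0"
    proof (rule L2_norm_dominated[OF L2_space_UNIV[OF h] hm km])
      show "AE x in M. (\<lambda>n. k n x) \<longlonglongrightarrow> h x"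
      proof (rule AE_I2)
        fix x
        show "(\<lambda>n. k n x) \<longlonglongrightarrow> h x"
        proof (cases "h x = 0")
          case True
          then show ?thesis by (simp add: k_def)
        next
          case False
          then have "h x > 0" using pos[of x] by simp
          then have "\<forall>\<^sub>F n in sequentially. 1 / real (Suc n) < h x"
            using order_tendstoD(2)[OF LIMSEQ_Suc[OF lim_1_over_n]] by blast
          then have "\<forall>\<^sub>F n in sequentially. k n x = h x" by eventually_elim (simp add: k_def)
          then show ?thesis by (rule tendsto_eventually)
        qed
      qed
    qed (auto simp: k_def)
    then obtain n where "L2_norm M (\<lambda>x. k n x - h x) < e"
      using eventually_happens[OF order_tendstoD(2)[OF _ e]] by force
    moreover have "AE x in M. S t (k n) x = SD t (k n) x"
      using pos by (intro agree_integrable[OF cons t kL _ kint]) (auto simp: k_def)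
    ultimately show "\<exists>u\<in>L2_space M \<Omega>. L2_norm M (\<lambda>x. u x - h x) < e \<and> (AE x in M. S t u x = SD t u x)"
      using kL by blast
  qed
  have part: "(\<lambda>x. max 0 (c * f x)) \<in> L2_space M \<Omega>" for c
  proof -
    have cf: "(\<lambda>x. c * f x) \<in> L2_space M \<Omega>" using f by (rule L2.scale_mem)
    have "(\<lambda>x. max 0 (c * f x)) \<in> L2_space M UNIV"
      using L2_spaceD(1)[OF cf] by (intro L2_space_bound[OF L2_space_UNIV[OF cf]]) auto
    moreover have "AE x in M. x \<notin> \<Omega> \<longrightarrow> max 0 (c * f x) = 0"
      using L2_spaceD(3)[OF f] by eventually_elim auto
    ultimately show ?thesis using L2_space_restrict by blast
  qed
  define a where "a x = max 0 (1 * f x)" for x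
  define b where "b x = max 0 ((-1) * f x)" for x
  have a: "a \<in> L2_space M \<Omega>" and b: "b \<in> L2_space M \<Omega>" unfolding a_def b_def by (rule part)+
  have f_eq: "f = (\<lambda>x. a x - b x)" by (auto simp: a_def b_def)
  have "AE x in M. S t a x = SD t a x" "AE x in M. S t b x = SD t b x"
    using a b by (auto intro!: nonneg simp: a_def b_def)
  moreover have "AE x in M. S t f x = S t a x - S t b x"
    unfolding f_eq using L2_operator.T_diff[OF F.op[OF t0]] a b L2_space_UNIV by blast
  moreover have "AE x in M. SD t f x = SD t a x - SD t b x"
    unfolding f_eq using L2_operator.T_diff[OF G.op[OF t0]] a b by blast
  ultimately show ?thesis by eventually_elim simp
qed

section \<open>From II to membership of the restrictions to \<Omega> in the Dirichlet domain\<close>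

lemma indicator_L2:
  assumes "v \<in> L2_space M UNIV"
  shows "(\<lambda>x. indicat_real \<Omega> x * v x) \<in> L2_space M \<Omega>"
proof -
  have "(\<lambda>x. indicat_real \<Omega> x * v x) \<in> L2_space M UNIV"
    using L2_spaceD(1)[OF assms] Om_sets by (intro L2_space_bound[OF assms]) (auto simp: indicator_def)
  moreover have "AE x in M. x \<notin> \<Omega> \<longrightarrow> indicat_real \<Omega> x * v x = 0" by (intro AE_I2) (simp add: indicator_def)
  ultimately show ?thesis using L2_space_restrict by blast
qed

text \<open>Difference quotients involve only times \<open>t > 0\<close>, where both semigroups
  coincide on \<open>\<Omega>\<close>. The generator of \<open>SD\<close> is thus part of that of
  \<open>S\<close>, and test functions from all of \<open>D\<close> become admissible.\<close>

lemma agree_generator: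
  assumes agree: "\<And>f t. f \<in> L2_space M \<Omega> \<Longrightarrow> t > 0 \<Longrightarrow> AE x in M. S t f x = SD t f x"
    and gen: "generator M \<Omega> SD u g" and v: "v \<in> D"
  shows "E u v = - (\<integral>x. g x * v x \<partial>M)"
proof -
  have u: "u \<in> L2_space M \<Omega>" and g: "g \<in> L2_space M \<Omega>"
    and lim: "((\<lambda>t. L2_norm M (\<lambda>x. (SD t u x - u x) / t - g x)) \<longlongrightarrow> 0) (at_right 0)"
    using gen by (auto simp: generator_def)
  have uU: "u \<in> L2_space M UNIV" and gU: "g \<in> L2_space M UNIV" using u g L2_space_UNIV by auto
  have "((\<lambda>t. L2_norm M (\<lambda>x. (S t u x - u x) / t - g x)) \<longlongrightarrow> 0) (at_right 0)"
  proof (rule Lim_transform_eventually[OF lim])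
    show "\<forall>\<^sub>F t in at_right 0. L2_norm M (\<lambda>x. (SD t u x - u x) / t - g x) = L2_norm M (\<lambda>x. (S t u x - u x) / t - g x)"
      using eventually_at_right_less[of "0::real"]
    proof eventually_elim
      case (elim t)
      have "AE x in M. S t u x = SD t u x" using u elim by (rule agree)
      then show ?case
        using G.S_meas[of t u] F.S_meas[of t u] elim u uU L2_spaceD(1)[OF u] L2_spaceD(1)[OF g]
        by (intro L2_norm_cong) auto
    qed
  qed
  then have "generator M UNIV S u g" using uU gU by (simp add: generator_def)
  then show ?thesis using v by (rule F.generator_form)
qed

lemma agree_indicator_mem:
  assumes agree: "\<And>f t. f \<in> L2_space M \<Omega> \<Longrightarrow> t > 0 \<Longrightarrow> AE x in M. S t f x = SD t f x"
    and v: "v \<in> D"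
  shows "(\<lambda>x. indicat_real \<Omega> x * v x) \<in> DD \<Omega>"
proof -
  define f where "f x = indicat_real \<Omega> x * v x" for x
  have f: "f \<in> L2_space M \<Omega>" unfolding f_def by (rule indicator_L2[OF D_L2[OF v]])
  have fU: "f \<in> L2_space M UNIV" using f by (rule L2_space_UNIV)
  have "f \<in> DD \<Omega>"
  proof (rule DD_bounded_energy_limit[OF fU])
    fix e :: real assume e: "e > 0"
    \<comment> \<open>The added 1 makes the inequality \<open>E v v < l * e\<^sup>2\<close>
      strict.\<close>
    define l where "l = max 1 ((E v v + 1) / e\<^sup>2)"
    have l: "l \<ge> 1" "E v v < l * e\<^sup>2"
    proof -
      have "(E v v + 1) / e\<^sup>2 \<le> l" by (simp add: l_def)
      then have "E v v + 1 \<le> l * e\<^sup>2" using e by (simp add: pos_divide_le_eq)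
      then show "E v v < l * e\<^sup>2" by simp
    qed (simp add: l_def)
    obtain r where r: "r \<in> DD \<Omega>" "\<And>w. w \<in> DD \<Omega> \<Longrightarrow> E r w = (\<integral>x. (l * (f x - r x)) * w x \<partial>M)"
      using G.resolvent_exists[OF l(1) fU] by blast
    have rD: "r \<in> D" using r(1) by (rule DD_D)
    have rV: "r \<in> L2_space M \<Omega>" using r(1) by (rule G.D_sub)
    have fr: "(\<lambda>x. f x - r x) \<in> L2_space M \<Omega>" using f rV by (rule L2.diff_mem)
    have "form_operator M \<Omega> (DD \<Omega>) E r (\<lambda>x. l * (f x - r x))"
      using r L2.scale_mem[OF fr] by (simp add: form_operator_def)
    then have gen: "generator M \<Omega> SD r (\<lambda>x. - (l * (f x - r x)))" by (simp add: G.form_operator_iff)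
    have vr: "(\<lambda>x. v x - r x) \<in> D" using v rD by (rule diff_mem)
    \<comment> \<open>Condition II allows the test function \<open>v - r\<close>, which lies in
      \<open>D\<close> but perhaps not in the Dirichlet domain. As \<open>f - r\<close> lives on
      \<open>\<Omega>\<close>, where \<open>v = f\<close>, the right-hand side is \<open>l\<close>
      times the squared distance of \<open>f\<close> and \<open>r\<close>; both the energy bound and
      the convergence are read off from this identity.\<close>
    have "E r (\<lambda>x. v x - r x) = (\<integral>x. (l * (f x - r x)) * (v x - r x) \<partial>M)"
      using agree_generator[OF agree gen vr] by simp
    also have "\<dots> = (\<integral>x. l * (f x - r x)\<^sup>2 \<partial>M)"
    proof (rule integral_cong_AE)
      show "AE x in M. l * (f x - r x) * (v x - r x) = l * (f x - r x)\<^sup>2"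
        using L2_spaceD(3)[OF fr] by eventually_elim (auto simp: f_def indicator_def power2_eq_square)
    qed (use L2_spaceD(1)[OF f] D_meas[OF v] D_meas[OF rD] in auto)
    also have "\<dots> = l * (L2_norm M (\<lambda>x. f x - r x))\<^sup>2" by (simp add: L2_norm_sq)
    finally have eq: "E r v - E r r = l * (L2_norm M (\<lambda>x. f x - r x))\<^sup>2"
      using E_diff_right[OF v rD rD] by simp
    have nn: "0 \<le> l * (L2_norm M (\<lambda>x. f x - r x))\<^sup>2" using l(1) by simp
    have "0 \<le> E (\<lambda>x. v x - r x) (\<lambda>x. v x - r x)" using vr by (rule E_nonneg)
    then have vr2: "2 * E r v \<le> E v v + E r r" using E_diff_self[OF v rD] E_sym[OF v rD] by simp
    have "l * (L2_norm M (\<lambda>x. f x - r x))\<^sup>2 < l * e\<^sup>2"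
      using eq nn vr2 l(2) E_nonneg[OF rD] E_nonneg[OF v] by linarith
    then have "(L2_norm M (\<lambda>x. f x - r x))\<^sup>2 < e\<^sup>2" using l(1) by simp
    then have "L2_norm M (\<lambda>x. f x - r x) < e" using e by (simp add: power2_less_imp_less)
    moreover have "E r r \<le> E v v" using eq nn vr2 by linarith
    ultimately show "\<exists>w\<in>DD \<Omega>. L2_norm M (\<lambda>x. w x - f x) < e \<and> E w w \<le> E v v"
      using r(1) L2_norm_commute[of M r f] by (intro bexI[of _ r]) auto
  qed
  then show ?thesis by (simp add: f_def[abs_def])
qed

section \<open>From II to III: vanishing capacity of the boundary\<close>

lemma rel_cap_admissible_compact:
  assumes mem: "\<And>v. v \<in> D \<Longrightarrow> (\<lambda>x. indicat_real \<Omega> x * v x) \<in> DD \<Omega>"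
    and K: "compact K" "K \<subseteq> frontier \<Omega>" and e: "e > 0"
  shows "\<exists>u V. u \<in> D \<and> (\<forall>x. 0 \<le> u x) \<and> graph_norm M E u < e \<and> open V \<and> K \<subseteq> V \<and> (AE x in M. x \<in> V \<inter> \<Omega> \<longrightarrow> 1 \<le> u x)"
proof -
  obtain \<eta> L' where \<eta>: "\<eta> \<in> D" "continuous_on UNIV \<eta>" "\<And>x. x \<in> K \<Longrightarrow> \<eta> x = 1"
    using cutoff_exists[OF K(1) open_UNIV] by (metis subset_UNIV)
  \<comment> \<open>The cutoff is known to equal 1 only on \<open>K\<close> itself; doubling it
    gives values at least 1 on the open set where \<open>\<eta> > 1/2\<close>.\<close>
  define f where "f x = indicat_real \<Omega> x * (2 * \<eta> x)" for x
  have f: "f \<in> DD \<Omega>" unfolding f_def by (rule mem[OF scale_mem[OF \<eta>(1)]])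
  obtain \<theta> where \<theta>: "\<theta> \<in> Dc \<Omega>" "graph_norm M E (\<lambda>x. f x - \<theta> x) < e" using DD_approx[OF f e] by blast
  obtain L where L: "compact L" "L \<subseteq> \<Omega>" "AE x in M. x \<notin> L \<longrightarrow> \<theta> x = 0"
    using \<theta>(1) unfolding compact_support_domain_iff by blast
  have d: "(\<lambda>x. f x - \<theta> x) \<in> D" using DD_D[OF f] Dc_D[OF \<theta>(1)] by (rule diff_mem)
  define u where "u x = max 0 (f x - \<theta> x)" for x
  have u: "u \<in> D" unfolding u_def[abs_def] using d by (rule pos_part_mem)
  have "(graph_norm M E u)\<^sup>2 \<le> (graph_norm M E (\<lambda>x. f x - \<theta> x))\<^sup>2"
  proof -
    have "L2_norm M u \<le> L2_norm M (\<lambda>x. f x - \<theta> x)"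
      using D_L2[OF d] D_meas[OF u] by (intro L2_norm_mono) (auto simp: u_def)
    then have "(L2_norm M u)\<^sup>2 \<le> (L2_norm M (\<lambda>x. f x - \<theta> x))\<^sup>2" by (intro power_mono) auto
    moreover have "E u u \<le> E (\<lambda>x. f x - \<theta> x) (\<lambda>x. f x - \<theta> x)"
      unfolding u_def[abs_def] using d by (rule E_pos_part_le)
    ultimately show ?thesis using graph_norm_sq[OF u] graph_norm_sq[OF d] by linarith
  qed
  then have "graph_norm M E u \<le> graph_norm M E (\<lambda>x. f x - \<theta> x)"
    using graph_norm_nonneg[OF d] by (rule power2_le_imp_le)
  then have n: "graph_norm M E u < e" using \<theta>(2) by simp
  \<comment> \<open>Removing \<open>L\<close> costs no boundary point, since \<open>L\<close> lies
    in the open set \<open>\<Omega>\<close>. Off \<open>L\<close> nothing is subtracted, so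
    \<open>u = f\<close> there inside \<open>\<Omega>\<close>.\<close>
  define V where "V = {x. 1/2 < \<eta> x} - L"
  have "open {x. 1/2 < \<eta> x}" using \<eta>(2) by (intro open_Collect_less continuous_on_const)
  then have V: "open V" unfolding V_def using L(1) by (intro open_Diff compact_imp_closed)
  have "K \<subseteq> V"
    using K(2) L(2) \<eta>(3) open_Om by (auto simp: V_def frontier_def interior_open)
  moreover have "AE x in M. x \<in> V \<inter> \<Omega> \<longrightarrow> 1 \<le> u x"
    using L(3) by eventually_elim (auto simp: V_def u_def f_def)
  ultimately show ?thesis using u n V by (intro exI[of _ u] exI[of _ V]) (auto simp: u_def)
qed

lemma sum_mem: "finite A \<Longrightarrow> (\<And>k. k \<in> A \<Longrightarrow> \<phi> k \<in> D) \<Longrightarrow> (\<lambda>x. \<Sum>k\<in>A. \<phi> k x) \<in> D"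
  by (induction A rule: finite_induct) (auto intro: zero_mem add_mem)

lemma graph_norm_sum:
  assumes "finite A" "\<And>k. k \<in> A \<Longrightarrow> \<phi> k \<in> D"
  shows "graph_norm M E (\<lambda>x. \<Sum>k\<in>A. \<phi> k x) \<le> (\<Sum>k\<in>A. graph_norm M E (\<phi> k))"
  using assms
proof (induction A rule: finite_induct)
  case empty
  then show ?case using graph_norm_scale[OF zero_mem, of 0] by simp
next
  case (insert a A)
  have "graph_norm M E (\<lambda>x. \<phi> a x + (\<Sum>k\<in>A. \<phi> k x)) \<le> graph_norm M E (\<phi> a) + graph_norm M E (\<lambda>x. \<Sum>k\<in>A. \<phi> k x)"
    using insert by (intro graph_norm_triangle sum_mem) auto
  then show ?case using insert by simp
qed

text \<open>A compact exhaustion splits the boundary into countably many pieces. The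
  \<open>n\<close>-th admissible function has graph norm below \<open>e * (1/2)^(n + 1)\<close>, so
  the series converges in \<open>D\<close> with norm at most \<open>e\<close>, and nonnegativity
  keeps the sum above each term.\<close>

lemma agree_rel_cap:
  assumes mem: "\<And>v. v \<in> D \<Longrightarrow> (\<lambda>x. indicat_real \<Omega> x * v x) \<in> DD \<Omega>"
  shows "rel_cap M D E \<Omega> (frontier \<Omega>) = 0"
proof -
  obtain C :: "nat \<Rightarrow> 'a set" where C: "\<And>n. compact (C n)" "UNIV = (\<Union>n. C n)"
    using sigma_compact unfolding sigma_compact_def by blast
  have small: "rel_cap M D E \<Omega> (frontier \<Omega>) \<le> ennreal (e\<^sup>2)" if e: "e > 0" for e
  proof -
    define R where "R n u V \<longleftrightarrow> u \<in> D \<and> (\<forall>x. 0 \<le> u x) \<and> graph_norm M E u < e * (1/2)^Suc n \<and> open V \<and>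
      C n \<inter> frontier \<Omega> \<subseteq> V \<and> (AE x in M. x \<in> V \<inter> \<Omega> \<longrightarrow> 1 \<le> u x)" for n u V
    have "\<exists>u V. R n u V" for n
      unfolding R_def using e C(1)
      by (intro rel_cap_admissible_compact[OF mem] compact_Int_closed frontier_closed) auto
    then obtain \<phi> V where RV: "\<And>n. R n (\<phi> n) (V n)" by metis
    have \<phi>: "\<phi> n \<in> D" "\<And>x. 0 \<le> \<phi> n x" "graph_norm M E (\<phi> n) < e * (1/2)^Suc n" "open (V n)"
      "C n \<inter> frontier \<Omega> \<subseteq> V n" "AE x in M. x \<in> V n \<inter> \<Omega> \<longrightarrow> 1 \<le> \<phi> n x" for n
      using RV[of n] unfolding R_def by auto
    define s where "s n x = (\<Sum>k<n. \<phi> k x)" for n x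
    have sD: "s n \<in> D" for n unfolding s_def[abs_def] using \<phi>(1) by (intro sum_mem) auto
    have geo: "(\<Sum>k=n..<m. e * (1/2)^Suc k) \<le> e * (1/2)^n" if "n \<le> m" for n m
    proof -
      have "(\<Sum>k=n..<m. e * (1/2)^Suc k) = e * (1/2)^n - e * (1/2)^m"
        using that by (induction m rule: dec_induct) (auto simp: sum.atLeastLessThan_Suc)
      then show ?thesis using e by simp
    qed
    have diff: "graph_norm M E (\<lambda>x. s m x - s n x) \<le> e * (1/2)^n" if "n \<le> m" for n m
    proof -
      have "(\<lambda>x. s m x - s n x) = (\<lambda>x. \<Sum>k=n..<m. \<phi> k x)"
        using that by (auto simp: s_def lessThan_atLeast0 sum_diff_nat_ivl)
      then have "graph_norm M E (\<lambda>x. s m x - s n x) \<le> (\<Sum>k=n..<m. graph_norm M E (\<phi> k))"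
        using graph_norm_sum[of "{n..<m}" \<phi>] \<phi>(1) by simp
      also have "\<dots> \<le> (\<Sum>k=n..<m. e * (1/2)^Suc k)" using \<phi>(3) by (intro sum_mono less_imp_le)
      also have "\<dots> \<le> e * (1/2)^n" using that by (rule geo)
      finally show ?thesis .
    qed
    have "\<exists>v\<in>D. (\<lambda>n. graph_norm M E (\<lambda>x. s n x - v x)) \<longlonglongrightarrow> 0"
    proof (rule complete[of s, OF sD])
      fix d :: real assume "d > 0"
      then obtain N where "(1/2::real)^N < d / e" using real_arch_pow_inv[of "d / e" "1/2"] e by auto
      then have N: "e * (1/2)^N < d" using e by (simp add: field_simps)
      have pw: "e * (1/2)^n \<le> e * (1/2)^N" if "N \<le> n" for n
        using e that by (intro mult_left_mono power_decreasing) auto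
      have "graph_norm M E (\<lambda>x. s m x - s n x) < d" if "m \<ge> N" "n \<ge> N" for m n
      proof (cases "n \<le> m")
        case True
        then show ?thesis using diff[OF True] pw[OF that(2)] N by linarith
      next
        case False
        then show ?thesis
          using diff[of m n] pw[OF that(1)] N graph_norm_commute[OF sD sD, of m n] by simp
      qed
      then show "\<exists>N. \<forall>m\<ge>N. \<forall>n\<ge>N. graph_norm M E (\<lambda>x. s m x - s n x) < d" by blast
    qed
    then obtain v where v: "v \<in> D" and lim: "(\<lambda>n. graph_norm M E (\<lambda>x. s n x - v x)) \<longlonglongrightarrow> 0" by blast
    have near: "\<exists>m\<ge>n. graph_norm M E (\<lambda>x. s m x - v x) < d" if "d > 0" for d n
    proof -
      have "\<forall>\<^sub>F m in sequentially. n \<le> m \<and> graph_norm M E (\<lambda>x. s m x - v x) < d"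
        using eventually_ge_at_top[of n] order_tendstoD(2)[OF lim that] by (rule eventually_conj)
      then show ?thesis using eventually_happens by force
    qed
    have "graph_norm M E v \<le> e"
    proof (rule field_le_epsilon)
      fix d :: real assume "d > 0"
      then obtain m where m: "graph_norm M E (\<lambda>x. s m x - v x) < d" using near by blast
      have "s 0 = (\<lambda>x. 0)" by (auto simp: s_def)
      then have "graph_norm M E (s m) \<le> e" using diff[of 0 m] by simp
      moreover have "graph_norm M E v \<le> graph_norm M E (\<lambda>x. v x - s m x) + graph_norm M E (s m)"
        using graph_norm_triangle[OF diff_mem[OF v sD] sD, of m m] by simp
      ultimately show "graph_norm M E v \<le> e + d" using m graph_norm_commute[OF v sD, of m] by linarith
    qed
    then have small: "(graph_norm M E v)\<^sup>2 \<le> e\<^sup>2" using graph_norm_nonneg[OF v] by (intro power_mono) auto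
    \<comment> \<open>Convergence in \<open>L\<^sub>2\<close> suffices: for \<open>m \<ge> n\<close>
      the positive part of \<open>s n - v\<close> is bounded by
      \<open>\<bar>s m x - v x\<bar>\<close>, because the partial sums increase.\<close>
    have ge: "AE x in M. s n x \<le> v x" for n
    proof -
      define z where "z x = max 0 (s n x - v x)" for x
      have z: "z \<in> D" unfolding z_def[abs_def] using sD v by (intro pos_part_mem diff_mem)
      have "L2_norm M z \<le> 0"
      proof (rule field_le_epsilon)
        fix d :: real assume "d > 0"
        then obtain m where m: "n \<le> m" "graph_norm M E (\<lambda>x. s m x - v x) < d" using near by blast
        have "s n x \<le> s m x" for x unfolding s_def using m(1) \<phi>(2) by (intro sum_mono2) auto
        then have zle: "\<bar>z x\<bar> \<le> \<bar>s m x - v x\<bar>" for x unfolding z_def by (smt (verit))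
        have dm: "(\<lambda>x. s m x - v x) \<in> D" using sD v by (rule diff_mem)
        have "L2_norm M z \<le> L2_norm M (\<lambda>x. s m x - v x)"
          using zle D_meas[OF z] by (intro L2_norm_mono[OF D_L2[OF dm]]) auto
        also have "\<dots> \<le> graph_norm M E (\<lambda>x. s m x - v x)" using dm by (rule L2_norm_le_graph_norm)
        finally show "L2_norm M z \<le> 0 + d" using m(2) by simp
      qed
      then have "AE x in M. z x = 0" by (rule L2_norm_eq_0[OF D_L2[OF z]])
      then show ?thesis by eventually_elim (auto simp: z_def)
    qed
    have "AE x in M. \<forall>n. s n x \<le> v x" using ge by (simp add: AE_all_countable)
    moreover have "AE x in M. \<forall>n. x \<in> V n \<inter> \<Omega> \<longrightarrow> 1 \<le> \<phi> n x" using \<phi>(6) by (simp add: AE_all_countable)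
    ultimately have v1: "AE x in M. x \<in> (\<Union>n. V n) \<inter> \<Omega> \<longrightarrow> v x \<ge> 1"
    proof eventually_elim
      case (elim x)
      show ?case
      proof
        assume "x \<in> (\<Union>n. V n) \<inter> \<Omega>"
        then obtain n where "x \<in> V n \<inter> \<Omega>" by blast
        then have "1 \<le> \<phi> n x" using elim by blast
        also have "\<phi> n x \<le> s (Suc n) x" unfolding s_def using \<phi>(2) by (simp add: sum_nonneg)
        also have "\<dots> \<le> v x" using elim by blast
        finally show "v x \<ge> 1" .
      qed
    qed
    have "frontier \<Omega> \<subseteq> (\<Union>n. V n)" using C(2) \<phi>(5) by blast
    moreover have "open (\<Union>n. V n)" using \<phi>(4) by auto
    ultimately have "rel_cap M D E \<Omega> (frontier \<Omega>) \<le> ennreal ((graph_norm M E v)\<^sup>2)"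
      unfolding rel_cap_def using v v1 by (intro INF_lower) blast
    also have "\<dots> \<le> ennreal (e\<^sup>2)" using small by (rule ennreal_leI)
    finally show ?thesis .
  qed
  have "rel_cap M D E \<Omega> (frontier \<Omega>) \<le> 0"
  proof (rule ennreal_le_epsilon)
    fix d :: real assume "d > 0"
    then show "rel_cap M D E \<Omega> (frontier \<Omega>) \<le> 0 + ennreal d" using small[of "sqrt d"] by simp
  qed
  then show ?thesis by simp
qed

section \<open>From III to II for regular forms\<close>

text \<open>With \<open>0 \<le> \<phi> \<le> c\<close> and \<open>\<theta>\<close> admissible for the capacity, the positive part of \<open>\<phi> - c * \<theta>\<close>
  vanishes in \<open>\<Omega>\<close> near the boundary. Its restriction to \<open>\<Omega>\<close> is then a minimum with a multiple of a
  cutoff function, which avoids products of elements of the form domain.\<close>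

lemma rel_cap_indicator_mem_nonneg:
  assumes cap: "rel_cap M D E \<Omega> (frontier \<Omega>) = 0"
    and \<phi>: "\<phi> \<in> D" "\<phi> \<in> Cc_space" and pos: "\<And>x. 0 \<le> \<phi> x"
  shows "(\<lambda>x. indicat_real \<Omega> x * \<phi> x) \<in> DD \<Omega>"
proof -
  define K0 where "K0 = closure {x. \<phi> x \<noteq> 0}"
  have K0: "compact K0" and cont: "continuous_on UNIV \<phi>" using \<phi>(2) by (auto simp: Cc_space_def K0_def)
  have K0': "\<phi> x = 0" if "x \<notin> K0" for x using that closure_subset[of "{x. \<phi> x \<noteq> 0}"] by (auto simp: K0_def)
  obtain c where c: "c > 0" "\<And>x. \<phi> x \<le> c"
  proof -
    have "bounded (\<phi> ` K0)" using K0 continuous_on_subset[OF cont] by (intro compact_imp_bounded compact_continuous_image) auto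
    then obtain b where "\<And>x. x \<in> K0 \<Longrightarrow> \<bar>\<phi> x\<bar> \<le> b" by (auto simp: bounded_iff)
    then have "\<phi> x \<le> \<bar>b\<bar> + 1" for x using K0'[of x] by (cases "x \<in> K0") force+
    then show thesis using that[of "\<bar>b\<bar> + 1"] by simp
  qed
  define f where "f x = indicat_real \<Omega> x * \<phi> x" for x
  have fU: "f \<in> L2_space M UNIV" unfolding f_def by (rule L2_space_UNIV[OF indicator_L2[OF D_L2[OF \<phi>(1)]]])
  have "f \<in> DD \<Omega>"
  proof (rule DD_bounded_energy_limit[OF fU])
    fix e :: real assume e: "e > 0"
    \<comment> \<open>The first entry makes the norm of \<open>\<psi>\<close> smaller than
      \<open>e\<close>, the second its energy at most 1.\<close>
    define d where "d = min (e / c) (1 / c)"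
    have d: "d > 0" using e c by (simp add: d_def)
    have "rel_cap M D E \<Omega> (frontier \<Omega>) < ennreal (d\<^sup>2)" using cap d by simp
    then obtain \<theta> V where \<theta>: "\<theta> \<in> D" "open V" "frontier \<Omega> \<subseteq> V" "AE x in M. x \<in> V \<inter> \<Omega> \<longrightarrow> \<theta> x \<ge> 1"
      "ennreal ((graph_norm M E \<theta>)\<^sup>2) < ennreal (d\<^sup>2)"
      unfolding rel_cap_def INF_less_iff by blast
    have "(graph_norm M E \<theta>)\<^sup>2 < d\<^sup>2" using \<theta>(5) by (simp add: ennreal_less_iff)
    then have gn: "graph_norm M E \<theta> < d" using d by (simp add: power2_less_imp_less)
    define \<psi> where "\<psi> x = c * max 0 (\<theta> x)" for x
    have \<psi>: "\<psi> \<in> D" unfolding \<psi>_def[abs_def] using \<theta>(1) by (intro scale_mem pos_part_mem)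
    have E\<psi>: "E \<psi> \<psi> \<le> 1"
    proof -
      have "E \<psi> \<psi> = c * c * E (\<lambda>x. max 0 (\<theta> x)) (\<lambda>x. max 0 (\<theta> x))"
        unfolding \<psi>_def[abs_def] using pos_part_mem[OF \<theta>(1)] by (simp add: E_scale_left E_scale_right scale_mem)
      also have "\<dots> \<le> c * c * E \<theta> \<theta>" using E_pos_part_le[OF \<theta>(1)] c by (intro mult_left_mono) auto
      also have "\<dots> \<le> c * c * (graph_norm M E \<theta>)\<^sup>2" using E_le_graph_norm[OF \<theta>(1)] c by (intro mult_left_mono) auto
      also have "\<dots> = (c * graph_norm M E \<theta>)\<^sup>2" by (simp add: power2_eq_square)
      also have "\<dots> \<le> 1"
      proof (rule power_le_one)
        have "c * graph_norm M E \<theta> \<le> c * d" using gn c by (intro mult_left_mono) auto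
        also have "\<dots> \<le> c * (1 / c)" using c by (intro mult_left_mono) (auto simp: d_def)
        finally show "c * graph_norm M E \<theta> \<le> 1" using c by simp
      qed (use c graph_norm_nonneg[OF \<theta>(1)] in auto)
      finally show ?thesis .
    qed
    have \<psi>norm: "L2_norm M \<psi> < e"
    proof -
      have cx: "(\<lambda>x. c * \<theta> x) \<in> D" using \<theta>(1) by (rule scale_mem)
      have "L2_norm M \<psi> \<le> L2_norm M (\<lambda>x. c * \<theta> x)"
        using c D_meas[OF \<psi>] by (intro L2_norm_mono[OF D_L2[OF cx]]) (auto simp: \<psi>_def abs_mult)
      also have "\<dots> = c * L2_norm M \<theta>" using c by (simp add: L2_norm_scale)
      also have "\<dots> \<le> c * graph_norm M E \<theta>" using L2_norm_le_graph_norm[OF \<theta>(1)] c by (intro mult_left_mono) auto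
      also have "\<dots> < c * d" using gn c by (intro mult_strict_left_mono)
      also have "\<dots> \<le> c * (e / c)" using c by (intro mult_left_mono) (auto simp: d_def)
      finally show ?thesis using c by simp
    qed
    define w where "w x = max 0 (\<phi> x - \<psi> x)" for x
    have w: "w \<in> D" unfolding w_def[abs_def] using \<phi>(1) \<psi> by (intro pos_part_mem diff_mem)
    have "E w w \<le> E (\<lambda>x. \<phi> x - \<psi> x) (\<lambda>x. \<phi> x - \<psi> x)"
      unfolding w_def[abs_def] using \<phi>(1) \<psi> by (intro E_pos_part_le diff_mem)
    then have Ew: "E w w \<le> 2 * E \<phi> \<phi> + 2" using E_diff_le[OF \<phi>(1) \<psi>] E\<psi> by linarith
    \<comment> \<open>Since \<open>V\<close> contains the boundary, what remains of the closure of
      \<open>\<Omega>\<close> is a closed set inside \<open>\<Omega>\<close>; intersecting with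
      \<open>K0\<close> makes it compact. It contains every point of \<open>\<Omega>\<close> outside
      \<open>V\<close> at which \<open>\<phi>\<close> is nonzero.\<close>
    define K where "K = K0 \<inter> (closure \<Omega> - V)"
    have "compact K" unfolding K_def using K0 \<theta>(2) by (intro compact_Int_closed closed_Diff closed_closure)
    moreover have KOm: "K \<subseteq> \<Omega>" using \<theta>(3) open_Om by (auto simp: K_def frontier_def interior_open)
    ultimately obtain \<eta> L where \<eta>: "\<eta> \<in> D" "\<And>x. 0 \<le> \<eta> x" "\<And>x. x \<in> K \<Longrightarrow> \<eta> x = 1"
      and L: "compact L" "L \<subseteq> \<Omega>" "\<And>x. x \<notin> L \<Longrightarrow> \<eta> x = 0"
      using cutoff_exists[OF _ open_Om] by metis
    define z where "z x = min (w x) (c * \<eta> x)" for x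
    have z: "z \<in> D" unfolding z_def[abs_def] using w \<eta>(1) by (intro min_mem scale_mem)
    have "AE x in M. x \<notin> L \<longrightarrow> z x = 0" using L(3) by (intro AE_I2) (auto simp: z_def w_def)
    then have zDD: "z \<in> DD \<Omega>" using z L by (intro Dc_DD) (auto simp: compact_support_domain_iff)
    have zw: "AE x in M. z x = indicat_real \<Omega> x * w x"
      using \<theta>(4)
    proof eventually_elim
      case (elim x)
      have \<psi>0: "0 \<le> \<psi> x" using c by (simp add: \<psi>_def)
      consider "x \<notin> \<Omega>" | "x \<in> \<Omega>" "x \<in> V" | "x \<in> \<Omega>" "x \<notin> V" "x \<in> K0" | "x \<in> \<Omega>" "x \<notin> K0" by blast
      then show ?case
      proof cases
        case 1
        then have "\<eta> x = 0" using L by blast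
        then show ?thesis using 1 by (simp add: z_def w_def)
      next
        case 2
        then have "\<psi> x \<ge> c" using elim c by (simp add: \<psi>_def)
        then have "w x = 0" using c(2)[of x] by (simp add: w_def)
        then show ?thesis using \<eta>(2)[of x] c by (simp add: z_def)
      next
        case 3
        then have "\<eta> x = 1" using \<eta>(3) closure_subset by (auto simp: K_def)
        then show ?thesis using 3 c(2)[of x] \<psi>0 c(1) by (auto simp: z_def w_def)
      next
        case 4
        then have "w x = 0" using K0' \<psi>0 by (simp add: w_def)
        then show ?thesis using \<eta>(2)[of x] c by (simp add: z_def)
      qed
    qed
    \<comment> \<open>Locality bounds the energy of \<open>z\<close> by that of \<open>w\<close>,
      independently of the cutoff \<open>\<eta>\<close>, whose energy may be large.\<close>
    have "AE x in M. z x * (w x - z x) = 0" using zw by eventually_elim (auto simp: indicator_def)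
    then have Ez: "E z z \<le> 2 * E \<phi> \<phi> + 2" using local_le[OF z w] Ew by simp
    have "AE x in M. \<bar>z x - f x\<bar> \<le> \<bar>\<psi> x\<bar>"
      using zw
    proof eventually_elim
      case (elim x)
      have "\<bar>w x - \<phi> x\<bar> \<le> \<bar>\<psi> x\<bar>" using pos[of x] by (auto simp: w_def)
      then show ?case using elim by (auto simp: f_def indicator_def)
    qed
    then have "L2_norm M (\<lambda>x. z x - f x) \<le> L2_norm M \<psi>"
      using D_meas[OF z] L2_spaceD(1)[OF fU] by (intro L2_norm_mono[OF D_L2[OF \<psi>]]) auto
    then show "\<exists>w\<in>DD \<Omega>. L2_norm M (\<lambda>x. w x - f x) < e \<and> E w w \<le> 2 * E \<phi> \<phi> + 2"
      using zDD Ez \<psi>norm by (intro bexI[of _ z]) auto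
  qed
  then show ?thesis by (simp add: f_def[abs_def])
qed

text \<open>Regularity supplies compactly supported continuous approximants of \<open>v\<close> in
  the graph norm. By locality, restricting them to \<open>\<Omega>\<close> does not raise their
  energy, so the restrictions converge in \<open>L\<^sub>2\<close> with bounded energy.\<close>

lemma rel_cap_indicator_mem:
  assumes reg: "regular_form M D E" and cap: "rel_cap M D E \<Omega> (frontier \<Omega>) = 0" and v: "v \<in> D"
  shows "(\<lambda>x. indicat_real \<Omega> x * v x) \<in> DD \<Omega>"
proof -
  have Cc: "(\<lambda>x. indicat_real \<Omega> x * \<phi> x) \<in> DD \<Omega>" if \<phi>: "\<phi> \<in> D" "\<phi> \<in> Cc_space" for \<phi>
  proof -
    have part: "(\<lambda>x. max 0 (\<psi> x)) \<in> Cc_space" if "\<psi> \<in> Cc_space" for \<psi>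
    proof -
      have "closure {x. max 0 (\<psi> x) \<noteq> 0} \<subseteq> closure {x. \<psi> x \<noteq> 0}" by (intro closure_mono) auto
      then have "compact (closure {x. max 0 (\<psi> x) \<noteq> 0})"
        using that compact_Int_closed[of "closure {x. \<psi> x \<noteq> 0}" "closure {x. max 0 (\<psi> x) \<noteq> 0}"]
        by (simp add: Cc_space_def Int_absorb1)
      then show ?thesis using that by (auto simp: Cc_space_def intro!: continuous_intros)
    qed
    have m: "(\<lambda>x. - \<phi> x) \<in> Cc_space" using \<phi>(2) by (auto simp: Cc_space_def intro!: continuous_intros)
    have a: "(\<lambda>x. indicat_real \<Omega> x * max 0 (\<phi> x)) \<in> DD \<Omega>"
      using \<phi> by (intro rel_cap_indicator_mem_nonneg[OF cap pos_part_mem part]) auto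
    have b: "(\<lambda>x. indicat_real \<Omega> x * max 0 (- \<phi> x)) \<in> DD \<Omega>"
      using \<phi>(1) m by (intro rel_cap_indicator_mem_nonneg[OF cap pos_part_mem part] uminus_mem) auto
    have "(\<lambda>x. indicat_real \<Omega> x * \<phi> x) = (\<lambda>x. indicat_real \<Omega> x * max 0 (\<phi> x) - indicat_real \<Omega> x * max 0 (- \<phi> x))"
      by (auto simp: max_def)
    then show ?thesis using DD_diff[OF a b] by simp
  qed
  define f where "f x = indicat_real \<Omega> x * v x" for x
  have fU: "f \<in> L2_space M UNIV" unfolding f_def by (rule L2_space_UNIV[OF indicator_L2[OF D_L2[OF v]]])
  have "f \<in> DD \<Omega>"
  proof (rule DD_bounded_energy_limit[OF fU])
    fix e :: real assume e: "e > 0"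
    obtain \<phi> where \<phi>: "\<phi> \<in> D" "\<phi> \<in> Cc_space" "graph_norm M E (\<lambda>x. v x - \<phi> x) < min e 1"
      using reg v e unfolding regular_form_def by (metis IntE min_less_iff_conj zero_less_one)
    have d: "(\<lambda>x. v x - \<phi> x) \<in> D" using v \<phi>(1) by (rule diff_mem)
    define z where "z x = indicat_real \<Omega> x * \<phi> x" for x
    have z: "z \<in> DD \<Omega>" unfolding z_def by (rule Cc[OF \<phi>(1,2)])
    have "E z z \<le> E \<phi> \<phi>"
      by (rule local_le[OF DD_D[OF z] \<phi>(1)]) (auto simp: z_def indicator_def)
    moreover have "E \<phi> \<phi> \<le> 2 * E v v + 2 * E (\<lambda>x. v x - \<phi> x) (\<lambda>x. v x - \<phi> x)"
      using E_diff_le[OF v d] by simp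
    moreover have "E (\<lambda>x. v x - \<phi> x) (\<lambda>x. v x - \<phi> x) \<le> 1"
    proof -
      have "(graph_norm M E (\<lambda>x. v x - \<phi> x))\<^sup>2 \<le> 1"
        using \<phi>(3) graph_norm_nonneg[OF d] by (intro power_le_one) auto
      then show ?thesis using E_le_graph_norm[OF d] by linarith
    qed
    ultimately have "E z z \<le> 2 * E v v + 2" by linarith
    moreover have "L2_norm M (\<lambda>x. z x - f x) < e"
    proof -
      have "L2_norm M (\<lambda>x. z x - f x) \<le> L2_norm M (\<lambda>x. v x - \<phi> x)"
      proof (rule L2_norm_mono[OF D_L2[OF d]])
        show "(\<lambda>x. z x - f x) \<in> borel_measurable M"
          using D_meas[OF DD_D[OF z]] L2_spaceD(1)[OF fU] by (rule borel_measurable_diff)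
        show "AE x in M. \<bar>z x - f x\<bar> \<le> \<bar>v x - \<phi> x\<bar>"
          by (intro AE_I2) (auto simp: z_def f_def indicator_def)
      qed
      then show ?thesis using L2_norm_le_graph_norm[OF d] \<phi>(3) by simp
    qed
    ultimately show "\<exists>w\<in>DD \<Omega>. L2_norm M (\<lambda>x. w x - f x) < e \<and> E w w \<le> 2 * E v v + 2"
      using z by blast
  qed
  then show ?thesis by (simp add: f_def[abs_def])
qed

text \<open>The part of \<open>v\<close> outside \<open>\<Omega>\<close> lies in \<open>D\<close>
  too and is orthogonal to \<open>u\<close> by locality. Only the part in the Dirichlet domain
  contributes to \<open>E u v\<close>, and there the generator identity is known.\<close>

lemma indicator_mem_imp_agree:
  assumes mem: "\<And>v. v \<in> D \<Longrightarrow> (\<lambda>x. indicat_real \<Omega> x * v x) \<in> DD \<Omega>"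
    and f: "f \<in> L2_space M \<Omega>" and t: "t > 0"
  shows "AE x in M. S t f x = SD t f x"
proof (rule semigroups_agree[OF _ f])
  fix u g v assume gen: "generator M \<Omega> SD u g" and v: "v \<in> D"
  have g: "g \<in> L2_space M \<Omega>" using gen by (simp add: generator_def)
  have u: "u \<in> DD \<Omega>" using gen by (rule G.generator_form)
  define z where "z x = indicat_real \<Omega> x * v x" for x
  have z: "z \<in> DD \<Omega>" unfolding z_def using v by (rule mem)
  have d: "(\<lambda>x. v x - z x) \<in> D" using v DD_D[OF z] by (rule diff_mem)
  have "E u (\<lambda>x. v x - z x) = 0"
  proof (rule local_zero[OF DD_D[OF u] d])
    show "AE x in M. u x * (v x - z x) = 0"
      using L2_spaceD(3)[OF G.D_sub[OF u]] by eventually_elim (auto simp: z_def indicator_def)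
  qed
  then have "E u v = E u z" using E_diff_right[OF v DD_D[OF z] DD_D[OF u]] by simp
  also have "\<dots> = - (\<integral>x. g x * z x \<partial>M)" using gen z by (rule G.generator_form)
  also have "(\<integral>x. g x * z x \<partial>M) = (\<integral>x. g x * v x \<partial>M)"
  proof (rule integral_cong_AE)
    show "AE x in M. g x * z x = g x * v x"
      using L2_spaceD(3)[OF g] by eventually_elim (auto simp: z_def indicator_def)
  qed (use L2_spaceD(1)[OF g] D_meas[OF v] D_meas[OF DD_D[OF z]] in auto)
  finally show "E u v = - (\<integral>x. g x * v x \<partial>M)" .
qed (use t in simp)

section \<open>From II back to I for conservative \<open>S\<close>\<close>

lemma L1_operator_range:
  assumes agree: "\<And>f. f \<in> L2_space M \<Omega> \<Longrightarrow> AE x in M. S t f x = SD t f x" and t: "t \<ge> 0"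
    and T1: "L1_extension M UNIV (S t) T1" and f: "f \<in> L1_space M \<Omega>"
  shows "T1 f \<in> L1_space M \<Omega>"
proof -
  have U: "g \<in> L1_space M UNIV" if "g \<in> L1_space M \<Omega>" for g using that by (simp add: L1_space_def)
  obtain C where mem: "\<And>g. g \<in> L1_space M UNIV \<Longrightarrow> T1 g \<in> L1_space M UNIV"
    and add: "\<And>g h. g \<in> L1_space M UNIV \<Longrightarrow> h \<in> L1_space M UNIV \<Longrightarrow> AE x in M. T1 (\<lambda>y. g y + h y) x = T1 g x + T1 h x"
    and C: "\<And>g. g \<in> L1_space M UNIV \<Longrightarrow> L1_norm M (T1 g) \<le> C * L1_norm M g"
    and ext: "\<And>g. g \<in> L1_space M UNIV \<Longrightarrow> g \<in> L2_space M UNIV \<Longrightarrow> AE x in M. T1 g x = S t g x"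
    using T1 unfolding L1_extension_def bounded_operator_def by blast
  have fint: "integrable M f" and f0: "AE x in M. x \<notin> \<Omega> \<longrightarrow> f x = 0" using f by (auto simp: L1_space_def)
  have fm: "f \<in> borel_measurable M" using fint by simp
  have Tint: "integrable M (T1 f)" using mem[OF U[OF f]] by (simp add: L1_space_def)
  \<comment> \<open>Large values are cut off here: \<open>k n\<close> is bounded by \<open>n\<close>
    and integrable, hence also square integrable, so on it \<open>T1\<close> agrees with
    \<open>S t\<close> and then with \<open>SD t\<close>.\<close>
  define k where "k n x = (if \<bar>f x\<bar> \<le> real n then f x else 0)" for n x
  define r where "r n x = f x - k n x" for n x
  have km: "k n \<in> borel_measurable M" for n unfolding k_def using fm by measurable
  have kint: "integrable M (k n)" for n
    using km by (intro Bochner_Integration.integrable_bound[OF fint]) (auto simp: k_def)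
  have k0: "AE x in M. x \<notin> \<Omega> \<longrightarrow> k n x = 0" for n using f0 by eventually_elim (auto simp: k_def)
  have k1: "k n \<in> L1_space M \<Omega>" for n using kint k0 by (simp add: L1_space_def)
  have k2: "k n \<in> L2_space M \<Omega>" for n
  proof -
    have "integrable M (\<lambda>x. (k n x)\<^sup>2)"
    proof (rule Bochner_Integration.integrable_bound)
      show "integrable M (\<lambda>x. real n * \<bar>f x\<bar>)" using fint by simp
      have "(k n x)\<^sup>2 \<le> real n * \<bar>f x\<bar>" for x
        using mult_right_mono[of "\<bar>f x\<bar>" "real n" "\<bar>f x\<bar>"] by (auto simp: k_def power2_eq_square)
      then show "AE x in M. norm ((k n x)\<^sup>2) \<le> norm (real n * \<bar>f x\<bar>)" by simp
    qed (use km in simp)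
    then show ?thesis using km k0 by (simp add: L2_space_def)
  qed
  have r1: "r n \<in> L1_space M UNIV" for n
    unfolding r_def[abs_def] L1_space_def using fint kint by auto
  have Tk0: "AE x in M. x \<notin> \<Omega> \<longrightarrow> T1 (k n) x = 0" for n
    using ext[OF U[OF k1] L2_space_UNIV[OF k2], of n] agree[OF k2, of n] L2_spaceD(3)[OF G.S_mem[OF t k2], of n]
    by eventually_elim auto
  have Tf: "AE x in M. T1 f x = T1 (k n) x + T1 (r n) x" for n
    using add[OF U[OF k1] r1, of n n] by (simp add: r_def)
  define h where "h x = T1 f x - indicat_real \<Omega> x * T1 f x" for x
  have hm: "h \<in> borel_measurable M" unfolding h_def using Tint Om_sets by simp
  have hint: "integrable M h"
    using hm by (intro Bochner_Integration.integrable_bound[OF Tint]) (auto simp: h_def indicator_def)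
  \<comment> \<open>Outside \<open>\<Omega>\<close> the image of \<open>k n\<close> vanishes, so
    \<open>h\<close> sees only the image of the remainder \<open>r n\<close>, which is small by
    boundedness of \<open>T1\<close>.\<close>
  have hle: "(\<integral>x. \<bar>h x\<bar> \<partial>M) \<le> C * (\<integral>x. \<bar>r n x\<bar> \<partial>M)" for n
  proof -
    have Tr: "integrable M (T1 (r n))" using mem[OF r1] by (simp add: L1_space_def)
    have "(\<integral>x. \<bar>h x\<bar> \<partial>M) \<le> (\<integral>x. \<bar>T1 (r n) x\<bar> \<partial>M)"
    proof (rule integral_mono_AE)
      show "AE x in M. \<bar>h x\<bar> \<le> \<bar>T1 (r n) x\<bar>"
        using Tf[of n] Tk0[of n] by eventually_elim (auto simp: h_def indicator_def)
    qed (use hint Tr in auto)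
    then show ?thesis using C[OF r1, of n] by (simp add: L1_norm_def)
  qed
  have "(\<lambda>n. \<integral>x. \<bar>r n x\<bar> \<partial>M) \<longlonglongrightarrow> (\<integral>x. 0 \<partial>M)"
  proof (rule integral_dominated_convergence[where w = "\<lambda>x. \<bar>f x\<bar>"])
    show "AE x in M. (\<lambda>n. \<bar>r n x\<bar>) \<longlonglongrightarrow> 0"
    proof (rule AE_I2)
      fix x
      obtain N :: nat where N: "\<bar>f x\<bar> \<le> real N" using real_arch_simple by blast
      have "\<forall>\<^sub>F n in sequentially. \<bar>r n x\<bar> = 0"
        using eventually_ge_at_top[of N] by eventually_elim (use N in \<open>simp add: r_def k_def\<close>)
      then show "(\<lambda>n. \<bar>r n x\<bar>) \<longlonglongrightarrow> 0" by (rule tendsto_eventually)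
    qed
    show "AE x in M. norm \<bar>r n x\<bar> \<le> \<bar>f x\<bar>" for n by (intro AE_I2) (auto simp: r_def k_def)
    show "(\<lambda>x. \<bar>r n x\<bar>) \<in> borel_measurable M" for n using fm km by (simp add: r_def)
  qed (use fint in auto)
  then have "(\<lambda>n. C * (\<integral>x. \<bar>r n x\<bar> \<partial>M)) \<longlonglongrightarrow> C * 0" by (intro tendsto_intros) simp
  then have "(\<integral>x. \<bar>h x\<bar> \<partial>M) \<le> C * 0" using hle by (intro LIMSEQ_le_const) auto
  then have "(\<integral>x. \<bar>h x\<bar> \<partial>M) = 0" by (intro antisym) auto
  then have "AE x in M. \<bar>h x\<bar> = 0"
    using integral_nonneg_eq_0_iff_AE[of M "\<lambda>x. \<bar>h x\<bar>"] hint by simp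
  then have "AE x in M. x \<notin> \<Omega> \<longrightarrow> T1 f x = 0" by eventually_elim (auto simp: h_def indicator_def)
  then show ?thesis using Tint by (simp add: L1_space_def)
qed

text \<open>For \<open>f\<close> integrable and supported in \<open>\<Omega>\<close>,
  \<open>T1 f\<close> lives on \<open>\<Omega>\<close>, so the indicator of \<open>\<Omega>\<close>
  and the constant 1 pair equally with it. By duality \<open>T\<close> of the indicator and
  \<open>T\<close> of 1 pair equally with all such \<open>f\<close>, hence agree on
  \<open>\<Omega>\<close>.\<close>

lemma agree_conservative:
  assumes agree: "\<And>f t. f \<in> L2_space M \<Omega> \<Longrightarrow> t > 0 \<Longrightarrow> AE x in M. S t f x = SD t f x"
    and cons: "conservative M UNIV S"
  shows "conservative M \<Omega> SD"
  unfolding conservative_def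
proof (intro allI impI)
  fix t :: real assume t: "t > 0"
  have t0: "t \<ge> 0" using t by simp
  obtain T where Text: "Linf_extension M UNIV (S t) T"
    and one: "AE x in M. T (indicat_real UNIV) x = indicat_real UNIV x"
    using cons t unfolding conservative_def by blast
  obtain T1 where T1: "L1_extension M UNIV (S t) T1"
    and T: "\<And>g. g \<in> Linf_space M UNIV \<Longrightarrow> T g \<in> Linf_space M UNIV"
      "\<And>g h. g \<in> Linf_space M UNIV \<Longrightarrow> h \<in> L1_space M UNIV \<Longrightarrow> (\<integral>x. T g x * h x \<partial>M) = (\<integral>x. g x * T1 h x \<partial>M)"
    using Text unfolding Linf_extension_def by blast
  have U: "g \<in> L1_space M UNIV" if "g \<in> L1_space M \<Omega>" for g using that by (simp add: L1_space_def)
  have UI: "g \<in> Linf_space M UNIV" if "g \<in> Linf_space M \<Omega>" for g using that by (simp add: Linf_space_def)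
  have range: "T1 f \<in> L1_space M \<Omega>" if "f \<in> L1_space M \<Omega>" for f
    using L1_operator_range[OF agree[OF _ t] t0 T1 that] .
  have "bounded_operator M (L1_space M \<Omega>) (L1_norm M) T1"
    using T1 U range unfolding L1_extension_def bounded_operator_def by blast
  moreover have "AE x in M. T1 f x = SD t f x" if f: "f \<in> L1_space M \<Omega>" "f \<in> L2_space M \<Omega>" for f
  proof -
    have "AE x in M. T1 f x = S t f x"
      using T1 U[OF f(1)] L2_space_UNIV[OF f(2)] unfolding L1_extension_def by blast
    then show ?thesis using agree[OF f(2) t] by eventually_elim simp
  qed
  ultimately have T1D: "L1_extension M \<Omega> (SD t) T1" unfolding L1_extension_def by blast
  \<comment> \<open>The dual of the restricted \<open>T1\<close> is \<open>T\<close> followed by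
    restriction to \<open>\<Omega>\<close>: the pairing with functions living on
    \<open>\<Omega>\<close> is unchanged, and the result vanishes off \<open>\<Omega>\<close> as
    required.\<close>
  define TD where "TD g x = indicat_real \<Omega> x * T g x" for g x
  have TDL: "TD g \<in> Linf_space M \<Omega>" if g: "g \<in> Linf_space M \<Omega>" for g
  proof -
    obtain C where m: "T g \<in> borel_measurable M" and C: "AE x in M. \<bar>T g x\<bar> \<le> C"
      using T(1)[OF UI[OF g]] unfolding Linf_space_def by blast
    have "TD g \<in> borel_measurable M" unfolding TD_def[abs_def] using m Om_sets by simp
    moreover have "AE x in M. \<bar>TD g x\<bar> \<le> C" using C by eventually_elim (auto simp: TD_def indicator_def)
    moreover have "AE x in M. x \<notin> \<Omega> \<longrightarrow> TD g x = 0" by (intro AE_I2) (simp add: TD_def)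
    ultimately show ?thesis unfolding Linf_space_def by blast
  qed
  have Tm: "T g \<in> borel_measurable M" if "g \<in> Linf_space M UNIV" for g
    using T(1)[OF that] unfolding Linf_space_def by blast
  have TDint: "(\<integral>x. TD g x * f x \<partial>M) = (\<integral>x. g x * T1 f x \<partial>M)"
    if g: "g \<in> Linf_space M \<Omega>" and f: "f \<in> L1_space M \<Omega>" for g f
  proof -
    have fm: "f \<in> borel_measurable M" and f0: "AE x in M. x \<notin> \<Omega> \<longrightarrow> f x = 0" using f by (auto simp: L1_space_def)
    have gm: "T g \<in> borel_measurable M" "TD g \<in> borel_measurable M"
      using Tm[OF UI[OF g]] Om_sets by (auto simp: TD_def[abs_def])
    have "(\<integral>x. TD g x * f x \<partial>M) = (\<integral>x. T g x * f x \<partial>M)"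
    proof (rule integral_cong_AE)
      show "AE x in M. TD g x * f x = T g x * f x"
        using f0 by eventually_elim (auto simp: TD_def indicator_def)
    qed (use gm fm in \<open>auto intro: borel_measurable_times\<close>)
    then show ?thesis using T(2)[OF UI[OF g] U[OF f]] by simp
  qed
  have ext: "Linf_extension M \<Omega> (SD t) TD"
    unfolding Linf_extension_def using T1D TDL TDint by blast
  have ind: "indicat_real \<Omega> \<in> Linf_space M UNIV" "indicat_real UNIV \<in> Linf_space M UNIV"
    unfolding Linf_space_def using Om_sets by (auto simp: indicator_def intro!: exI[of _ 1])
  define h where "h x = T (indicat_real \<Omega>) x - 1" for x
  have hm: "h \<in> borel_measurable M" unfolding h_def using Tm[OF ind(1)] by simp
  obtain C where C: "AE x in M. \<bar>T (indicat_real \<Omega>) x\<bar> \<le> C"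
    using T(1)[OF ind(1)] unfolding Linf_space_def by blast
  have orth: "(\<integral>x. h x * f x \<partial>M) = 0" and orth_int: "integrable M (\<lambda>x. h x * f x)"
    if f: "f \<in> L1_space M \<Omega>" for f
  proof -
    have fint: "integrable M f" using f by (simp add: L1_space_def)
    have Tfint: "integrable M (\<lambda>x. T (indicat_real \<Omega>) x * f x)"
    proof (rule Bochner_Integration.integrable_bound)
      show "integrable M (\<lambda>x. C * f x)" using fint by simp
      show "(\<lambda>x. T (indicat_real \<Omega>) x * f x) \<in> borel_measurable M"
        using Tm[OF ind(1)] fint by (intro borel_measurable_times) auto
      show "AE x in M. norm (T (indicat_real \<Omega>) x * f x) \<le> norm (C * f x)"
        using C by eventually_elim (auto simp: abs_mult intro!: mult_right_mono)
    qed
    have T1f0: "AE x in M. x \<notin> \<Omega> \<longrightarrow> T1 f x = 0" and T1m: "T1 f \<in> borel_measurable M"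
      using range[OF f] by (auto simp: L1_space_def)
    have "(\<integral>x. T (indicat_real \<Omega>) x * f x \<partial>M) = (\<integral>x. indicat_real \<Omega> x * T1 f x \<partial>M)"
      by (rule T(2)[OF ind(1) U[OF f]])
    also have "\<dots> = (\<integral>x. indicat_real UNIV x * T1 f x \<partial>M)"
    proof (rule integral_cong_AE)
      show "AE x in M. indicat_real \<Omega> x * T1 f x = indicat_real UNIV x * T1 f x"
        using T1f0 by eventually_elim (auto simp: indicator_def)
    qed (use T1m Om_sets in simp_all)
    also have "\<dots> = (\<integral>x. T (indicat_real UNIV) x * f x \<partial>M)" by (rule T(2)[OF ind(2) U[OF f], symmetric])
    also have "\<dots> = (\<integral>x. f x \<partial>M)"
    proof (rule integral_cong_AE)
      show "(\<lambda>x. T (indicat_real UNIV) x * f x) \<in> borel_measurable M"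
        using Tm[OF ind(2)] fint by (intro borel_measurable_times) auto
      show "AE x in M. T (indicat_real UNIV) x * f x = f x" using one by eventually_elim simp
    qed (use fint in simp)
    finally have eq: "(\<integral>x. T (indicat_real \<Omega>) x * f x \<partial>M) = (\<integral>x. f x \<partial>M)" .
    have h_eq: "(\<lambda>x. h x * f x) = (\<lambda>x. T (indicat_real \<Omega>) x * f x - f x)"
      by (auto simp: h_def algebra_simps)
    show "integrable M (\<lambda>x. h x * f x)" unfolding h_eq using Tfint fint by (rule Bochner_Integration.integrable_diff)
    show "(\<integral>x. h x * f x \<partial>M) = 0" unfolding h_eq using Tfint fint eq by simp
  qed
  obtain K :: "nat \<Rightarrow> 'a set" where K: "\<And>n. compact (K n)" "UNIV = (\<Union>n. K n)"
    using sigma_compact unfolding sigma_compact_def by blast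
  have "AE x in M. x \<in> \<Omega> \<inter> K n \<longrightarrow> h x = 0" for n
  proof -
    \<comment> \<open>The sign of \<open>h\<close> on a set of finite measure is an integrable test
      function that turns the pairing into the integral of \<open>\<bar>h x\<bar>\<close> over that
      set; countably many such sets exhaust \<open>\<Omega>\<close>.\<close>
    define f where "f x = sgn (h x) * indicat_real (\<Omega> \<inter> K n) x" for x
    have B: "\<Omega> \<inter> K n \<in> sets M" using Om_sets sets_compact[OF K(1)] by (rule sets.Int)
    have "integrable M (indicat_real (K n))"
      using emeasure_compact[OF K(1)] sets_compact[OF K(1)] by (simp add: integrable_indicator_iff)
    moreover have fm: "f \<in> borel_measurable M" unfolding f_def using hm B by simp
    ultimately have "integrable M f"
      by (rule Bochner_Integration.integrable_bound) (auto simp: f_def indicator_def sgn_if)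
    then have f: "f \<in> L1_space M \<Omega>" by (auto simp: L1_space_def f_def indicator_def)
    have nn: "AE x in M. 0 \<le> h x * f x" by (intro AE_I2) (auto simp: f_def indicator_def sgn_if)
    have "AE x in M. h x * f x = 0"
      using integral_nonneg_eq_0_iff_AE[OF orth_int[OF f] nn] orth[OF f] by blast
    then show ?thesis by eventually_elim (auto simp: f_def indicator_def sgn_if split: if_splits)
  qed
  then have "AE x in M. \<forall>n. x \<in> \<Omega> \<inter> K n \<longrightarrow> h x = 0" by (intro AE_all_countable[THEN iffD2] allI)
  then have "AE x in M. TD (indicat_real \<Omega>) x = indicat_real \<Omega> x"
  proof eventually_elim
    case (elim x)
    obtain n where "x \<in> K n" using K(2) by blast
    then show ?case using elim by (auto simp: TD_def h_def indicator_def)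
  qed
  with ext show "\<exists>T. Linf_extension M \<Omega> (SD t) T \<and> (AE x in M. T (indicat_real \<Omega>) x = indicat_real \<Omega> x)"
    by blast
qed

end

theorem theorem1p1:
  fixes M :: "'a::metric_space measure"
    and D :: "('a \<Rightarrow> real) set"
    and E :: "('a \<Rightarrow> real) \<Rightarrow> ('a \<Rightarrow> real) \<Rightarrow> real"
    and S SD :: "real \<Rightarrow> ('a \<Rightarrow> real) \<Rightarrow> ('a \<Rightarrow> real)"
    and \<Omega> :: "'a set"
    and I II III invariant :: bool
  assumes "locally compact (UNIV :: 'a set)"
    and "sigma_compact (UNIV :: 'a set)"
    and "radon_measure M"
    and "measure_support M = UNIV"
    and "dirichlet_form M D E"
    and "local_form M D E"
    and "dense_in_C0 (D \<inter> Cc_space)"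
    and "associated_semigroup M UNIV D E S"
    and "open \<Omega>"
    and "associated_semigroup M \<Omega> (dirichlet_domain M D E \<Omega>) E SD"
  defines "I \<equiv> conservative M \<Omega> SD"
    and "II \<equiv> (\<forall>\<phi>\<in>L2_space M \<Omega>. \<forall>t>0. AE x in M. S t \<phi> x = SD t \<phi> x)"
    and "III \<equiv> rel_cap M D E \<Omega> (frontier \<Omega>) = 0"
    and "invariant \<equiv> (\<forall>t>0. \<forall>\<phi>\<in>L2_space M \<Omega>. S t \<phi> \<in> L2_space M \<Omega>)"
  shows "(I \<longrightarrow> II) \<and> (II \<longrightarrow> III) \<and> (I \<longrightarrow> invariant) \<and> (II \<longrightarrow> invariant) \<and>
         (conservative M UNIV S \<longrightarrow> II \<longrightarrow> I) \<and>
         (regular_form M D E \<longrightarrow> III \<longrightarrow> II)"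
proof -
  interpret dirichlet_setting M D E \<Omega> S SD
    using assms(1-10) by unfold_locales
  have I_II: "I \<longrightarrow> II"
    unfolding I_def II_def using conservative_imp_agree by blast
  moreover have agree: "AE x in M. S t f x = SD t f x" if II "f \<in> L2_space M \<Omega>" "t > 0" for f t
    using that unfolding II_def by blast
  moreover have "II \<longrightarrow> III"
    unfolding III_def using agree_rel_cap[OF agree_indicator_mem[OF agree]] by blast
  moreover have "II \<longrightarrow> invariant"
    unfolding invariant_def
  proof (intro impI allI ballI)
    fix t :: real and f assume II and t: "t > 0" and f: "f \<in> L2_space M \<Omega>"
    have t0: "t \<ge> 0" using t by simp
    have "AE x in M. SD t f x = S t f x" using agree[OF \<open>II\<close> f t] by eventually_elim simp
    then show "S t f \<in> L2_space M \<Omega>"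
      by (rule L2_space_cong[OF G.S_mem[OF t0 f] F.S_meas[OF t0 L2_space_UNIV[OF f]]])
  qed
  moreover have "conservative M UNIV S \<longrightarrow> II \<longrightarrow> I"
    unfolding I_def using agree_conservative[OF agree] by blast
  moreover have "regular_form M D E \<longrightarrow> III \<longrightarrow> II"
    unfolding II_def III_def using indicator_mem_imp_agree[OF rel_cap_indicator_mem] by blast
  ultimately show ?thesis by blast
qed

end
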